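(* Let $d\ge1$. For any Borel probability measure $\mu_0$ on $\mathbb{R}^d$, the classical solution $(u,R)$ to the free boundary problem (FBP) with initial measure $\mu_0$ (defined in the context) satisfies $$\lim_{t\to\infty}R_t=R_\infty\qquad\text{and}\qquad\lim_{t\to\infty}\|u(\cdot,t)-U(\cdot)\|_{L^\infty}=0,$$ where $R_\infty>0$ is the unique value for which the Dirichlet eigenvalue problem for $-\Delta$ on the ball of radius $R_\infty$ stated in the context has a solution with eigenvalue $\lambda=1$, and $U$ is the corresponding normalized positive eigenfunction, extended by $0$.
   Context: $\mathcal{B}(r)=\{x\in\mathbb{R}^d:\|x\|<r\}$. Free boundary problem (FBP) with initial measure $\mu_0$: find $u:\mathbb{R}^d\times(0,\infty)\to[0,\infty)$ and $R:(0,\infty)\to[0,\infty]$, $t\mapsto R_t$, such that - $\partial_t u=\Delta u+u$ for $t>0$ and $\|x\|<R_t$; - $u(x,t)=0$ for $t>0$ and $\|x\|\ge R_t$; - $u$ is continuous on $\mathbb{R}^d\times(0,\infty)$; - $\int_{\mathbb{R}^d}u(x,t)\,dx=1$ for all $t>0$; - $u(\cdot,t)\to\mu_0$ weakly as $t\searrow0$ (weak convergence of the measures $u(x,t)\,dx$). A pair $(u,R)$ is a classical solution if $R$ is measurable, $u\in C(\mathbb{R}^d\times(0,\infty))\cap C^{2,1}(\Omega^+)$ where $\Omega^+=\{(x,t)\in\mathbb{R}^d\times(0,\infty):\|x\|<R_t\}$, and all the conditions above hold. For every Borel probability measure $\mu_0$ there is exactly one classical solution. Eigenvalue problem: there is a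 unique $R_\infty>0$ such that the problem $-\Delta U=\lambda U$ for $\|x\|<R_\infty$, $U>0$ for $\|x\|<R_\infty$, $U=0$ for $\|x\|=R_\infty$, has a solution $(U,\lambda)$ with $\lambda=1$. The eigenfunction $U$ is unique up to a multiplicative factor; it is normalized by $\int_{\mathcal{B}(R_\infty)}U(x)\,dx=1$ and extended to $\mathbb{R}^d$ by $U(x)=0$ for $\|x\|>R_\infty$. *)

theory Defs
  imports "HOL-Probability.Probability"
begin

text \<open>Classical derivatives of real functions on a Euclidean space, in coordinate directions
  \<^term>\<open>i \<in> Basis\<close>. As \<^const>\<open>deriv\<close> is total, existence of the derivative is always required
  separately.\<close>

definition partially_differentiable :: "'a::euclidean_space \<Rightarrow> ('a \<Rightarrow> real) \<Rightarrow> 'a \<Rightarrow> bool" where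
  "partially_differentiable i f x \<longleftrightarrow> (\<lambda>h. f (x + h *\<^sub>R i)) field_differentiable (at 0)"

definition partial_deriv :: "'a::euclidean_space \<Rightarrow> ('a \<Rightarrow> real) \<Rightarrow> 'a \<Rightarrow> real" where
  "partial_deriv i f x = deriv (\<lambda>h. f (x + h *\<^sub>R i)) 0"

definition laplacian :: "('a::euclidean_space \<Rightarrow> real) \<Rightarrow> 'a \<Rightarrow> real" where
  "laplacian f x = (\<Sum>i\<in>Basis. partial_deriv i (partial_deriv i f) x)"

definition C2_on :: "'a::euclidean_space set \<Rightarrow> ('a \<Rightarrow> real) \<Rightarrow> bool" where
  "C2_on S f \<longleftrightarrow>
     continuous_on S f \<and>
     (\<forall>i\<in>Basis.
        (\<forall>x\<in>S. partially_differentiable i f x) \<and>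
        continuous_on S (partial_deriv i f) \<and>
        (\<forall>j\<in>Basis.
           (\<forall>x\<in>S. partially_differentiable j (partial_deriv i f) x) \<and>
           continuous_on S (partial_deriv j (partial_deriv i f))))"

text \<open>The class \<open>C\<^sup>2\<^sup>,\<^sup>1\<close>: two derivatives in space, one in time. The set \<open>\<Omega>\<close> below is not known to
  be open a priori; the derivatives are those of the function \<open>u\<close>, which is defined for all
  space-time points, at the points of \<open>\<Omega>\<close>, and they are required to be continuous on \<open>\<Omega>\<close>.\<close>

definition C21_on :: "('a::euclidean_space \<times> real) set \<Rightarrow> ('a \<Rightarrow> real \<Rightarrow> real) \<Rightarrow> bool" where
  "C21_on \<Omega> u \<longleftrightarrow>
     continuous_on \<Omega> (\<lambda>(x, t). u x t) \<and>
     (\<forall>(x, t)\<in>\<Omega>. u x field_differentiable (at t)) \<and>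
     continuous_on \<Omega> (\<lambda>(x, t). deriv (u x) t) \<and>
     (\<forall>i\<in>Basis.
        (\<forall>(x, t)\<in>\<Omega>. partially_differentiable i (\<lambda>y. u y t) x) \<and>
        continuous_on \<Omega> (\<lambda>(x, t). partial_deriv i (\<lambda>y. u y t) x) \<and>
        (\<forall>j\<in>Basis.
           (\<forall>(x, t)\<in>\<Omega>. partially_differentiable j (partial_deriv i (\<lambda>y. u y t)) x) \<and>
           continuous_on \<Omega> (\<lambda>(x, t). partial_deriv j (partial_deriv i (\<lambda>y. u y t)) x)))"

definition weakly_converges ::
    "('b \<Rightarrow> 'a::euclidean_space measure) \<Rightarrow> 'a measure \<Rightarrow> 'b filter \<Rightarrow> bool" where
  "weakly_converges M \<mu> F \<longleftrightarrow>
     (\<forall>f :: 'a \<Rightarrow> real. continuous_on UNIV f \<and> bounded (range f) \<longrightarrow>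
        ((\<lambda>t. \<integral>x. f x \<partial>M t) \<longlongrightarrow> (\<integral>x. f x \<partial>\<mu>)) F)"

definition positive_region :: "(real \<Rightarrow> ennreal) \<Rightarrow> ('a::euclidean_space \<times> real) set" where
  "positive_region R = {(x, t). 0 < t \<and> ennreal (norm x) < R t}"

text \<open>Only the values \<open>u x t\<close> and \<open>R t\<close> with \<^prop>\<open>0 < t\<close> are constrained.\<close>

definition classical_solution ::
    "'a::euclidean_space measure \<Rightarrow> ('a \<Rightarrow> real \<Rightarrow> real) \<Rightarrow> (real \<Rightarrow> ennreal) \<Rightarrow> bool" where
  "classical_solution \<mu>0 u R \<longleftrightarrow>
     R \<in> borel_measurable (restrict_space borel {0<..}) \<and>
     (\<forall>t>0. \<forall>x. 0 \<le> u x t) \<and>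
     continuous_on (UNIV \<times> {0<..}) (\<lambda>(x, t). u x t) \<and>
     C21_on (positive_region R) u \<and>
     (\<forall>(x, t)\<in>positive_region R. deriv (u x) t = laplacian (\<lambda>y. u y t) x + u x t) \<and>
     (\<forall>t>0. \<forall>x. R t \<le> ennreal (norm x) \<longrightarrow> u x t = 0) \<and>
     (\<forall>t>0. (\<integral>x. u x t \<partial>lborel) = 1) \<and>
     weakly_converges (\<lambda>t. density lborel (\<lambda>x. ennreal (u x t))) \<mu>0 (at_right 0)"

definition dirichlet_eigenproblem :: "real \<Rightarrow> ('a::euclidean_space \<Rightarrow> real) \<Rightarrow> real \<Rightarrow> bool" where
  "dirichlet_eigenproblem r U \<kappa> \<longleftrightarrow>
     C2_on (ball 0 r) U \<and> continuous_on (cball 0 r) U \<and>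
     (\<forall>x. norm x < r \<longrightarrow> - laplacian U x = \<kappa> * U x) \<and>
     (\<forall>x. norm x < r \<longrightarrow> 0 < U x) \<and>
     (\<forall>x. norm x = r \<longrightarrow> U x = 0)"

definition normalized_ground_state :: "real \<Rightarrow> ('a::euclidean_space \<Rightarrow> real) \<Rightarrow> bool" where
  "normalized_ground_state r U \<longleftrightarrow>
     0 < r \<and> dirichlet_eigenproblem r U 1 \<and>
     (LINT x:ball 0 r|lborel. U x) = 1 \<and>
     (\<forall>x. r < norm x \<longrightarrow> U x = 0)"

end

theory Submission
  imports Defs
begin

text \<open>
  The mass \<open>M r t\<close> of the ball of radius \<open>r\<close> equals \<open>r\<^sup>d A r t\<close>, where \<open>A\<close> solves the radial
  heat equation \<open>\<partial>\<^sub>t A = \<Delta> A + A\<close> in dimension \<open>d + 2\<close> wherever \<open>M < 1\<close>. Hence \<open>M\<close> solves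
  an obstacle problem with obstacle 1, for which a comparison principle holds. Let \<open>V\<close> be the
  mass function of \<open>U\<close>. For \<open>q > 1\<close> the function \<open>c(t) V(q r)\<close> with
  \<open>c' = (1 - q\<^sup>2) c\<close>, \<open>c \<ge> 1\<close>, is a supersolution, and for \<open>q < 1\<close> with \<open>c \<le> 1\<close> a
  subsolution. Running them until \<open>c = 1\<close> gives \<open>V(q r) \<le> M r t \<le> V(q' r)\<close> for all
  \<open>q < 1 < q'\<close> and large \<open>t\<close>, so \<open>M\<close> converges to \<open>V\<close> and the supports converge.
  A moving plane argument, based on the fact that the principal eigenvalue of a half ball of
  radius slightly larger than \<open>R\<^sub>\<infinity>\<close> exceeds 1, shows
  \<open>u(x, t) \<le> u(y, t) + C exp(-\<kappa> t)\<close> whenever \<open>|y| \<le> |x|\<close>. Averages of such an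
  almost radially decreasing function over thin annuli control its values, which turns convergence
  of \<open>M\<close> into uniform convergence of \<open>u\<close>.
\<close>

section \<open>Calculus\<close>

text \<open>\<open>R\<close> is only measurable, and derivatives of \<open>u\<close> are available
  only in the positive region, so \<open>u\<close> itself cannot be compared with a barrier at the
  free boundary. The mass avoids this. Where \<open>M r t < 1\<close>, a slightly larger ball lies
  in the positive region for all nearby times, so \<open>A\<close> satisfies its equation
  classically. Where \<open>M r t = 1\<close>, \<open>u\<close> vanishes from that radius on, and
  the resulting flatness of \<open>M\<close> just inside replaces a boundary condition. Dividing
  \<open>M\<close> by \<open>r^d\<close> removes the zero that all mass functions share at the
  origin, so that ratios of \<open>A\<close> to a barrier stay bounded. The barrier belongs to
  \<open>q^d U(q x)\<close>, a Dirichlet eigenfunction with eigenvalue \<open>q\<^sup>2\<close>;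
  hence the rate \<open>1 - q\<^sup>2\<close>. An upper barrier must reach the obstacle at
  \<open>\<rho> / q\<close>, a lower one must stay below it; this is why \<open>c\<close> stays on
  one side of 1 and is frozen once it gets there. \<open>R t\<close> may a priori exceed the radius
  of the support of \<open>u\<close>, so its upper bound needs an argument of its own. That
  \<open>U\<close> is radially decreasing is not assumed: it follows from the reflection estimate
  applied to the stationary solution.\<close>

lemma real_local_max_second_derivative:
  fixes g :: "real \<Rightarrow> real"
  assumes g': "\<forall>\<^sub>F s in nhds r. (g has_real_derivative g' s) (at s)"
    and g'': "(g' has_real_derivative g'') (at r)"
    and mx: "\<forall>\<^sub>F s in nhds r. g s \<le> g r"
  shows "g' r = 0" and "g'' \<le> 0"
proof -
  obtain d where d: "d > 0" "\<And>s. \<bar>s - r\<bar> < d \<Longrightarrow> (g has_real_derivative g' s) (at s) \<and> g s \<le> g r"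
    using eventually_conj[OF g' mx] unfolding eventually_nhds_metric by (auto simp: dist_real_def)
  show z: "g' r = 0"
    by (rule DERIV_local_max[of g _ r d]) (use d in \<open>auto simp: abs_minus_commute\<close>)
  show "g'' \<le> 0"
  proof (rule ccontr)
    assume "\<not> g'' \<le> 0"
    then obtain e where e: "e > 0" "\<And>h. h > 0 \<Longrightarrow> h < e \<Longrightarrow> g' r < g' (r + h)"
      using DERIV_pos_inc_right[OF g''] by auto
    define h where "h = min d e / 2"
    have h: "0 < h" "h < d" "h < e" using d e by (auto simp: h_def)
    have "\<exists>s. r < s \<and> s < r + h \<and> g (r + h) - g r = (r + h - r) * g' s"
      by (rule MVT2) (use h d in auto)
    then obtain s where s: "r < s" "s < r + h" "g (r + h) - g r = (r + h - r) * g' s"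
      by blast
    have "g' s > 0" using e(2)[of "s - r"] s h z by auto
    then have "g (r + h) > g r" using s h by (simp add: algebra_simps)
    moreover have "g (r + h) \<le> g r" using d(2)[of "r+h"] h by auto
    ultimately show False by simp
  qed
qed

text \<open>The partial sums \<open>\<Sum>i\<in>B. (h \<bullet> i) i\<close> lead from \<open>x\<close> to \<open>x + h\<close> one coordinate at a time.\<close>

lemma has_derivative_of_continuous_partials:
  fixes f :: "'a::euclidean_space \<Rightarrow> real"
  assumes S: "open S" "x \<in> S"
    and pd: "\<And>i y. i \<in> Basis \<Longrightarrow> y \<in> S \<Longrightarrow> partially_differentiable i f y"
    and ct: "\<And>i. i \<in> Basis \<Longrightarrow> continuous_on S (partial_deriv i f)"
  shows "(f has_derivative (\<lambda>h. \<Sum>i\<in>Basis. (h \<bullet> i) * partial_deriv i f x)) (at x)"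
  unfolding has_derivative_at_alt
proof (intro conjI allI impI)
  show "bounded_linear (\<lambda>h. \<Sum>i\<in>Basis. (h \<bullet> i) * partial_deriv i f x)"
    by (intro bounded_linear_sum bounded_linear_mult_const bounded_linear_inner_left)
  fix e :: real assume "e > 0"
  define e' where "e' = e / DIM('a)"
  have e': "e' > 0" using \<open>e > 0\<close> by (simp add: e'_def)
  have ev: "\<forall>\<^sub>F y in nhds x. y \<in> S \<and> (\<forall>i\<in>Basis. \<bar>partial_deriv i f y - partial_deriv i f x\<bar> < e')"
  proof (rule eventually_conj)
    show "\<forall>\<^sub>F y in nhds x. y \<in> S" using S eventually_nhds by blast
    show "\<forall>\<^sub>F y in nhds x. \<forall>i\<in>Basis. \<bar>partial_deriv i f y - partial_deriv i f x\<bar> < e'"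
    proof (rule eventually_ball_finite[OF finite_Basis], rule ballI)
      fix i :: 'a assume i: "i \<in> Basis"
      have "isCont (partial_deriv i f) x" using ct[OF i] S continuous_on_eq_continuous_at by blast
      then have "(partial_deriv i f \<longlongrightarrow> partial_deriv i f x) (nhds x)"
        by (simp add: isCont_def tendsto_at_iff_tendsto_nhds)
      from tendstoD[OF this e'] show "\<forall>\<^sub>F y in nhds x. \<bar>partial_deriv i f y - partial_deriv i f x\<bar> < e'"
        by (simp add: dist_real_def)
    qed
  qed
  obtain d where d: "d > 0" "\<And>y. dist y x < d \<Longrightarrow> y \<in> S"
      "\<And>y i. dist y x < d \<Longrightarrow> i \<in> Basis \<Longrightarrow> \<bar>partial_deriv i f y - partial_deriv i f x\<bar> < e'"
    using ev unfolding eventually_nhds_metric by auto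
  show "\<exists>d>0. \<forall>y. norm (y - x) < d \<longrightarrow>
      norm (f y - f x - (\<Sum>i\<in>Basis. ((y - x) \<bullet> i) * partial_deriv i f x)) \<le> e * norm (y - x)"
  proof (intro exI[of _ d] conjI allI impI \<open>d > 0\<close>)
    fix y assume y: "norm (y - x) < d"
    define h where "h = y - x"
    define P where "P = (\<lambda>B. \<Sum>i\<in>B. (h \<bullet> i) *\<^sub>R i)"
    have "\<bar>f (x + P B) - f x - (\<Sum>i\<in>B. (h \<bullet> i) * partial_deriv i f x)\<bar> \<le> e' * (\<Sum>i\<in>B. \<bar>h \<bullet> i\<bar>)"
      if "B \<subseteq> Basis" for B
      using finite_subset[OF that finite_Basis] that
    proof (induction B rule: finite_induct)
      case empty then show ?case by (simp add: P_def)
    next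
      case (insert j B)
      then have j: "j \<in> Basis" "B \<subseteq> Basis" by auto
      have PB: "P (insert j B) = P B + (h \<bullet> j) *\<^sub>R j"
        using insert by (simp add: P_def add.commute)
      have nrm: "norm (P B + s *\<^sub>R j) < d" if "\<bar>s\<bar> \<le> \<bar>h \<bullet> j\<bar>" for s
      proof -
        have "norm (P B + s *\<^sub>R j) \<le> norm h"
        proof (rule norm_le_componentwise)
          fix b :: 'a assume b: "b \<in> Basis"
          have "P B \<bullet> b = (\<Sum>i\<in>B. if i = b then h \<bullet> b else 0)"
            unfolding P_def inner_sum_left
            by (rule sum.cong) (use b j in \<open>auto simp: inner_Basis\<close>)
          then have "P B \<bullet> b = (if b \<in> B then h \<bullet> b else 0)" using insert by simp
          then show "\<bar>(P B + s *\<^sub>R j) \<bullet> b\<bar> \<le> \<bar>h \<bullet> b\<bar>"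
            using insert j b that by (auto simp: inner_left_distrib inner_Basis)
        qed
        then show ?thesis using y by (simp add: h_def)
      qed
      define F where "F = (\<lambda>s. f (x + P B + s *\<^sub>R j) - s * partial_deriv j f x)"
      have der: "(F has_real_derivative (partial_deriv j f (x + P B + s *\<^sub>R j) - partial_deriv j f x)) (at s)"
        if "\<bar>s\<bar> \<le> \<bar>h \<bullet> j\<bar>" for s
      proof -
        have "x + P B + s *\<^sub>R j \<in> S" using nrm[OF that] by (intro d(2)) (simp add: dist_norm algebra_simps)
        from pd[OF j(1) this] have "((\<lambda>k. f (x + P B + s *\<^sub>R j + k *\<^sub>R j)) has_real_derivative
            partial_deriv j f (x + P B + s *\<^sub>R j)) (at 0)"
          unfolding partially_differentiable_def partial_deriv_def
          by (simp add: field_differentiable_derivI)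
        then have "((\<lambda>k. f (x + P B + (k + s) *\<^sub>R j)) has_real_derivative
            partial_deriv j f (x + P B + s *\<^sub>R j)) (at 0)"
          by (simp add: algebra_simps scaleR_add_left)
        then have "((\<lambda>k. f (x + P B + k *\<^sub>R j)) has_real_derivative
            partial_deriv j f (x + P B + s *\<^sub>R j)) (at s)"
          using DERIV_shift[where f="\<lambda>k. f (x + P B + k *\<^sub>R j)" and x=0 and z=s] by simp
        then show ?thesis unfolding F_def by (auto intro!: derivative_eq_intros)
      qed
      have "norm (F (h \<bullet> j) - F 0) \<le> e' * norm (h \<bullet> j - 0)"
      proof (rule field_differentiable_bound[of "closed_segment 0 (h \<bullet> j)"])
        fix s assume "s \<in> closed_segment 0 (h \<bullet> j)"
        then have s: "\<bar>s\<bar> \<le> \<bar>h \<bullet> j\<bar>" by (auto simp: closed_segment_eq_real_ivl split: if_splits)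
        show "(F has_real_derivative (partial_deriv j f (x + P B + s *\<^sub>R j) - partial_deriv j f x))
            (at s within closed_segment 0 (h \<bullet> j))"
          using der[OF s] by (rule has_field_derivative_at_within)
        have "dist (x + P B + s *\<^sub>R j) x < d" using nrm[OF s] by (simp add: dist_norm algebra_simps)
        from d(3)[OF this j(1)]
        show "norm (partial_deriv j f (x + P B + s *\<^sub>R j) - partial_deriv j f x) \<le> e'" by simp
      qed auto
      then have "\<bar>f (x + P (insert j B)) - f (x + P B) - (h \<bullet> j) * partial_deriv j f x\<bar> \<le> e' * \<bar>h \<bullet> j\<bar>"
        by (simp add: F_def PB add.assoc algebra_simps)
      with insert.IH[OF j(2)] show ?case
        using insert.hyps by (simp add: algebra_simps)
    qed
    from this[of Basis] have "\<bar>f (x + P Basis) - f x - (\<Sum>i\<in>Basis. (h \<bullet> i) * partial_deriv i f x)\<bar>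
        \<le> e' * (\<Sum>i\<in>Basis. \<bar>h \<bullet> i\<bar>)" by simp
    also have "\<dots> \<le> e' * (DIM('a) * norm h)"
      using e' sum_bounded_above[of Basis "\<lambda>i. \<bar>h \<bullet> i\<bar>" "norm h"]
      by (intro mult_left_mono) (auto simp: Basis_le_norm)
    finally show "norm (f y - f x - (\<Sum>i\<in>Basis. ((y - x) \<bullet> i) * partial_deriv i f x)) \<le> e * norm (y - x)"
      by (simp add: P_def h_def e'_def euclidean_representation)
  qed
qed

lemma set_integrable_compact_continuous:
  fixes f :: "'a::euclidean_space \<Rightarrow> real"
  assumes "compact K" "continuous_on K f"
  shows "set_integrable lborel K f"
  using borel_integrable_compact[OF assms] by (simp add: set_integrable_def)

lemma abs_set_integral_le:
  fixes f :: "'a::euclidean_space \<Rightarrow> real"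
  assumes K: "compact K" and f: "set_integrable lborel K f" and b: "\<And>z. z \<in> K \<Longrightarrow> \<bar>f z\<bar> \<le> B"
  shows "\<bar>LINT z:K|lborel. f z\<bar> \<le> B * measure lborel K"
proof -
  have i: "set_integrable lborel K (\<lambda>_. B)"
    by (rule set_integrable_compact_continuous[OF K]) auto
  have "\<bar>LINT z:K|lborel. f z\<bar> \<le> (LINT z:K|lborel. \<bar>f z\<bar>)"
    using set_integral_norm_bound[OF f] by simp
  also have "\<dots> \<le> (LINT z:K|lborel. B)"
    by (rule set_integral_mono) (use f b i in \<open>auto simp: set_integrable_abs\<close>)
  also have "\<dots> = B * measure lborel K"
    using K by (simp add: set_lebesgue_integral_def borel_compact emeasure_compact_finite)
  finally show ?thesis .
qed

lemma continuous_on_set_integral_param: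
  fixes f :: "'b::metric_space \<Rightarrow> 'a::euclidean_space \<Rightarrow> real"
  assumes K: "compact K" and c: "continuous_on (T \<times> K) (\<lambda>(s, z). f s z)"
  shows "continuous_on T (\<lambda>s. LINT z:K|lborel. f s z)"
  unfolding continuous_on_def
proof
  fix s0 assume s0: "s0 \<in> T"
  have ic: "set_integrable lborel K (f s)" if "s \<in> T" for s
    by (rule set_integrable_compact_continuous[OF K])
       (use that in \<open>auto intro!: continuous_on_compose2[OF c, of _ "\<lambda>z. (s, z)", simplified] continuous_intros\<close>)
  show "((\<lambda>s. LINT z:K|lborel. f s z) \<longlongrightarrow> (LINT z:K|lborel. f s0 z)) (at s0 within T)"
  proof (rule tendstoI)
    fix e :: real assume e: "e > 0"
    define e' where "e' = e / (measure lborel K + 1)"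
    have "0 < measure lborel K + 1" by (rule add_nonneg_pos) auto
    then have e': "e' > 0" "e' * measure lborel K < e" using e
      by (auto simp: e'_def field_simps)
    obtain X0 where X: "s0 \<in> X0" "open X0"
      "\<forall>s\<in>X0 \<inter> T. \<forall>z\<in>K. dist (f s z) (f s0 z) \<le> e'"
      using continuous_on_prod_compactE[OF c K s0 e'(1)] by auto
    have "\<forall>\<^sub>F s in at s0 within T. s \<in> X0 \<inter> T"
      using X unfolding eventually_at_topological by auto
    then show "\<forall>\<^sub>F s in at s0 within T. dist (LINT z:K|lborel. f s z) (LINT z:K|lborel. f s0 z) < e"
    proof eventually_elim
      case (elim s)
      then have s: "s \<in> T" "\<And>z. z \<in> K \<Longrightarrow> \<bar>f s z - f s0 z\<bar> \<le> e'" using X by (auto simp: dist_real_def)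
      have "\<bar>LINT z:K|lborel. f s z - f s0 z\<bar> \<le> e' * measure lborel K"
        by (rule abs_set_integral_le[OF K]) (use s s0 ic in auto)
      then show ?case using e' ic[OF s(1)] ic[OF s0] by (simp add: dist_real_def set_integral_diff)
    qed
  qed
qed

text \<open>Compactness of \<open>K\<close> makes \<open>f' s z\<close> uniformly close to
  \<open>f' s0 z\<close> for \<open>s\<close> near \<open>s0\<close>. The mean value inequality for
  \<open>f s z - f' s0 z * s\<close> then bounds the remainder uniformly in \<open>z\<close>, and
  this bound can be integrated.\<close>

lemma has_real_derivative_set_integral_param:
  fixes f :: "real \<Rightarrow> 'a::euclidean_space \<Rightarrow> real"
  assumes K: "compact K" and U: "open U" "convex U" "s0 \<in> U"
    and f: "\<And>s. s \<in> U \<Longrightarrow> continuous_on K (f s)"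
    and d: "\<And>s z. s \<in> U \<Longrightarrow> z \<in> K \<Longrightarrow> ((\<lambda>s. f s z) has_real_derivative f' s z) (at s)"
    and c: "continuous_on (U \<times> K) (\<lambda>(s, z). f' s z)"
  shows "((\<lambda>s. LINT z:K|lborel. f s z) has_real_derivative (LINT z:K|lborel. f' s0 z)) (at s0)"
  unfolding has_field_derivative_def has_derivative_at_alt
proof (intro conjI allI impI)
  show "bounded_linear ((*) (LINT z:K|lborel. f' s0 z))" by (rule bounded_linear_mult_right)
  fix e :: real assume e: "e > 0"
  have if': "set_integrable lborel K (f s)" if "s \<in> U" for s
    using set_integrable_compact_continuous[OF K f[OF that]] .
  have iff': "set_integrable lborel K (f' s0)"
    by (rule set_integrable_compact_continuous[OF K])
       (use U in \<open>auto intro!: continuous_on_compose2[OF c, of _ "\<lambda>z. (s0, z)", simplified] continuous_intros\<close>)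
  define e' where "e' = e / (measure lborel K + 1)"
  have "0 < measure lborel K + 1" by (rule add_nonneg_pos) auto
  then have e': "e' > 0" "e' * measure lborel K \<le> e" using e
    by (auto simp: e'_def field_simps)
  obtain X0 where X: "s0 \<in> X0" "open X0"
    "\<forall>s\<in>X0 \<inter> U. \<forall>z\<in>K. dist (f' s z) (f' s0 z) \<le> e'"
    using continuous_on_prod_compactE[OF c K U(3) e'(1)] by auto
  have "open (X0 \<inter> U)" "s0 \<in> X0 \<inter> U" using X U by auto
  then obtain r where r: "r > 0" "ball s0 r \<subseteq> X0 \<inter> U" using open_contains_ball by blast
  show "\<exists>r>0. \<forall>s. norm (s - s0) < r \<longrightarrow>
     norm ((LINT z:K|lborel. f s z) - (LINT z:K|lborel. f s0 z) - (LINT z:K|lborel. f' s0 z) * (s - s0))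
       \<le> e * norm (s - s0)"
  proof (intro exI[of _ r] conjI allI impI r(1))
    fix s assume s: "norm (s - s0) < r"
    have seg: "closed_segment s0 s \<subseteq> X0 \<inter> U"
      using r s by (intro order.trans[OF closed_segment_subset[OF _ _ convex_ball] r(2)])
        (auto simp: dist_norm norm_minus_commute)
    have sU: "s \<in> U" using seg by auto
    have "\<bar>f s z - f s0 z - f' s0 z * (s - s0)\<bar> \<le> e' * \<bar>s - s0\<bar>" if z: "z \<in> K" for z
    proof -
      have "norm ((f s z - f' s0 z * s) - (f s0 z - f' s0 z * s0)) \<le> e' * norm (s - s0)"
      proof (rule field_differentiable_bound[where S="closed_segment s0 s"])
        fix t assume t: "t \<in> closed_segment s0 s"
        then have t': "t \<in> X0 \<inter> U" using seg by auto
        show "((\<lambda>s. f s z - f' s0 z * s) has_real_derivative f' t z - f' s0 z) (at t within closed_segment s0 s)"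
          using d[of t z] t' z
          by (auto intro!: derivative_eq_intros intro: has_field_derivative_at_within)
        show "norm (f' t z - f' s0 z) \<le> e'" using X(3) t' z by (auto simp: dist_real_def)
      qed auto
      then show ?thesis by (simp add: algebra_simps)
    qed
    then have "\<bar>LINT z:K|lborel. f s z - f s0 z - f' s0 z * (s - s0)\<bar> \<le> (e' * \<bar>s - s0\<bar>) * measure lborel K"
      by (intro abs_set_integral_le[OF K])
         (use if'[OF sU] if'[OF U(3)] iff' in auto)
    also have "\<dots> \<le> e * \<bar>s - s0\<bar>"
      using mult_right_mono[OF e'(2), of "\<bar>s - s0\<bar>"] by (simp add: mult_ac)
    finally show "norm ((LINT z:K|lborel. f s z) - (LINT z:K|lborel. f s0 z) - (LINT z:K|lborel. f' s0 z) * (s - s0))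
       \<le> e * norm (s - s0)"
      using if'[OF sU] if'[OF U(3)] iff' by (simp add: set_integral_diff)
  qed
qed

definition dirderiv :: "('a::euclidean_space \<Rightarrow> real) \<Rightarrow> 'a \<Rightarrow> 'a \<Rightarrow> real" where
  "dirderiv f x v = (\<Sum>i\<in>Basis. (v \<bullet> i) * partial_deriv i f x)"

text \<open>The quadratic form of the second derivative at \<open>x\<close> applied to
  \<open>(v, v)\<close>, which is the second derivative along the line through \<open>x\<close> in
  direction \<open>v\<close>.\<close>

definition hessian :: "('a::euclidean_space \<Rightarrow> real) \<Rightarrow> 'a \<Rightarrow> 'a \<Rightarrow> real" where
  "hessian f x v = (\<Sum>i\<in>Basis. (v \<bullet> i) * dirderiv (partial_deriv i f) x v)"

lemma C2_onD:
  assumes "C2_on S f" "i \<in> Basis" "j \<in> Basis"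
  shows "continuous_on S f" "continuous_on S (partial_deriv i f)"
    "continuous_on S (partial_deriv j (partial_deriv i f))"
    "x \<in> S \<Longrightarrow> partially_differentiable i f x"
    "x \<in> S \<Longrightarrow> partially_differentiable j (partial_deriv i f) x"
  using assms unfolding C2_on_def by auto

lemma has_derivative_imp_line_derivative:
  fixes f :: "'a::euclidean_space \<Rightarrow> real"
  assumes "(f has_derivative (\<lambda>h. \<Sum>i\<in>Basis. (h \<bullet> i) * p i)) (at (y + h *\<^sub>R v))"
  shows "((\<lambda>h. f (y + h *\<^sub>R v)) has_real_derivative (\<Sum>i\<in>Basis. (v \<bullet> i) * p i)) (at h)"
proof -
  have "((\<lambda>h. y + h *\<^sub>R v) has_derivative (\<lambda>k. k *\<^sub>R v)) (at h)"
    by (auto intro!: derivative_eq_intros)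
  from has_derivative_compose[OF this assms]
  have "((\<lambda>h. f (y + h *\<^sub>R v)) has_derivative (\<lambda>k. \<Sum>i\<in>Basis. (k *\<^sub>R v \<bullet> i) * p i)) (at h)" .
  moreover have "(\<lambda>k. \<Sum>i\<in>Basis. (k *\<^sub>R v \<bullet> i) * p i) = (*) (\<Sum>i\<in>Basis. (v \<bullet> i) * p i)"
    by (rule ext) (simp add: sum_distrib_left sum_distrib_right mult_ac)
  ultimately show ?thesis by (simp add: has_field_derivative_def)
qed

lemma C2_on_line_derivative:
  assumes C: "C2_on S f" and S: "open S" and y: "y + h *\<^sub>R v \<in> S"
  shows "((\<lambda>h. f (y + h *\<^sub>R v)) has_real_derivative dirderiv f (y + h *\<^sub>R v) v) (at h)"
  unfolding dirderiv_def
  by (intro has_derivative_imp_line_derivative has_derivative_of_continuous_partials[OF S y])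
     (use C in \<open>auto dest: C2_onD\<close>)

lemma C2_on_line_derivative_partial:
  assumes C: "C2_on S f" and S: "open S" and y: "y + h *\<^sub>R v \<in> S" and i: "i \<in> Basis"
  shows "((\<lambda>h. partial_deriv i f (y + h *\<^sub>R v)) has_real_derivative
           dirderiv (partial_deriv i f) (y + h *\<^sub>R v) v) (at h)"
  unfolding dirderiv_def
  by (intro has_derivative_imp_line_derivative has_derivative_of_continuous_partials[OF S y])
     (use C i in \<open>auto dest: C2_onD\<close>)

lemma C2_on_line_derivative2:
  assumes C: "C2_on S f" and S: "open S" and y: "y + h *\<^sub>R v \<in> S"
  shows "((\<lambda>h. dirderiv f (y + h *\<^sub>R v) v) has_real_derivative hessian f (y + h *\<^sub>R v) v) (at h)"
  unfolding hessian_def dirderiv_def[of f]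
  by (intro DERIV_sum DERIV_cmult C2_on_line_derivative_partial[OF C S y])

section \<open>Integrals over dilated balls\<close>

text \<open>The domain of integration is fixed, so \<open>r\<close> enters only through the
  integrand. The formula makes sense at \<open>r = 0\<close> and for negative \<open>r\<close>, and
  \<open>r ^ DIM('a) * dilint f r\<close> is the integral over the ball of radius \<open>r\<close>
  (\<open>dilint_eq\<close>).\<close>

definition dilint :: "('a::euclidean_space \<Rightarrow> real) \<Rightarrow> real \<Rightarrow> real" where
  "dilint f r = (LINT z:cball 0 1|lborel. f (r *\<^sub>R z))"

lemma scaled_unit_ball: "(z::'a::real_normed_vector) \<in> cball 0 1 \<Longrightarrow> \<bar>r\<bar> < R \<Longrightarrow> r *\<^sub>R z \<in> ball 0 R"
proof -
  assume "z \<in> cball 0 1" "\<bar>r\<bar> < R"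
  then have "norm z \<le> 1" by simp
  then have "\<bar>r\<bar> * norm z \<le> \<bar>r\<bar>" by (rule mult_left_le) simp
  with \<open>\<bar>r\<bar> < R\<close> show "r *\<^sub>R z \<in> ball 0 R" by simp
qed

lemma continuous_on_dilated:
  fixes f :: "'a::real_normed_vector \<Rightarrow> real"
  assumes "continuous_on (ball 0 R) f"
  shows "continuous_on ({-R<..<R} \<times> cball 0 1) (\<lambda>(s, z). f (s *\<^sub>R z))"
  unfolding split_beta
proof (rule continuous_on_compose2[OF assms])
  show "(\<lambda>x. fst x *\<^sub>R snd x) ` ({-R<..<R} \<times> cball 0 1) \<subseteq> ball (0::'a) R"
  proof safe
    fix s and z :: 'a assume "s \<in> {-R<..<R}" "z \<in> cball 0 1"
    then show "fst (s, z) *\<^sub>R snd (s, z) \<in> ball 0 R" using scaled_unit_ball[of z s R] by auto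
  qed
qed (intro continuous_intros)

lemma continuous_on_dilated_slice:
  fixes f :: "'a::real_normed_vector \<Rightarrow> real"
  assumes "continuous_on (ball 0 R) f" "\<bar>r\<bar> < R"
  shows "continuous_on (cball 0 1) (\<lambda>z. f (r *\<^sub>R z))"
proof (rule continuous_on_compose2[OF assms(1)])
  show "continuous_on (cball 0 1) (\<lambda>z::'a. r *\<^sub>R z)" by (intro continuous_intros)
  show "(*\<^sub>R) r ` cball 0 1 \<subseteq> ball (0::'a) R"
    using scaled_unit_ball[OF _ assms(2)] by blast
qed

lemma continuous_on_dilated_dirderiv:
  assumes "\<And>i. i \<in> Basis \<Longrightarrow> continuous_on (ball 0 R) (partial_deriv i f)"
  shows "continuous_on ({-R<..<R} \<times> cball 0 1) (\<lambda>(s, z). dirderiv f (s *\<^sub>R z) z)"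
  unfolding dirderiv_def split_beta
  by (intro continuous_on_sum continuous_on_mult continuous_on_dilated[OF assms, unfolded split_beta])
     (auto intro!: continuous_intros)

lemma continuous_on_dilated_hessian:
  assumes "C2_on (ball 0 R) f"
  shows "continuous_on ({-R<..<R} \<times> cball 0 1) (\<lambda>(s, z). hessian f (s *\<^sub>R z) z)"
  unfolding hessian_def split_beta
  by (intro continuous_on_sum continuous_on_mult continuous_on_dilated_dirderiv[unfolded split_beta])
     (use assms in \<open>auto intro!: continuous_intros dest: C2_onD\<close>)

lemma continuous_on_laplacian:
  assumes "C2_on S f"
  shows "continuous_on S (laplacian f)"
  unfolding laplacian_def[abs_def]
  by (intro continuous_on_sum) (use assms in \<open>auto dest: C2_onD\<close>)

lemma dilint_derivative:
  assumes C: "C2_on (ball 0 R) f" and r: "\<bar>r\<bar> < R"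
  shows "(dilint f has_real_derivative (LINT z:cball 0 1|lborel. dirderiv f (r *\<^sub>R z) z)) (at r)"
  unfolding dilint_def[abs_def]
proof (rule has_real_derivative_set_integral_param[where U="{-R<..<R}"])
  fix s z assume "s \<in> {-R<..<R}" "z \<in> cball (0::'a) 1"
  then show "((\<lambda>s. f (s *\<^sub>R z)) has_real_derivative dirderiv f (s *\<^sub>R z) z) (at s)"
    using C2_on_line_derivative[OF C open_ball, of 0 s z] scaled_unit_ball[of z s R] by auto
next
  fix s assume "s \<in> {-R<..<R}"
  then show "continuous_on (cball 0 1) (\<lambda>z. f (s *\<^sub>R z))"
    using C by (intro continuous_on_dilated_slice[of R]) (auto simp: C2_on_def)
qed (use C r in \<open>auto intro!: continuous_on_dilated_dirderiv dest: C2_onD\<close>)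

lemma dilint_derivative2:
  assumes C: "C2_on (ball 0 R) f" and r: "\<bar>r\<bar> < R"
  shows "((\<lambda>r. LINT z:cball 0 1|lborel. dirderiv f (r *\<^sub>R z) z) has_real_derivative
           (LINT z:cball 0 1|lborel. hessian f (r *\<^sub>R z) z)) (at r)"
proof (rule has_real_derivative_set_integral_param[where U="{-R<..<R}"])
  fix s z assume "s \<in> {-R<..<R}" "z \<in> cball (0::'a) 1"
  then show "((\<lambda>s. dirderiv f (s *\<^sub>R z) z) has_real_derivative hessian f (s *\<^sub>R z) z) (at s)"
    using C2_on_line_derivative2[OF C open_ball, of 0 s z] scaled_unit_ball[of z s R] by auto
next
  have c: "continuous_on ({-R<..<R} \<times> cball 0 1) (\<lambda>(s, z). dirderiv f (s *\<^sub>R z) z)"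
    using C by (intro continuous_on_dilated_dirderiv) (auto dest: C2_onD)
  fix s assume "s \<in> {-R<..<R}"
  then show "continuous_on (cball 0 1) (\<lambda>z. dirderiv f (s *\<^sub>R z) z)"
    by (intro continuous_on_compose2[OF c, of _ "\<lambda>z. (s, z)", simplified]) (auto intro!: continuous_intros)
qed (use C r in \<open>auto intro!: continuous_on_dilated_hessian\<close>)

text \<open>Difference quotients have integral zero by translation invariance. The bound
  \<open>B\<close> makes them Lipschitz-dominated; since the shifts are at most
  \<open>norm v\<close>, they all vanish outside the ball of radius \<open>1 + norm v\<close>, and
  dominated convergence applies.\<close>

lemma integral_line_derivative_zero:
  fixes G :: "'a::euclidean_space \<Rightarrow> real"
  assumes G: "integrable lborel G" "\<And>z. norm z > 1 \<Longrightarrow> G z = 0"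
    and g: "\<And>z. ((\<lambda>h. G (z + h *\<^sub>R v)) has_real_derivative g z) (at 0)"
    and B: "\<And>z. \<bar>g z\<bar> \<le> B"
  shows "integrable lborel g" and "integral\<^sup>L lborel g = 0"
proof -
  have g': "((\<lambda>h. G (z + h *\<^sub>R v)) has_real_derivative g (z + s *\<^sub>R v)) (at s)" for z s
  proof -
    have "((\<lambda>h. G (z + (h + s) *\<^sub>R v)) has_real_derivative g (z + s *\<^sub>R v)) (at 0)"
      using g[of "z + s *\<^sub>R v"] by (simp add: algebra_simps scaleR_add_left)
    then show ?thesis
      using DERIV_shift[where f="\<lambda>h. G (z + h *\<^sub>R v)" and x=0 and z=s] by simp
  qed
  have lip: "\<bar>G (z + h *\<^sub>R v) - G z\<bar> \<le> B * \<bar>h\<bar>" for z h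
    using field_differentiable_bound[of UNIV "\<lambda>h. G (z + h *\<^sub>R v)" "\<lambda>s. g (z + s *\<^sub>R v)" B h 0] g' B
    by auto
  define q where "q = (\<lambda>n z. real (Suc n) * (G (z + inverse (real (Suc n)) *\<^sub>R v) - G z))"
  define D where "D = (\<lambda>z::'a. B * indicator (cball 0 (1 + norm v)) z)"
  have Gm[measurable]: "G \<in> borel_measurable borel" using G(1) by auto
  have sh: "has_bochner_integral lborel (\<lambda>z. G (z + c)) (integral\<^sup>L lborel G)" for c
  proof -
    have "integrable (distr lborel borel ((+) c)) G" "integral\<^sup>L (distr lborel borel ((+) c)) G = integral\<^sup>L lborel G"
      unfolding lborel_distr_plus using G(1) by auto
    then have "has_bochner_integral lborel (\<lambda>z. G (c + z)) (integral\<^sup>L lborel G)"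
      by (simp add: has_bochner_integral_iff integrable_distr_eq integral_distr)
    then show ?thesis by (simp add: add.commute)
  qed
  have q0: "integral\<^sup>L lborel (q n) = 0" for n
    unfolding q_def using sh[of "inverse (real (Suc n)) *\<^sub>R v"] G(1)
    by (simp add: has_bochner_integral_iff)
  have lim: "(\<lambda>n. q n z) \<longlonglongrightarrow> g z" for z
  proof -
    have "((\<lambda>h. (G (z + h *\<^sub>R v) - G z) / h) \<longlongrightarrow> g z) (at 0)"
      using g[of z] unfolding DERIV_def by simp
    moreover have "filterlim (\<lambda>n. inverse (real (Suc n))) (at 0) sequentially"
      unfolding filterlim_at using LIMSEQ_inverse_real_of_nat by auto
    ultimately have "((\<lambda>n. (G (z + inverse (real (Suc n)) *\<^sub>R v) - G z) / inverse (real (Suc n))) \<longlonglongrightarrow> g z)"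
      by (rule filterlim_compose)
    then show ?thesis by (simp add: q_def field_simps)
  qed
  have m: "q n \<in> borel_measurable lborel" for n unfolding q_def by measurable
  have gm: "g \<in> borel_measurable lborel" by (rule borel_measurable_LIMSEQ_real[OF lim m])
  have Di: "integrable lborel D" unfolding D_def
    by (intro integrable_mult_right integrable_real_indicator) (use emeasure_lborel_cball_finite[of "0::'a" "1 + norm v"] in auto)
  have dom: "norm (q n z) \<le> D z" for n z
  proof (cases "norm z \<le> 1 + norm v")
    case True
    have "\<bar>q n z\<bar> \<le> real (Suc n) * (B * \<bar>inverse (real (Suc n))\<bar>)"
      unfolding q_def abs_mult by (intro mult_mono lip) auto
    also have "\<dots> = B" by (simp add: field_simps)
    finally show ?thesis using True by (simp add: D_def)
  next
    case False
    have "norm (inverse (real (Suc n)) *\<^sub>R v) \<le> norm v"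
      by (simp add: mult_left_le_one_le inverse_le_1_iff)
    moreover have "norm z \<le> norm (z + inverse (real (Suc n)) *\<^sub>R v) + norm (inverse (real (Suc n)) *\<^sub>R v)"
      by (metis norm_triangle_ineq4 add_diff_cancel_right')
    ultimately have "norm (z + inverse (real (Suc n)) *\<^sub>R v) > 1" "norm z > 1"
      using False by auto (smt (verit) norm_ge_zero)+
    then show ?thesis using False G(2) by (simp add: D_def q_def)
  qed
  have *: "AE z in lborel. (\<lambda>n. q n z) \<longlonglongrightarrow> g z" "\<And>n. AE z in lborel. norm (q n z) \<le> D z"
    using lim dom by auto
  show "integrable lborel g" by (rule integrable_dominated_convergence[OF gm m Di *])
  have "(\<lambda>n. integral\<^sup>L lborel (q n)) \<longlonglongrightarrow> integral\<^sup>L lborel g"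
    by (rule integral_dominated_convergence[OF gm m Di *])
  then show "integral\<^sup>L lborel g = 0" using q0 by (simp add: LIMSEQ_const_iff)
qed

lemma DERIV_max_zero_square:
  fixes s :: real
  shows "((\<lambda>s::real. (max 0 (1 - s))\<^sup>2) has_real_derivative - 2 * max 0 (1 - s)) (at s)"
proof -
  consider "s < 1" | "s > 1" | "s = 1" by linarith
  then show ?thesis
  proof cases
    case 1
    have "((\<lambda>s::real. (1 - s)\<^sup>2) has_real_derivative - 2 * max 0 (1 - s)) (at s)"
      using 1 by (auto intro!: derivative_eq_intros)
    then show ?thesis
      by (rule has_field_derivative_transform_within_open[of _ _ _ "{..<1}"]) (use 1 in auto)
  next
    case 2
    have "((\<lambda>s::real. 0) has_real_derivative - 2 * max 0 (1 - s)) (at s)"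
      using 2 by (auto intro!: derivative_eq_intros)
    then show ?thesis
      by (rule has_field_derivative_transform_within_open[of _ _ _ "{1<..}"]) (use 2 in auto)
  next
    case 3
    show ?thesis unfolding has_field_derivative_def has_derivative_at_alt 3
    proof (intro conjI allI impI)
      fix e :: real assume "e > 0"
      moreover have "(max 0 (1 - y))\<^sup>2 \<le> e * \<bar>y - 1\<bar>" if "\<bar>y - 1\<bar> < e" for y :: real
      proof -
        have "(max 0 (1 - y))\<^sup>2 \<le> \<bar>y - 1\<bar>\<^sup>2" by (rule power_mono) auto
        also have "\<dots> \<le> e * \<bar>y - 1\<bar>" using that by (simp only: power2_eq_square) (intro mult_right_mono, auto)
        finally show ?thesis .
      qed
      ultimately show "\<exists>d>0. \<forall>y::real. norm (y - 1) < d \<longrightarrow> norm ((max 0 (1 - y))\<^sup>2 - (max 0 (1 - 1))\<^sup>2 - - 2 * max 0 (1 - 1) * (y - 1)) \<le> e * norm (y - 1)"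
        by (intro exI[of _ e]) (auto simp: power_abs)
    qed (auto intro: bounded_linear_mult_right)
  qed
qed

lemma AE_lborel_norm_neq: "AE z in lborel. norm (z::'a::euclidean_space) \<noteq> r"
proof (rule AE_I')
  have "sphere (0::'a) r \<in> null_sets lebesgue"
    using negligible_sphere[of "0::'a" r] by (simp add: negligible_iff_null_sets)
  then show "sphere (0::'a) r \<in> null_sets lborel"
    by (subst (asm) null_sets_completion_iff) auto
qed auto

text \<open>A cutoff to be used with \<open>s = z \<bullet> z\<close>. Squaring the positive part
  makes it differentiable at \<open>s = 1\<close>; it tends to 1 for \<open>s < 1\<close>. By
  \<open>y * exp (- y) \<le> 1\<close> the product of its derivative with \<open>1 - s\<close> is
  bounded uniformly in \<open>n\<close>, which is the domination needed in
  \<open>divergence_identity\<close>.\<close>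

definition cutoff :: "nat \<Rightarrow> real \<Rightarrow> real" where
  "cutoff n s = 1 - exp (- (real n * (max 0 (1 - s))\<^sup>2))"

definition cutoff' :: "nat \<Rightarrow> real \<Rightarrow> real" where
  "cutoff' n s = - (2 * real n * max 0 (1 - s)) * exp (- (real n * (max 0 (1 - s))\<^sup>2))"

lemma DERIV_cutoff: "(cutoff n has_real_derivative cutoff' n s) (at s)"
  unfolding cutoff_def[abs_def] cutoff'_def
  by (rule derivative_eq_intros DERIV_max_zero_square refl | simp)+

lemma continuous_cutoff: "continuous_on S (cutoff n)" "continuous_on S (cutoff' n)"
  unfolding cutoff_def[abs_def] cutoff'_def[abs_def] by (intro continuous_intros)+

lemma cutoff_ge_1: "s \<ge> 1 \<Longrightarrow> cutoff n s = 0" "s \<ge> 1 \<Longrightarrow> cutoff' n s = 0"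
  by (auto simp: cutoff_def cutoff'_def)

lemma cutoff_bounds: "\<bar>cutoff n s\<bar> \<le> 1"
  by (simp add: cutoff_def)

lemma cutoff'_bound:
  assumes "s \<le> 1" shows "\<bar>2 * cutoff' n s * (1 - s)\<bar> \<le> 4"
proof -
  define y where "y = real n * (1 - s)\<^sup>2"
  have y: "y \<ge> 0" by (simp add: y_def)
  have "y \<le> exp y" using exp_ge_add_one_self[of y] by linarith
  then have "y * exp (- y) \<le> 1" by (simp add: exp_minus field_simps)
  moreover have "2 * cutoff' n s * (1 - s) = - 4 * (y * exp (- y))"
    using assms by (simp add: cutoff'_def y_def power2_eq_square algebra_simps)
  moreover have "0 \<le> y * exp (- y)" using y by simp
  ultimately show ?thesis by (simp only: abs_le_iff) linarith
qed

lemma cutoff_limits: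
  assumes "s < 1"
  shows "(\<lambda>n. cutoff n s) \<longlonglongrightarrow> 1" "(\<lambda>n. cutoff' n s) \<longlonglongrightarrow> 0"
proof -
  define x where "x = exp (- (1 - s)\<^sup>2)"
  have x: "\<bar>x\<bar> < 1" using assms by (simp add: x_def)
  have e: "exp (- (real n * (max 0 (1 - s))\<^sup>2)) = x ^ n" for n
    using assms by (simp add: x_def exp_of_nat_mult[symmetric] max_absorb2)
  have "(\<lambda>n. 1 - x ^ n) \<longlonglongrightarrow> 1 - 0"
    by (intro tendsto_intros LIMSEQ_power_zero) (use x in auto)
  then show "(\<lambda>n. cutoff n s) \<longlonglongrightarrow> 1" by (simp add: cutoff_def e)
  have "(\<lambda>n. - (2 * (1 - s)) * (real n * x ^ n)) \<longlonglongrightarrow> - (2 * (1 - s)) * 0"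
    by (intro tendsto_intros powser_times_n_limit_0) (use x in auto)
  moreover have "cutoff' n s = - (2 * (1 - s)) * (real n * x ^ n)" for n
  proof -
    have "max 0 (1 - s) = 1 - s" using assms by simp
    then have "cutoff' n s = - (2 * real n * (1 - s)) * x ^ n" unfolding cutoff'_def e by simp
    then show ?thesis by (simp add: algebra_simps)
  qed
  ultimately show "(\<lambda>n. cutoff' n s) \<longlonglongrightarrow> 0" by simp
qed

lemma sum_inner_Basis: "j \<in> Basis \<Longrightarrow> (\<Sum>i\<in>Basis. (j \<bullet> i) * F i) = F (j::'a::euclidean_space)"
  by (simp add: inner_Basis if_distrib[of "\<lambda>x. x * _"] cong: if_cong)

text \<open>The divergence theorem on the unit ball for the vector field
  \<open>\<nabla>f (r z) - z (z \<bullet> \<nabla>f (r z))\<close>, which is tangential to the unit sphere. Multiplied by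
  \<open>cutoff n (z \<bullet> z)\<close> it extends by zero to the whole space, where translation invariance of
  Lebesgue measure makes the integral of a divergence vanish; the term containing the derivative
  of the cutoff disappears as \<open>n\<close> grows because of the tangentiality.\<close>

lemma divergence_identity:
  fixes f :: "'a::euclidean_space \<Rightarrow> real"
  assumes C: "C2_on (ball 0 R) f" and r: "\<bar>r\<bar> < R"
  shows "r * (LINT z:cball 0 1|lborel. laplacian f (r *\<^sub>R z)) =
         r * (LINT z:cball 0 1|lborel. hessian f (r *\<^sub>R z) z)
         + (DIM('a) + 1) * (LINT z:cball 0 1|lborel. dirderiv f (r *\<^sub>R z) z)"
proof -
  define D where "D = (\<lambda>z. dirderiv f (r *\<^sub>R z) z)"
  define H where "H = (\<lambda>z. hessian f (r *\<^sub>R z) z)"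
  define L where "L = (\<lambda>z. laplacian f (r *\<^sub>R z))"
  define F where "F = (\<lambda>i z. partial_deriv i f (r *\<^sub>R z) - (z \<bullet> i) * D z)"
  \<comment> \<open>\<open>E i\<close> is the derivative of \<open>F i\<close> in direction
    \<open>i\<close>, and \<open>g n i\<close> is that of the product
    \<open>cutoff n (z \<bullet> z) * F i z\<close>.\<close>
  define E where "E = (\<lambda>i z. r * partial_deriv i (partial_deriv i f) (r *\<^sub>R z)
      - (D z + (z \<bullet> i) * (partial_deriv i f (r *\<^sub>R z) + r * (\<Sum>j\<in>Basis. (z \<bullet> j) * partial_deriv i (partial_deriv j f) (r *\<^sub>R z)))))"
  define g where "g = (\<lambda>n i z. cutoff n (z \<bullet> z) * E i z + cutoff' n (z \<bullet> z) * (2 * (z \<bullet> i)) * F i z)"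
  define K where "K = cball (0::'a) 1"
  have inb: "r *\<^sub>R z \<in> ball 0 R" if "z \<in> K" for z using scaled_unit_ball[OF that[unfolded K_def] r] .
  have cp: "continuous_on K (\<lambda>z. h (r *\<^sub>R z))" if "continuous_on (ball 0 R) h" for h :: "'a \<Rightarrow> real"
    unfolding K_def by (rule continuous_on_dilated_slice[OF that r])
  have cz: "continuous_on K (\<lambda>z. cutoff n (z \<bullet> z))" "continuous_on K (\<lambda>z. cutoff' n (z \<bullet> z))" for n
    by (auto intro!: continuous_on_compose2[OF continuous_cutoff(1)[of UNIV]]
        continuous_on_compose2[OF continuous_cutoff(2)[of UNIV]] continuous_intros)
  have p1: "continuous_on (ball 0 R) (partial_deriv i f)" if "i \<in> Basis" for i
    using C that by (auto dest: C2_onD)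
  have p2: "continuous_on (ball 0 R) (partial_deriv j (partial_deriv i f))"
    if "i \<in> Basis" "j \<in> Basis" for i j
    using C that by (auto dest: C2_onD)
  have cD: "continuous_on K D" unfolding D_def dirderiv_def
    by (intro continuous_intros cp p1)
  have cH: "continuous_on K H" unfolding H_def hessian_def dirderiv_def
    by (intro continuous_intros cp p2)
  have cL: "continuous_on K L" unfolding L_def by (rule cp[OF continuous_on_laplacian[OF C]])
  have cF: "continuous_on K (F i)" if "i \<in> Basis" for i unfolding F_def
    by (intro continuous_intros cp p1 cD that)
  have cE: "continuous_on K (E i)" if "i \<in> Basis" for i unfolding E_def
    by (intro continuous_intros cp p1 p2 cD that)
  have cg: "continuous_on K (g n i)" if "i \<in> Basis" for i n unfolding g_def
    by (intro continuous_intros cE cF cz that)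
  have out: "cutoff n (z \<bullet> z) = 0" "cutoff' n (z \<bullet> z) = 0" if "norm z \<ge> 1" for n and z :: 'a
  proof -
    have "z \<bullet> z \<ge> 1" using that by (simp add: dot_square_norm)
    then show "cutoff n (z \<bullet> z) = 0" "cutoff' n (z \<bullet> z) = 0" by (rule cutoff_ge_1)+
  qed
  have zero: "(LINT z:K|lborel. g n i z) = 0" if i: "i \<in> Basis" for n i
  proof -
    define G where "G = (\<lambda>z. cutoff n (z \<bullet> z) * F i z)"
    have G0: "G z = 0" if "norm z > 1" for z using out[of z n] that by (simp add: G_def)
    have g0: "g n i z = 0" if "z \<notin> K" for z using out[of z n] that by (simp add: g_def K_def)
    have "continuous_on K G" unfolding G_def by (intro continuous_intros cz cF i)
    then have "integrable lborel (\<lambda>z. indicator K z *\<^sub>R G z)"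
      by (intro borel_integrable_compact) (auto simp: K_def)
    moreover have "(\<lambda>z. indicator K z *\<^sub>R G z) = G"
      using G0 by (auto simp: fun_eq_iff indicator_def K_def)
    ultimately have Gi: "integrable lborel G" by simp
    have "bounded (g n i ` K)" by (rule compact_imp_bounded[OF compact_continuous_image[OF cg[OF i]]]) (simp add: K_def)
    then obtain B where B: "\<And>z. z \<in> K \<Longrightarrow> \<bar>g n i z\<bar> \<le> B" unfolding bounded_iff by auto
    have B': "\<bar>g n i z\<bar> \<le> max 0 B" for z
      using B[of z] g0[of z] by (cases "z \<in> K") auto
    have der: "((\<lambda>h. G (z + h *\<^sub>R i)) has_real_derivative g n i z) (at 0)" for z
    proof (cases "z \<in> K")
      case True
      have z0: "r *\<^sub>R z + 0 *\<^sub>R (r *\<^sub>R i) \<in> ball 0 R" using inb[OF True] by simp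
      have dp: "((\<lambda>h. partial_deriv k f (r *\<^sub>R (z + h *\<^sub>R i))) has_real_derivative
          r * partial_deriv i (partial_deriv k f) (r *\<^sub>R z)) (at 0)" if k: "k \<in> Basis" for k
      proof -
        have "dirderiv (partial_deriv k f) (r *\<^sub>R z) (r *\<^sub>R i) = r * partial_deriv i (partial_deriv k f) (r *\<^sub>R z)"
          unfolding dirderiv_def by (simp add: mult.assoc sum_distrib_left[symmetric] sum_inner_Basis[OF i])
        then show ?thesis
          using C2_on_line_derivative_partial[OF C open_ball z0 k]
          by (simp add: scaleR_add_right mult.commute)
      qed
      have dc: "((\<lambda>h. (z + h *\<^sub>R i) \<bullet> k) has_real_derivative i \<bullet> k) (at 0)" for k
        by (auto simp: inner_left_distrib intro!: derivative_eq_intros)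
      have dD: "((\<lambda>h. D (z + h *\<^sub>R i)) has_real_derivative
          (partial_deriv i f (r *\<^sub>R z) + r * (\<Sum>j\<in>Basis. (z \<bullet> j) * partial_deriv i (partial_deriv j f) (r *\<^sub>R z)))) (at 0)"
      proof -
        have "((\<lambda>h. D (z + h *\<^sub>R i)) has_real_derivative
          (\<Sum>j\<in>Basis. (i \<bullet> j) * partial_deriv j f (r *\<^sub>R (z + 0 *\<^sub>R i)) +
             (r * partial_deriv i (partial_deriv j f) (r *\<^sub>R z)) * ((z + 0 *\<^sub>R i) \<bullet> j))) (at 0)"
          unfolding D_def dirderiv_def by (intro DERIV_sum DERIV_mult dp dc)
        then show ?thesis
          by (simp add: sum.distrib sum_inner_Basis[OF i] sum_distrib_left mult_ac)
      qed
      have dF: "((\<lambda>h. F i (z + h *\<^sub>R i)) has_real_derivative E i z) (at 0)"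
      proof -
        have "((\<lambda>h. F i (z + h *\<^sub>R i)) has_real_derivative
          r * partial_deriv i (partial_deriv i f) (r *\<^sub>R z) - ((i \<bullet> i) * D (z + 0 *\<^sub>R i) +
          (partial_deriv i f (r *\<^sub>R z) + r * (\<Sum>j\<in>Basis. (z \<bullet> j) * partial_deriv i (partial_deriv j f) (r *\<^sub>R z))) * ((z + 0 *\<^sub>R i) \<bullet> i))) (at 0)"
          unfolding F_def by (intro DERIV_diff DERIV_mult dp dD dc i)
        then show ?thesis using i by (simp add: E_def mult_ac)
      qed
      have dq: "((\<lambda>h. (z + h *\<^sub>R i) \<bullet> (z + h *\<^sub>R i)) has_real_derivative 2 * (z \<bullet> i)) (at 0)"
        by (auto simp: inner_left_distrib inner_right_distrib inner_commute intro!: derivative_eq_intros)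
      have dw: "((\<lambda>h. cutoff n ((z + h *\<^sub>R i) \<bullet> (z + h *\<^sub>R i))) has_real_derivative
          cutoff' n (z \<bullet> z) * (2 * (z \<bullet> i))) (at 0)"
        using DERIV_chain2[OF DERIV_cutoff dq] by simp
      have "((\<lambda>h. G (z + h *\<^sub>R i)) has_real_derivative
          (cutoff' n (z \<bullet> z) * (2 * (z \<bullet> i))) * F i (z + 0 *\<^sub>R i) + E i z * cutoff n ((z + 0 *\<^sub>R i) \<bullet> (z + 0 *\<^sub>R i))) (at 0)"
        unfolding G_def by (intro DERIV_mult dw dF)
      then show ?thesis by (simp add: g_def mult_ac add.commute)
    next
      case False
      then have z: "norm z > 1" by (simp add: K_def)
      have "((\<lambda>h::real. norm (z + h *\<^sub>R i)) \<longlongrightarrow> norm (z + 0 *\<^sub>R i)) (nhds 0)"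
        by (intro tendsto_intros tendsto_ident_at)
           (simp add: filterlim_ident)
      then have "\<forall>\<^sub>F h in nhds (0::real). norm (z + h *\<^sub>R i) > 1"
        using z by (intro order_tendstoD(1)) auto
      then have "\<forall>\<^sub>F h in nhds (0::real). G (z + h *\<^sub>R i) = 0"
        by eventually_elim (rule G0)
      then show ?thesis using g0[OF False] by (simp add: DERIV_cong_ev[OF refl _ refl, of _ "\<lambda>_. 0"])
    qed
    have "integral\<^sup>L lborel (g n i) = 0"
      by (rule integral_line_derivative_zero(2)[OF Gi G0 der B'])
    moreover have "(\<lambda>z. indicator K z *\<^sub>R g n i z) = g n i"
      using g0 by (auto simp: fun_eq_iff indicator_def)
    ultimately show ?thesis by (simp add: set_lebesgue_integral_def)
  qed
  define h where "h = (\<lambda>z. r * L z - (DIM('a) + 1) * D z - r * H z)"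
  have sumg: "(\<Sum>i\<in>Basis. g n i z) = cutoff n (z \<bullet> z) * h z + (2 * cutoff' n (z \<bullet> z) * (1 - z \<bullet> z)) * D z" for n z
  proof -
    have D: "(\<Sum>i\<in>Basis. (z \<bullet> i) * partial_deriv i f (r *\<^sub>R z)) = D z" by (simp add: D_def dirderiv_def)
    have zz: "(\<Sum>i\<in>Basis. (z \<bullet> i) * (z \<bullet> i)) = z \<bullet> z" by (simp add: euclidean_inner[of z z])
    have HH: "(\<Sum>i\<in>Basis. (z \<bullet> i) * (\<Sum>j\<in>Basis. (z \<bullet> j) * partial_deriv i (partial_deriv j f) (r *\<^sub>R z))) = H z"
      unfolding H_def hessian_def dirderiv_def sum_distrib_left
      by (subst sum.swap) (simp add: mult_ac)
    have E: "(\<Sum>i\<in>Basis. E i z) = h z"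
      unfolding E_def h_def
      by (simp add: sum_subtractf sum.distrib distrib_left D HH L_def laplacian_def sum_distrib_left[symmetric] algebra_simps)
    \<comment> \<open>Tangentiality of \<open>F\<close> produces the factor
      \<open>1 - z \<bullet> z\<close>, which compensates the growth of \<open>cutoff'\<close> near
      the sphere.\<close>
    have F: "(\<Sum>i\<in>Basis. (z \<bullet> i) * F i z) = (1 - z \<bullet> z) * D z"
    proof -
      have "(\<Sum>i\<in>Basis. (z \<bullet> i) * F i z) = (\<Sum>i\<in>Basis. (z \<bullet> i) * partial_deriv i f (r *\<^sub>R z)) - (\<Sum>i\<in>Basis. (z \<bullet> i) * (z \<bullet> i)) * D z"
        unfolding F_def by (simp add: right_diff_distrib sum_subtractf sum_distrib_right mult.assoc)
      then show ?thesis unfolding D zz by (simp add: left_diff_distrib)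
    qed
    have "(\<Sum>i\<in>Basis. g n i z) = cutoff n (z \<bullet> z) * (\<Sum>i\<in>Basis. E i z) + 2 * cutoff' n (z \<bullet> z) * (\<Sum>i\<in>Basis. (z \<bullet> i) * F i z)"
      unfolding g_def by (simp add: sum.distrib sum_distrib_left mult_ac)
    then show ?thesis unfolding E F by (simp add: mult_ac)
  qed
  have ch: "continuous_on K h" unfolding h_def by (intro continuous_intros cL cD cH)
  have bd: "\<exists>B. \<forall>z\<in>K. \<bar>\<phi> z\<bar> \<le> B" if "continuous_on K \<phi>" for \<phi> :: "'a \<Rightarrow> real"
    using compact_imp_bounded[OF compact_continuous_image[OF that]] unfolding bounded_iff K_def by auto
  obtain B1 B2 where B1: "\<And>z. z \<in> K \<Longrightarrow> \<bar>h z\<bar> \<le> B1" and B2: "\<And>z. z \<in> K \<Longrightarrow> \<bar>D z\<bar> \<le> B2"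
    using bd[OF ch] bd[OF cD] by auto
  define s where "s = (\<lambda>n z. indicator K z *\<^sub>R (\<Sum>i\<in>Basis. g n i z))"
  have s0: "integral\<^sup>L lborel (s n) = 0" for n
  proof -
    have "(LINT z:K|lborel. \<Sum>i\<in>Basis. g n i z) = (\<Sum>i\<in>Basis. LINT z:K|lborel. g n i z)"
      unfolding set_lebesgue_integral_def scaleR_sum_right
      by (rule Bochner_Integration.integral_sum, rule borel_integrable_compact) (use cg in \<open>auto simp: K_def\<close>)
    then show ?thesis using zero by (simp add: s_def set_lebesgue_integral_def)
  qed
  have ih: "integrable lborel (\<lambda>z. indicator K z *\<^sub>R h z)"
    by (rule borel_integrable_compact[OF _ ch]) (simp add: K_def)
  have m1: "(\<lambda>z. indicator K z *\<^sub>R h z) \<in> borel_measurable lborel" using ih by auto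
  have m2: "s n \<in> borel_measurable lborel" for n
  proof -
    have "integrable lborel (s n)" unfolding s_def
      by (rule borel_integrable_compact) (use cg in \<open>auto intro!: continuous_on_sum simp: K_def\<close>)
    then show ?thesis by auto
  qed
  have dI: "integrable lborel (\<lambda>z. (B1 + 4 * B2) * indicator K z)"
    by (intro integrable_mult_right integrable_real_indicator) (use emeasure_lborel_cball_finite[of "0::'a" 1] in \<open>auto simp: K_def\<close>)
  have lim: "AE z in lborel. (\<lambda>n. s n z) \<longlonglongrightarrow> indicator K z *\<^sub>R h z"
    using AE_lborel_norm_neq[of 1]
  proof eventually_elim
    case (elim z)
    show ?case
    proof (cases "z \<in> K")
      case True
      then have "z \<bullet> z < 1" using elim by (simp add: K_def dot_square_norm power_less_one_iff)
      then have "(\<lambda>n. cutoff n (z \<bullet> z) * h z + (2 * cutoff' n (z \<bullet> z) * (1 - z \<bullet> z)) * D z)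
          \<longlonglongrightarrow> 1 * h z + (2 * 0 * (1 - z \<bullet> z)) * D z"
        by (intro tendsto_intros cutoff_limits)
      then show ?thesis using True by (simp add: s_def sumg)
    qed (simp add: s_def)
  qed
  have dom: "AE z in lborel. norm (s n z) \<le> (B1 + 4 * B2) * indicator K z" for n
  proof (rule AE_I2)
    fix z
    show "norm (s n z) \<le> (B1 + 4 * B2) * indicator K z"
    proof (cases "z \<in> K")
      case True
      then have "z \<bullet> z \<le> 1" by (simp add: K_def dot_square_norm power_le_one_iff)
      then have "\<bar>cutoff n (z \<bullet> z) * h z\<bar> \<le> 1 * B1" "\<bar>(2 * cutoff' n (z \<bullet> z) * (1 - z \<bullet> z)) * D z\<bar> \<le> 4 * B2"
        unfolding abs_mult[of "cutoff n (z \<bullet> z)"] abs_mult[of _ "D z"]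
        by (intro mult_mono cutoff_bounds cutoff'_bound B1 B2 True; simp)+
      then show ?thesis using True by (simp add: s_def sumg)
    qed (simp add: s_def)
  qed
  have "(\<lambda>n. integral\<^sup>L lborel (s n)) \<longlonglongrightarrow> (\<integral>z. indicator K z *\<^sub>R h z \<partial>lborel)"
    by (rule integral_dominated_convergence[OF m1 m2 dI lim dom])
  then have "(LINT z:K|lborel. h z) = 0" using s0 by (simp add: LIMSEQ_const_iff set_lebesgue_integral_def)
  moreover have "(LINT z:K|lborel. h z) = r * (LINT z:K|lborel. L z) - (DIM('a) + 1) * (LINT z:K|lborel. D z) - r * (LINT z:K|lborel. H z)"
    unfolding h_def
    using set_integrable_compact_continuous[OF _ cL] set_integrable_compact_continuous[OF _ cD] set_integrable_compact_continuous[OF _ cH]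
    by (simp add: set_integral_diff K_def)
  ultimately show ?thesis unfolding L_def D_def H_def K_def by (simp add: algebra_simps)
qed

text \<open>\<open>radial_op k g r l\<close> says that \<open>g'' + (k / r) g'\<close> exists at \<open>r\<close> and equals \<open>l\<close>; at \<open>r = 0\<close>
  this is understood as the limit \<open>(k + 1) g''(0)\<close> for a function with \<open>g'(0) = 0\<close>.\<close>

definition radial_op :: "real \<Rightarrow> (real \<Rightarrow> real) \<Rightarrow> real \<Rightarrow> real \<Rightarrow> bool" where
  "radial_op k g r l \<longleftrightarrow> (\<exists>g' g''. (\<forall>\<^sub>F s in nhds r. (g has_real_derivative g' s) (at s)) \<and>
     (g' has_real_derivative g'') (at r) \<and>
     (if r = 0 then g' 0 = 0 \<and> l = (k + 1) * g'' else l = g'' + k / r * g' r))"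

lemma radial_op_cmult:
  assumes "radial_op k g r l" shows "radial_op k (\<lambda>s. c * g s) r (c * l)"
proof -
  obtain g' g'' where *: "\<forall>\<^sub>F s in nhds r. (g has_real_derivative g' s) (at s)"
     "(g' has_real_derivative g'') (at r)"
     "if r = 0 then g' 0 = 0 \<and> l = (k + 1) * g'' else l = g'' + k / r * g' r"
    using assms unfolding radial_op_def by blast
  show ?thesis unfolding radial_op_def
  proof (intro exI conjI)
    show "\<forall>\<^sub>F s in nhds r. ((\<lambda>s. c * g s) has_real_derivative c * g' s) (at s)"
      using *(1) by eventually_elim (rule DERIV_cmult)
    show "((\<lambda>s. c * g' s) has_real_derivative c * g'') (at r)" using *(2) by (rule DERIV_cmult)
    show "if r = 0 then c * g' 0 = 0 \<and> c * l = (k + 1) * (c * g'') else c * l = c * g'' + k / r * (c * g' r)"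
      using *(3) by (auto simp: algebra_simps split: if_splits)
  qed
qed

lemma radial_op_add:
  assumes "radial_op k f r l" "radial_op k g r m" shows "radial_op k (\<lambda>s. f s + g s) r (l + m)"
proof -
  obtain f' f'' where f: "\<forall>\<^sub>F s in nhds r. (f has_real_derivative f' s) (at s)"
     "(f' has_real_derivative f'') (at r)"
     "if r = 0 then f' 0 = 0 \<and> l = (k + 1) * f'' else l = f'' + k / r * f' r"
    using assms(1) unfolding radial_op_def by blast
  obtain g' g'' where g: "\<forall>\<^sub>F s in nhds r. (g has_real_derivative g' s) (at s)"
     "(g' has_real_derivative g'') (at r)"
     "if r = 0 then g' 0 = 0 \<and> m = (k + 1) * g'' else m = g'' + k / r * g' r"
    using assms(2) unfolding radial_op_def by blast
  show ?thesis unfolding radial_op_def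
  proof (intro exI conjI)
    show "\<forall>\<^sub>F s in nhds r. ((\<lambda>s. f s + g s) has_real_derivative f' s + g' s) (at s)"
      using f(1) g(1) by eventually_elim (rule DERIV_add)
    show "((\<lambda>s. f' s + g' s) has_real_derivative f'' + g'') (at r)" using f(2) g(2) by (rule DERIV_add)
    show "if r = 0 then f' 0 + g' 0 = 0 \<and> l + m = (k + 1) * (f'' + g'') else l + m = f'' + g'' + k / r * (f' r + g' r)"
      using f(3) g(3) by (auto simp: algebra_simps split: if_splits)
  qed
qed

lemma radial_op_diff:
  assumes "radial_op k f r l" "radial_op k g r m" shows "radial_op k (\<lambda>s. f s - g s) r (l - m)"
  using radial_op_add[OF assms(1) radial_op_cmult[OF assms(2), of "-1"]] by simp

lemma radial_op_scale:
  assumes "radial_op k g (q * r) l" "q \<noteq> 0" shows "radial_op k (\<lambda>s. g (q * s)) r (q\<^sup>2 * l)"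
proof -
  obtain g' g'' where *: "\<forall>\<^sub>F s in nhds (q * r). (g has_real_derivative g' s) (at s)"
     "(g' has_real_derivative g'') (at (q * r))"
     "if q * r = 0 then g' 0 = 0 \<and> l = (k + 1) * g'' else l = g'' + k / (q * r) * g' (q * r)"
    using assms unfolding radial_op_def by blast
  have lin: "((\<lambda>s. q * s) has_real_derivative q) (at s)" for s by (auto intro!: derivative_eq_intros)
  have "filterlim (\<lambda>s. q * s) (nhds (q * r)) (nhds r)"
    by (intro tendsto_intros filterlim_ident)
  with *(1) have ev: "\<forall>\<^sub>F s in nhds r. (g has_real_derivative g' (q * s)) (at (q * s))"
    by (rule eventually_compose_filterlim)
  show ?thesis unfolding radial_op_def
  proof (intro exI conjI)
    show "\<forall>\<^sub>F s in nhds r. ((\<lambda>s. g (q * s)) has_real_derivative q * g' (q * s)) (at s)"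
      using ev
    proof eventually_elim
      case (elim s)
      show ?case using DERIV_chain2[OF elim lin] by (rule DERIV_cong) (rule mult.commute)
    qed
    show "((\<lambda>s. q * g' (q * s)) has_real_derivative q * (g'' * q)) (at r)"
      by (intro DERIV_cmult DERIV_chain2[OF *(2) lin])
    show "if r = 0 then q * g' (q * 0) = 0 \<and> q\<^sup>2 * l = (k + 1) * (q * (g'' * q))
      else q\<^sup>2 * l = q * (g'' * q) + k / r * (q * g' (q * r))"
      using *(3) assms(2) by (auto simp: algebra_simps power2_eq_square)
  qed
qed

lemma radial_op_local_max:
  assumes "radial_op k g r l" "k \<ge> 0" "\<forall>\<^sub>F s in nhds r. g s \<le> g r"
  shows "l \<le> 0"
proof -
  obtain g' g'' where *: "\<forall>\<^sub>F s in nhds r. (g has_real_derivative g' s) (at s)"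
     "(g' has_real_derivative g'') (at r)"
     "if r = 0 then g' 0 = 0 \<and> l = (k + 1) * g'' else l = g'' + k / r * g' r"
    using assms unfolding radial_op_def by blast
  have "g' r = 0" "g'' \<le> 0"
    using real_local_max_second_derivative[OF *(1,2) assms(3)] by auto
  then show ?thesis using *(3) assms(2) by (auto split: if_splits simp: mult_nonneg_nonpos)
qed

text \<open>Away from 0 this is \<open>divergence_identity\<close> divided by \<open>r\<close>. At 0
  that identity only gives \<open>A' 0 = 0\<close>; the remaining value comes from continuity of
  both sides, because \<open>A' s / s\<close> tends to \<open>A'' 0\<close>.\<close>

lemma radial_op_dilint:
  fixes f :: "'a::euclidean_space \<Rightarrow> real"
  assumes C: "C2_on (ball 0 R) f" and r: "\<bar>r\<bar> < R"
  shows "radial_op (DIM('a) + 1) (dilint f) r (LINT z:cball 0 1|lborel. laplacian f (r *\<^sub>R z))"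
proof -
  define A' where "A' = (\<lambda>r. LINT z:cball 0 1|lborel. dirderiv f (r *\<^sub>R z) z)"
  define A'' where "A'' = (\<lambda>r. LINT z:cball 0 1|lborel. hessian f (r *\<^sub>R z) z)"
  define L where "L = (\<lambda>r. LINT z:cball 0 1|lborel. laplacian f (r *\<^sub>R z))"
  define k where "k = real (DIM('a) + 1)"
  have op: "open {-R<..<R}" by simp
  have "r \<in> {-R<..<R}" using r by auto
  then have "\<forall>\<^sub>F s in nhds r. s \<in> {-R<..<R}" by (rule eventually_nhds_in_open[OF op])
  then have ev: "\<forall>\<^sub>F s in nhds r. (dilint f has_real_derivative A' s) (at s)"
    unfolding A'_def by eventually_elim (use dilint_derivative[OF C] in auto)
  have d2: "(A' has_real_derivative A'' s) (at s)" if "\<bar>s\<bar> < R" for s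
    unfolding A'_def A''_def by (rule dilint_derivative2[OF C that])
  have id: "s * L s = s * A'' s + k * A' s" if "\<bar>s\<bar> < R" for s
    unfolding L_def A''_def A'_def k_def using divergence_identity[OF C that] by simp
  have zero: "A' 0 = 0 \<and> L 0 = (k + 1) * A'' 0" if R: "R > 0"
  proof
    have k: "k > 0" by (simp add: k_def)
    show A0: "A' 0 = 0" using id[of 0] R k by simp
    have cL: "continuous_on {-R<..<R} L" unfolding L_def
      by (intro continuous_on_set_integral_param continuous_on_dilated continuous_on_laplacian C) simp
    have cA: "continuous_on {-R<..<R} A''" unfolding A''_def
      by (intro continuous_on_set_integral_param continuous_on_dilated_hessian C) simp
    have lim: "(L \<longlongrightarrow> L 0) (at 0)" "(A'' \<longlongrightarrow> A'' 0) (at 0)"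
      using continuous_on_interior[OF cL, of 0] continuous_on_interior[OF cA, of 0] R by (auto simp: isCont_def)
    have "((\<lambda>s. (A' s - A' 0) / (s - 0)) \<longlongrightarrow> A'' 0) (at 0)"
      using d2[of 0] R by (simp add: has_field_derivative_iff)
    then have "((\<lambda>s. A'' s + k * (A' s / s)) \<longlongrightarrow> A'' 0 + k * A'' 0) (at 0)"
      using A0 by (intro tendsto_intros lim) auto
    moreover have "\<forall>\<^sub>F s in at 0. A'' s + k * (A' s / s) = L s"
    proof -
      have "\<forall>\<^sub>F s in at 0. s \<in> {-R<..<R} \<and> s \<noteq> (0::real)"
        using R eventually_at_in_open[OF op, of 0] by auto
      then show ?thesis
      proof eventually_elim
        case (elim s)
        then show ?case using id[of s] by (auto simp: field_simps)
      qed
    qed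
    ultimately have "(L \<longlongrightarrow> A'' 0 + k * A'' 0) (at 0)"
      by (rule Lim_transform_eventually)
    with lim(1) have "L 0 = A'' 0 + k * A'' 0"
      by (rule LIM_unique)
    then show "L 0 = (k + 1) * A'' 0" by (simp add: algebra_simps)
  qed
  have "if r = 0 then A' 0 = 0 \<and> L r = (k + 1) * A'' r else L r = A'' r + k / r * A' r"
    using zero id[OF r] r by (auto simp: field_simps)
  then have "radial_op k (dilint f) r (L r)" unfolding radial_op_def
    using ev d2[OF r] by blast
  then show ?thesis by (simp add: k_def L_def add.commute)
qed

lemma lborel_integral_affine:
  fixes f :: "'a::euclidean_space \<Rightarrow> real"
  assumes [measurable]: "f \<in> borel_measurable borel" and c: "c \<noteq> 0"
  shows "(\<integral>x. f x \<partial>lborel) = \<bar>c\<bar> ^ DIM('a) * (\<integral>x. f (c *\<^sub>R x) \<partial>lborel)"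
proof -
  have "(\<integral>x. f x \<partial>lborel) = (\<integral>x. f x \<partial>density (distr lborel borel (\<lambda>x. 0 + c *\<^sub>R x)) (\<lambda>_. \<bar>c\<bar> ^ DIM('a)))"
    using lborel_affine[OF c, of "0::'a"] by simp
  also have "\<dots> = \<bar>c\<bar> ^ DIM('a) * (\<integral>x. f (c *\<^sub>R x) \<partial>lborel)"
    by (subst integral_density) (auto simp: integral_distr)
  finally show ?thesis .
qed

lemma dilint_eq:
  fixes f :: "'a::euclidean_space \<Rightarrow> real"
  assumes [measurable]: "f \<in> borel_measurable borel" and r: "r > 0"
  shows "r ^ DIM('a) * dilint f r = (LINT z:cball 0 r|lborel. f z)"
proof -
  have "(LINT z:cball 0 r|lborel. f z) = \<bar>r\<bar> ^ DIM('a) * (\<integral>x. indicator (cball 0 r) (r *\<^sub>R x) *\<^sub>R f (r *\<^sub>R x) \<partial>lborel)"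
    unfolding set_lebesgue_integral_def
    by (rule lborel_integral_affine) (use r in \<open>measurable, auto\<close>)
  also have "(\<lambda>x::'a. indicator (cball 0 r) (r *\<^sub>R x) *\<^sub>R f (r *\<^sub>R x)) = (\<lambda>x. indicator (cball 0 1) x *\<^sub>R f (r *\<^sub>R x))"
    using r by (auto simp: fun_eq_iff indicator_def)
  finally show ?thesis using r by (simp add: dilint_def set_lebesgue_integral_def)
qed

lemma dilint_zero: "dilint f 0 = unit_ball_vol DIM('a) * f (0::'a::euclidean_space)"
proof -
  have "measure lborel (cball (0::'a) 1) = unit_ball_vol DIM('a)" using content_cball[of 1 "0::'a"] by simp
  then show ?thesis by (simp add: dilint_def set_lebesgue_integral_def)
qed

lemma dilint_uminus:
  fixes f :: "'a::euclidean_space \<Rightarrow> real"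
  assumes [measurable]: "f \<in> borel_measurable borel"
  shows "dilint f (- r) = dilint f r"
proof -
  have "dilint f (- r) = \<bar>-1\<bar> ^ DIM('a) * (\<integral>x. indicator (cball 0 1) ((-1) *\<^sub>R x) *\<^sub>R f (- r *\<^sub>R ((-1) *\<^sub>R x)) \<partial>lborel)"
    unfolding dilint_def set_lebesgue_integral_def
    by (rule lborel_integral_affine) (measurable, auto)
  also have "(\<lambda>x::'a. indicator (cball 0 1) ((-1) *\<^sub>R x) *\<^sub>R f (- r *\<^sub>R ((-1) *\<^sub>R x))) = (\<lambda>x. indicator (cball 0 1) x *\<^sub>R f (r *\<^sub>R x))"
    by (auto simp: fun_eq_iff indicator_def)
  finally show ?thesis by (simp add: dilint_def set_lebesgue_integral_def)
qed

section \<open>Parabolic comparison\<close>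

text \<open>The factor \<open>exp (- 2 t)\<close> absorbs the zero-order term in \<open>\<partial>\<^sub>t D \<le> D\<close>.\<close>

lemma parabolic_max_principle:
  fixes D :: "'b::metric_space \<Rightarrow> real \<Rightarrow> real"
  assumes K: "compact K"
    and cont: "continuous_on (K \<times> {t0..T}) (\<lambda>(x, t). D x t)"
    and init: "\<And>x. x \<in> K \<Longrightarrow> D x t0 \<le> 0"
    and step: "\<And>x t. x \<in> K \<Longrightarrow> t0 < t \<Longrightarrow> t \<le> T \<Longrightarrow> 0 < D x t \<Longrightarrow> (\<And>y. y \<in> K \<Longrightarrow> D y t \<le> D x t) \<Longrightarrow>
        \<exists>d. (D x has_real_derivative d) (at t) \<and> d \<le> D x t"
    and x: "x \<in> K" and t: "t0 \<le> t" "t \<le> T"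
  shows "D x t \<le> 0"
proof (rule ccontr)
  assume pos: "\<not> D x t \<le> 0"
  define E where "E = (\<lambda>(x, t). exp (- 2 * (t - t0)) * D x t)"
  have "continuous_on (K \<times> {t0..T}) E" unfolding E_def split_beta
    by (intro continuous_intros cont[unfolded split_beta])
  moreover have "compact (K \<times> {t0..T})" using K by (intro compact_Times) auto
  ultimately obtain p where p: "p \<in> K \<times> {t0..T}" "\<And>q. q \<in> K \<times> {t0..T} \<Longrightarrow> E q \<le> E p"
    using continuous_attains_sup[of "K \<times> {t0..T}" E] x t by force
  obtain y s where ys: "p = (y, s)" "y \<in> K" "t0 \<le> s" "s \<le> T" using p by auto
  have mx: "exp (- 2 * (s' - t0)) * D y' s' \<le> exp (- 2 * (s - t0)) * D y s"
    if "y' \<in> K" "t0 \<le> s'" "s' \<le> T" for y' s'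
    using p(2)[of "(y', s')"] that by (simp add: E_def ys)
  have "0 < exp (- 2 * (t - t0)) * D x t" using pos by simp
  also have "\<dots> \<le> exp (- 2 * (s - t0)) * D y s" by (rule mx) (use x t in auto)
  finally have Dp: "0 < D y s" by (simp add: zero_less_mult_iff)
  then have "s \<noteq> t0" using init[OF ys(2)] by auto
  then have s: "t0 < s" using ys by simp
  have sp: "D z s \<le> D y s" if "z \<in> K" for z using mx[OF that ys(3,4)] by simp
  obtain d where d: "(D y has_real_derivative d) (at s)" "d \<le> D y s"
    using step[OF ys(2) s ys(4) Dp sp] by blast
  have "((\<lambda>s. exp (- 2 * (s - t0)) * D y s) has_real_derivative exp (- 2 * (s - t0)) * (d - 2 * D y s)) (at s)"
    by (rule derivative_eq_intros d refl | simp add: algebra_simps)+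
  moreover have "exp (- 2 * (s - t0)) * (d - 2 * D y s) < 0" using d(2) Dp by (simp add: mult_less_0_iff)
  ultimately obtain e where e: "e > 0"
      "\<And>h. 0 < h \<Longrightarrow> h < e \<Longrightarrow> exp (- 2 * (s - t0)) * D y s < exp (- 2 * (s - h - t0)) * D y (s - h)"
    using DERIV_neg_dec_left by blast
  \<comment> \<open>Only earlier times are used, so a maximum at the final time \<open>T\<close> is
    no exception.\<close>
  define h where "h = min e (s - t0) / 2"
  have h: "0 < h" "h < e" "h < s - t0" using e s by (auto simp: h_def min_def)
  show False using e(2)[OF h(1,2)] mx[OF ys(2), of "s - h"] h ys by simp
qed

lemma mass_annulus_le:
  fixes f :: "'a::euclidean_space \<Rightarrow> real"
  assumes f: "continuous_on UNIV f" and r: "0 \<le> r" "r \<le> s"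
    and B: "\<And>z. r \<le> norm z \<Longrightarrow> norm z \<le> s \<Longrightarrow> f z \<le> B"
  shows "s ^ DIM('a) * dilint f s - r ^ DIM('a) * dilint f r \<le> B * unit_ball_vol DIM('a) * (s ^ DIM('a) - r ^ DIM('a))"
proof -
  have m[measurable]: "f \<in> borel_measurable borel" using f by (rule borel_measurable_continuous_onI)
  have I: "integrable lborel (\<lambda>x. indicator (cball 0 q) x *\<^sub>R f x)" for q
    by (rule borel_integrable_compact) (auto intro: continuous_on_subset[OF f])
  have eq: "q ^ DIM('a) * dilint f q = (LINT z:cball 0 q|lborel. f z)" if "0 \<le> q" for q
  proof (cases "q = 0")
    case True
    have "(LINT z:cball 0 q|lborel. f z) = 0"
      unfolding set_lebesgue_integral_def
    proof (rule integral_eq_zero_AE)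
      show "AE z in lborel. indicator (cball 0 q) z *\<^sub>R f z = 0"
        using AE_lborel_singleton[of "0::'a"] by eventually_elim (use True in simp)
    qed
    then show ?thesis using True by simp
  qed (use that dilint_eq[of f q] in auto)
  have c: "integrable lborel (\<lambda>x. indicator (cball (0::'a) q) x *\<^sub>R B)" for q
    by (rule borel_integrable_compact) auto
  have mc: "measure lborel (cball (0::'a) q) = unit_ball_vol DIM('a) * q ^ DIM('a)" if "q \<ge> 0" for q
    using content_cball[OF that, of "0::'a"] by simp
  have "(\<integral>x. indicator (cball 0 s) x *\<^sub>R f x \<partial>lborel) - (\<integral>x. indicator (cball 0 r) x *\<^sub>R f x \<partial>lborel)
      = (\<integral>x. indicator (cball 0 s) x *\<^sub>R f x - indicator (cball 0 r) x *\<^sub>R f x \<partial>lborel)"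
    using I by simp
  also have "\<dots> \<le> (\<integral>x. indicator (cball (0::'a) s) x *\<^sub>R B - indicator (cball 0 r) x *\<^sub>R B \<partial>lborel)"
    using I c B r by (intro integral_mono Bochner_Integration.integrable_diff) (auto simp: indicator_def)
  also have "\<dots> = (\<integral>x. indicator (cball (0::'a) s) x *\<^sub>R B \<partial>lborel) - (\<integral>x. indicator (cball (0::'a) r) x *\<^sub>R B \<partial>lborel)"
    using c by simp
  also have "\<dots> = B * unit_ball_vol DIM('a) * (s ^ DIM('a) - r ^ DIM('a))"
    using mc[of r] mc[of s] r by (simp add: algebra_simps)
  finally show ?thesis using eq[of r] eq[of s] r by (simp add: set_lebesgue_integral_def)
qed

lemma mass_annulus_ge:
  fixes f :: "'a::euclidean_space \<Rightarrow> real"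
  assumes f: "continuous_on UNIV f" and r: "0 \<le> r" "r \<le> s"
    and B: "\<And>z. r \<le> norm z \<Longrightarrow> norm z \<le> s \<Longrightarrow> B \<le> f z"
  shows "B * unit_ball_vol DIM('a) * (s ^ DIM('a) - r ^ DIM('a)) \<le> s ^ DIM('a) * dilint f s - r ^ DIM('a) * dilint f r"
proof -
  have "dilint (\<lambda>z. - f z) q = - dilint f q" for q by (simp add: dilint_def set_lebesgue_integral_def)
  then show ?thesis
    using mass_annulus_le[OF continuous_on_minus[OF f] r, of "- B"] B by simp
qed

lemma C21_onD:
  assumes "C21_on \<Omega> u"
  shows "continuous_on \<Omega> (\<lambda>(x, t). u x t)"
    and "continuous_on \<Omega> (\<lambda>(x, t). deriv (u x) t)"
    and "(x, t) \<in> \<Omega> \<Longrightarrow> u x field_differentiable (at t)"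
  using assms by (auto simp: C21_on_def)

lemma C21_onD_space:
  assumes C: "C21_on \<Omega> u" and i: "i \<in> Basis"
  shows "continuous_on \<Omega> (\<lambda>(x, t). partial_deriv i (\<lambda>y. u y t) x)"
    and "(x, t) \<in> \<Omega> \<Longrightarrow> partially_differentiable i (\<lambda>y. u y t) x"
    and "j \<in> Basis \<Longrightarrow> continuous_on \<Omega> (\<lambda>(x, t). partial_deriv j (partial_deriv i (\<lambda>y. u y t)) x)"
    and "j \<in> Basis \<Longrightarrow> (x, t) \<in> \<Omega> \<Longrightarrow> partially_differentiable j (partial_deriv i (\<lambda>y. u y t)) x"
proof -
  have *: "(\<forall>(x, t)\<in>\<Omega>. partially_differentiable i (\<lambda>y. u y t) x) \<and>
        continuous_on \<Omega> (\<lambda>(x, t). partial_deriv i (\<lambda>y. u y t) x) \<and>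
        (\<forall>j\<in>Basis.
           (\<forall>(x, t)\<in>\<Omega>. partially_differentiable j (partial_deriv i (\<lambda>y. u y t)) x) \<and>
           continuous_on \<Omega> (\<lambda>(x, t). partial_deriv j (partial_deriv i (\<lambda>y. u y t)) x))"
    using C i unfolding C21_on_def by blast
  show "continuous_on \<Omega> (\<lambda>(x, t). partial_deriv i (\<lambda>y. u y t) x)" using * by blast
  show "partially_differentiable i (\<lambda>y. u y t) x" if "(x, t) \<in> \<Omega>"
    using * that by auto
  show "continuous_on \<Omega> (\<lambda>(x, t). partial_deriv j (partial_deriv i (\<lambda>y. u y t)) x)" if "j \<in> Basis"
    using * that by blast
  show "partially_differentiable j (partial_deriv i (\<lambda>y. u y t)) x" if "j \<in> Basis" "(x, t) \<in> \<Omega>"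
    using * that by auto
qed

section \<open>Classical solutions and their mass function\<close>

text \<open>Formulated so that the stationary pair consisting of \<open>U\<close> and the constant
  radius \<open>\<rho>\<close> is also an instance (\<open>stationary_solution\<close>); the
  reflection estimate can then be applied to \<open>U\<close> itself.\<close>

locale fbp =
  fixes u :: "'a::euclidean_space \<Rightarrow> real \<Rightarrow> real" and R :: "real \<Rightarrow> ennreal"
  assumes nonneg: "t > 0 \<Longrightarrow> 0 \<le> u x t"
    and cont: "continuous_on (UNIV \<times> {0<..}) (\<lambda>(x, t). u x t)"
    and C21: "C21_on (positive_region R) u"
    and pde: "(x, t) \<in> positive_region R \<Longrightarrow> deriv (u x) t = laplacian (\<lambda>y. u y t) x + u x t"
    and vanish: "t > 0 \<Longrightarrow> R t \<le> ennreal (norm x) \<Longrightarrow> u x t = 0"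
    and mass: "t > 0 \<Longrightarrow> (\<integral>x. u x t \<partial>lborel) = 1"
begin

definition A :: "real \<Rightarrow> real \<Rightarrow> real" where "A r t = dilint (\<lambda>x. u x t) r"

abbreviation M :: "real \<Rightarrow> real \<Rightarrow> real" where "M r t \<equiv> r ^ DIM('a) * A r t"

lemma continuous_slice: "t > 0 \<Longrightarrow> continuous_on UNIV (\<lambda>x. u x t)"
  by (rule continuous_on_compose2[OF cont, of _ "\<lambda>x. (x, t)", simplified]) (auto intro!: continuous_intros)

lemma continuous_time: "continuous_on {0<..} (u x)"
  by (rule continuous_on_compose2[OF cont, of _ "\<lambda>t. (x, t)", simplified]) (auto intro!: continuous_intros)

lemma measurable_slice: "t > 0 \<Longrightarrow> (\<lambda>x. u x t) \<in> borel_measurable borel"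
  by (intro borel_measurable_continuous_onI continuous_slice)

lemma integrable_slice: "t > 0 \<Longrightarrow> integrable lborel (\<lambda>x. u x t)"
  using mass[of t] not_integrable_integral_eq by fastforce

lemma A_uminus: "t > 0 \<Longrightarrow> A (- r) t = A r t"
  unfolding A_def by (rule dilint_uminus[OF measurable_slice])

lemma mass_ball: "t > 0 \<Longrightarrow> r > 0 \<Longrightarrow> M r t = (\<integral>x. indicator (cball 0 r) x * u x t \<partial>lborel)"
  unfolding A_def using dilint_eq[OF measurable_slice, of t r] by (simp add: set_lebesgue_integral_def)

lemma integrable_ball_slice: "t > 0 \<Longrightarrow> integrable lborel (\<lambda>x. indicator (cball 0 r) x * u x t)"
  using integrable_mult_indicator[OF _ integrable_slice, of "cball 0 r" t] by simp

lemma mass_mono: "t > 0 \<Longrightarrow> 0 \<le> r \<Longrightarrow> r \<le> s \<Longrightarrow> M r t \<le> M s t"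
  using mass_annulus_ge[OF continuous_slice, of t r s 0] nonneg by (simp add: A_def)

lemma mass_le_1: "t > 0 \<Longrightarrow> 0 \<le> r \<Longrightarrow> M r t \<le> 1"
proof (cases "r = 0")
  case False
  assume t: "t > 0" "0 \<le> r"
  have "(\<integral>x. indicator (cball 0 r) x * u x t \<partial>lborel) \<le> (\<integral>x. u x t \<partial>lborel)"
    by (intro integral_mono integrable_slice integrable_ball_slice t)
       (auto simp: indicator_def nonneg t)
  then show ?thesis using mass_ball[of t r] mass[of t] t False by simp
qed (simp add: zero_power)

lemma A_nonneg: "t > 0 \<Longrightarrow> 0 \<le> A r t"
  unfolding A_def dilint_def set_lebesgue_integral_def
  by (intro Bochner_Integration.integral_nonneg) (auto simp: nonneg)

text \<open>A positive value at or beyond radius \<open>r\<close> would, by continuity, put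
  additional mass on a small ball outside \<open>cball 0 r\<close>, and the total would exceed
  1.\<close>

lemma mass_full_imp_zero:
  assumes t: "t > 0" and r: "r > 0" and full: "M r t = 1" and x: "r \<le> norm x"
  shows "u x t = 0"
proof (rule ccontr)
  assume "u x t \<noteq> 0"
  then have p: "u x t > 0" using nonneg[OF t, of x] by simp
  define c where "c = u x t / 2"
  have c: "c > 0" using p by (simp add: c_def)
  have "isCont (\<lambda>y. u y t) x" using continuous_slice[OF t] continuous_on_eq_continuous_at by blast
  then have "((\<lambda>y. u y t) \<longlongrightarrow> u x t) (nhds x)"
    using tendsto_at_iff_tendsto_nhds[of "\<lambda>y. u y t" x] by (simp add: isCont_def)
  then have "\<forall>\<^sub>F y in nhds x. c < u y t" by (rule order_tendstoD(1)) (use p in \<open>simp add: c_def\<close>)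
  then obtain e where e: "e > 0" "\<And>y. dist y x < e \<Longrightarrow> c < u y t"
    unfolding eventually_nhds_metric by auto
  have x0: "norm x > 0" using x r by linarith
  \<comment> \<open>\<open>x\<close> may lie on the sphere of radius \<open>r\<close>. Moving
    outward by \<open>e / 2\<close> makes the ball of radius \<open>e / 4\<close> around
    \<open>y\<close> lie strictly outside and still within distance \<open>e\<close> of
    \<open>x\<close>.\<close>
  define y where "y = x + (e / 2 / norm x) *\<^sub>R x"
  have ny: "norm y = norm x + e / 2"
  proof -
    have "y = (1 + e / 2 / norm x) *\<^sub>R x" by (simp add: y_def scaleR_add_left)
    then have "norm y = (1 + e / 2 / norm x) * norm x" using e x0 by simp
    then show ?thesis using x0 by (simp add: field_simps)
  qed
  have dy: "dist y x = e / 2" using e x0 by (simp add: y_def dist_norm)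
  define S where "S = cball y (e / 4)"
  have S: "r < norm z" "c < u z t" if "z \<in> S" for z
  proof -
    have "dist y z \<le> e / 4" using that by (simp add: S_def)
    then show "c < u z t" using dist_triangle[of z x y] dy e by (intro e(2)) (simp add: dist_commute)
    have "norm y \<le> norm z + dist y z" by (simp add: dist_norm norm_triangle_sub)
    then show "r < norm z" using \<open>dist y z \<le> e / 4\<close> ny x e by linarith
  qed
  have iS: "integrable lborel (\<lambda>z. c * indicator S z)"
    by (intro integrable_mult_right integrable_real_indicator)
       (use emeasure_lborel_cball_finite[of y "e / 4"] in \<open>auto simp: S_def\<close>)
  have mS: "measure lborel S > 0" unfolding S_def using content_cball_pos[of "e/4" y] e by simp
  have "(\<integral>z. indicator (cball 0 r) z * u z t + c * indicator S z \<partial>lborel) \<le> (\<integral>z. u z t \<partial>lborel)"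
  proof (intro integral_mono Bochner_Integration.integrable_add integrable_slice integrable_ball_slice t iS)
    fix z show "indicator (cball 0 r) z * u z t + c * indicator S z \<le> u z t"
      using S[of z] nonneg[OF t, of z] by (auto simp: indicator_def)
  qed
  then have "1 + c * measure lborel S \<le> 1"
    using mass_ball[OF t r] full mass[OF t] integrable_ball_slice[OF t] iS
    by (simp add: S_def)
  then show False using c mS by (simp add: mult_le_0_iff)
qed

lemma zero_imp_mass_full:
  assumes t: "t > 0" and r: "r > 0" and z: "\<And>x. norm x > r \<Longrightarrow> u x t = 0"
  shows "M r t = 1"
proof -
  have "(\<lambda>x. indicator (cball 0 r) x * u x t) = (\<lambda>x. u x t)"
    using z by (auto simp: fun_eq_iff indicator_def)
  then show ?thesis using mass_ball[OF t r] mass[OF t] by simp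
qed

text \<open>The substitute for openness of the positive region. Some \<open>x\<close> beyond radius
  \<open>r\<close> has \<open>u x t > 0\<close>; by continuity \<open>u x s\<close> stays positive
  for \<open>s\<close> near \<open>t\<close>, and then \<open>vanish\<close> forces
  \<open>R s\<close> to exceed \<open>norm x\<close>.\<close>

lemma mass_lt_1_nbhd:
  assumes t: "t > 0" and r: "r \<ge> 0" and lt: "M r t < 1"
  obtains r' e where "r < r'" "0 < e" "e < t" "\<And>s. \<bar>s - t\<bar> < e \<Longrightarrow> ennreal r' < R s"
proof -
  have "\<exists>x. norm x > r \<and> u x t \<noteq> 0"
  proof (cases "r = 0")
    case True
    show ?thesis
    proof (rule ccontr)
      assume "\<not> ?thesis"
      then have z: "norm x > r \<Longrightarrow> u x t = 0" for x by blast
      have "u x t = 0" if "norm x > q" "q > 0" for x q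
        by (rule z) (use True that in linarith)
      then have "M q t = 1" if "q > 0" for q using zero_imp_mass_full[OF t that] that by blast
      then have nz: "u x t = 0" if "x \<noteq> 0" for x
        using mass_full_imp_zero[OF t, of "norm x" x] that by auto
      have "AE x in lborel. u x t = 0"
        using AE_lborel_singleton[of "0::'a"] by eventually_elim (rule nz)
      then have "(\<integral>x. u x t \<partial>lborel) = 0"
        by (rule integral_eq_zero_AE)
      then show False using mass[OF t] by simp
    qed
  next
    case False
    then show ?thesis using zero_imp_mass_full[OF t, of r] r lt by force
  qed
  then obtain x where x: "norm x > r" "u x t > 0" using nonneg[OF t] by (metis less_eq_real_def)
  have "isCont (u x) t" using continuous_time t continuous_on_interior[of "{0<..}" "u x" t] by (simp add: interior_open)
  then have "(u x \<longlongrightarrow> u x t) (nhds t)" by (simp add: isCont_def tendsto_at_iff_tendsto_nhds)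
  then have "\<forall>\<^sub>F s in nhds t. 0 < u x s" by (rule order_tendstoD(1)) (rule x(2))
  then obtain e where e: "e > 0" "\<And>s. \<bar>s - t\<bar> < e \<Longrightarrow> 0 < u x s"
    unfolding eventually_nhds_metric by (auto simp: dist_real_def)
  define e' where "e' = min e (t / 2)"
  have "ennreal (norm x) < R s" if "\<bar>s - t\<bar> < e'" for s
    using vanish[of s x] e(2)[of s] that t by (force simp: e'_def not_le[symmetric])
  then show thesis using that[OF x(1), of e'] e t by (simp add: e'_def min_def)
qed

lemma C2_slice:
  assumes t: "t > 0" and r: "ennreal r \<le> R t"
  shows "C2_on (ball 0 r) (\<lambda>x. u x t)"
proof -
  have sub: "(x, t) \<in> positive_region R" if "x \<in> ball 0 r" for x
  proof -
    have "norm x < r" "0 < r" using that order.strict_trans1[OF norm_ge_zero, of x r] by auto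
    then show ?thesis using t less_le_trans[OF ennreal_lessI r, of "norm x"] by (simp add: positive_region_def)
  qed
  have sl: "continuous_on (ball 0 r) (\<lambda>x. F x t)" if "continuous_on (positive_region R) (\<lambda>(x, t). F x t)" for F :: "'a \<Rightarrow> real \<Rightarrow> real"
    by (rule continuous_on_compose2[OF that, of _ "\<lambda>x. (x, t)", simplified])
       (use sub in \<open>auto intro!: continuous_intros\<close>)
  show ?thesis unfolding C2_on_def
  proof (intro conjI ballI)
    show "continuous_on (ball 0 r) (\<lambda>x. u x t)" by (intro sl C21_onD(1)[OF C21])
    fix i :: 'a assume i: "i \<in> Basis"
    show "partially_differentiable i (\<lambda>x. u x t) x" if "x \<in> ball 0 r" for x
      by (rule C21_onD_space(2)[OF C21 i sub[OF that]])
    show "continuous_on (ball 0 r) (partial_deriv i (\<lambda>x. u x t))"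
      by (rule sl[OF C21_onD_space(1)[OF C21 i]])
    fix j :: 'a assume j: "j \<in> Basis"
    show "partially_differentiable j (partial_deriv i (\<lambda>x. u x t)) x" if "x \<in> ball 0 r" for x
      by (rule C21_onD_space(4)[OF C21 i j sub[OF that]])
    show "continuous_on (ball 0 r) (partial_deriv j (partial_deriv i (\<lambda>x. u x t)))"
      by (rule sl[OF C21_onD_space(3)[OF C21 i j]])
  qed
qed

lemma time_derivative:
  "(x, t) \<in> positive_region R \<Longrightarrow> (u x has_real_derivative laplacian (\<lambda>y. u y t) x + u x t) (at t)"
  using field_differentiable_derivI[OF C21_onD(3)[OF C21, of x t]] pde[of x t] by simp

lemma A_time_derivative:
  assumes t: "t > 0" and r: "r \<ge> 0" and lt: "M r t < 1"
  shows "(A r has_real_derivative (LINT z:cball 0 1|lborel. deriv (u (r *\<^sub>R z)) t)) (at t)"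
proof -
  obtain r' e where e: "r < r'" "0 < e" "e < t" "\<And>s. \<bar>s - t\<bar> < e \<Longrightarrow> ennreal r' < R s"
    using mass_lt_1_nbhd[OF assms] by blast
  have sub: "(r *\<^sub>R z, s) \<in> positive_region R" if "z \<in> cball 0 1" "s \<in> {t-e<..<t+e}" for z s
  proof -
    have "norm (r *\<^sub>R z) \<le> r'" using scaled_unit_ball[OF that(1), of r r'] r e by simp
    then have "ennreal (norm (r *\<^sub>R z)) < R s"
      using le_less_trans[OF ennreal_leI e(4)[of s]] that(2) by auto
    then show ?thesis using that e(3) unfolding positive_region_def by simp
  qed
  show ?thesis unfolding A_def[abs_def] dilint_def
  proof (rule has_real_derivative_set_integral_param[where U="{t-e<..<t+e}"])
    fix s assume s: "s \<in> {t-e<..<t+e}"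
    show "continuous_on (cball 0 1) (\<lambda>z. u (r *\<^sub>R z) s)"
      by (rule continuous_on_compose2[OF continuous_slice]) (use s e in \<open>auto intro!: continuous_intros\<close>)
    fix z :: 'a assume z: "z \<in> cball 0 1"
    show "((\<lambda>s. u (r *\<^sub>R z) s) has_real_derivative deriv (u (r *\<^sub>R z)) s) (at s)"
      using time_derivative[OF sub[OF z s]] pde[OF sub[OF z s]] by simp
  next
    have c: "continuous_on (positive_region R) (\<lambda>(x, t). deriv (u x) t)"
      by (rule C21_onD(2)[OF C21])
    have im: "(\<lambda>p::real \<times> 'a. (r *\<^sub>R snd p, fst p)) ` ({t-e<..<t+e} \<times> cball 0 1) \<subseteq> positive_region R"
    proof (rule image_subsetI)
      fix p :: "real \<times> 'a" assume "p \<in> {t-e<..<t+e} \<times> cball 0 1"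
      then have "snd p \<in> cball 0 1" "fst p \<in> {t-e<..<t+e}" by (auto simp only: mem_Times_iff)
      then show "(r *\<^sub>R snd p, fst p) \<in> positive_region R" by (rule sub)
    qed
    have "continuous_on ({t-e<..<t+e} \<times> cball 0 1) (\<lambda>p. (r *\<^sub>R snd p, fst p) :: 'a \<times> real)"
      by (intro continuous_intros)
    from continuous_on_compose2[OF c this im]
    show "continuous_on ({t-e<..<t+e} \<times> cball 0 1) (\<lambda>(s, z). deriv (u (r *\<^sub>R z)) s)"
      by (simp add: split_beta)
  qed (use e in auto)
qed

text \<open>\<open>mass_lt_1_nbhd\<close> keeps the closed ball of radius \<open>r\<close> inside
  the positive region for times near \<open>t\<close>, so the equation may be integrated over the
  dilated unit ball and differentiated under the integral.\<close>

lemma A_evolution: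
  assumes t: "t > 0" and r: "r \<ge> 0" and lt: "M r t < 1"
  obtains l where "radial_op (DIM('a) + 1) (\<lambda>r. A r t) r l" "(A r has_real_derivative l + A r t) (at t)"
proof -
  obtain r' e where e: "r < r'" "0 < e" "e < t" "\<And>s. \<bar>s - t\<bar> < e \<Longrightarrow> ennreal r' < R s"
    using mass_lt_1_nbhd[OF assms] by blast
  have R: "ennreal r' < R t" using e by simp
  have C: "C2_on (ball 0 r') (\<lambda>x. u x t)" using C2_slice[OF t less_imp_le[OF R]] .
  have rr: "\<bar>r\<bar> < r'" using r e by simp
  have sub: "(r *\<^sub>R z, t) \<in> positive_region R" if "z \<in> cball 0 1" for z
  proof -
    have "norm (r *\<^sub>R z) \<le> r'" using scaled_unit_ball[OF that(1) rr] by simp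
    then have "ennreal (norm (r *\<^sub>R z)) < R t"
      using le_less_trans[OF ennreal_leI R] by auto
    then show ?thesis using t unfolding positive_region_def by simp
  qed
  define l where "l = (LINT z:cball 0 1|lborel. laplacian (\<lambda>x. u x t) (r *\<^sub>R z))"
  have "(LINT z:cball 0 1|lborel. deriv (u (r *\<^sub>R z)) t)
      = (LINT z:cball 0 1|lborel. laplacian (\<lambda>x. u x t) (r *\<^sub>R z) + u (r *\<^sub>R z) t)"
    by (rule set_lebesgue_integral_cong) (use pde[OF sub] in auto)
  also have "\<dots> = l + A r t"
    unfolding l_def A_def dilint_def
    by (rule set_integral_add)
       (auto intro!: set_integrable_compact_continuous continuous_on_dilated_slice[OF _ rr] continuous_on_laplacian C
          continuous_on_subset[OF continuous_slice[OF t]])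
  finally have *: "(LINT z:cball 0 1|lborel. deriv (u (r *\<^sub>R z)) t) = l + A r t" .
  show thesis
  proof (rule that)
    show "radial_op (DIM('a) + 1) (\<lambda>r. A r t) r l"
      unfolding A_def[abs_def] l_def using radial_op_dilint[OF C rr] by simp
    show "(A r has_real_derivative l + A r t) (at t)"
      using A_time_derivative[OF assms] * by simp
  qed
qed

lemma continuous_A: "continuous_on (UNIV \<times> {0<..}) (\<lambda>(r, t). A r t)"
proof -
  have "continuous_on (UNIV \<times> {0<..}) (\<lambda>p. LINT z:cball 0 1|lborel. u (fst p *\<^sub>R z) (snd p))"
  proof (rule continuous_on_set_integral_param)
    show "continuous_on ((UNIV \<times> {0<..}) \<times> cball 0 1) (\<lambda>(p, z). u (fst p *\<^sub>R z) (snd p))"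
      unfolding split_beta
      by (rule continuous_on_compose2[OF cont, of _ "\<lambda>q. (fst (fst q) *\<^sub>R snd q, snd (fst q))", simplified])
         (auto intro!: continuous_intros)
  qed simp
  then show ?thesis by (simp add: A_def dilint_def split_beta)
qed

end

lemma small_near_sphere:
  fixes f :: "'a::euclidean_space \<Rightarrow> real"
  assumes f: "continuous_on UNIV f" and z: "\<And>x. norm x = r \<Longrightarrow> f x = 0" and r: "r > 0" and e: "e > 0"
  obtains r1 where "0 < r1" "r1 < r" "\<And>x. r1 \<le> norm x \<Longrightarrow> norm x \<le> r \<Longrightarrow> f x < e"
proof -
  have "uniformly_continuous_on (cball 0 r) f"
    by (rule compact_uniformly_continuous) (auto intro: continuous_on_subset[OF f])
  then obtain \<delta> where \<delta>: "\<delta> > 0" "\<And>x y. x \<in> cball 0 r \<Longrightarrow> y \<in> cball 0 r \<Longrightarrow> dist y x < \<delta> \<Longrightarrow> dist (f y) (f x) < e"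
    using uniformly_continuous_onE[OF _ e] by metis
  define r1 where "r1 = max (r / 2) (r - \<delta> / 2)"
  show thesis
  proof (rule that)
    show "0 < r1" "r1 < r" using r \<delta>(1) by (auto simp: r1_def)
    fix x :: 'a assume x: "r1 \<le> norm x" "norm x \<le> r"
    then have "r / 2 \<le> norm x" by (simp add: r1_def)
    then have x0: "norm x > 0" using r by linarith
    define y where "y = (r / norm x) *\<^sub>R x"
    have ny: "norm y = r" using x0 r by (simp add: y_def)
    have "y - x = (r / norm x - 1) *\<^sub>R x" by (simp add: y_def scaleR_diff_left)
    then have "norm (y - x) = \<bar>r / norm x - 1\<bar> * norm x" by simp
    also have "\<bar>r / norm x - 1\<bar> = r / norm x - 1" using x x0 by (intro abs_of_nonneg) simp
    also have "(r / norm x - 1) * norm x = r - norm x" using x0 by (simp add: left_diff_distrib)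
    also have "\<dots> < \<delta>" using x \<delta>(1) by (simp add: r1_def)
    finally have "dist (f y) (f x) < e" using x ny by (intro \<delta>(2)) (auto simp: dist_norm)
    then show "f x < e" using z[OF ny] by (simp add: dist_real_def)
  qed
qed

lemma continuous_dilint: "continuous_on UNIV (f :: 'a::euclidean_space \<Rightarrow> real) \<Longrightarrow> continuous_on UNIV (dilint f)"
  unfolding dilint_def[abs_def]
  by (intro continuous_on_set_integral_param) (auto simp: split_beta intro!: continuous_on_compose2[of UNIV f] continuous_intros)

lemma power_dim_strict_mono: "0 \<le> r \<Longrightarrow> r < s \<Longrightarrow> r ^ DIM('a::euclidean_space) < (s::real) ^ DIM('a)"
  by (intro power_strict_mono) auto


section \<open>The ground state and its mass function\<close>

locale ground_state =
  fixes \<rho> :: real and U :: "'a::euclidean_space \<Rightarrow> real"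
  assumes gs: "normalized_ground_state \<rho> U"
begin

definition g :: "real \<Rightarrow> real" where "g = dilint U"

abbreviation V :: "real \<Rightarrow> real" where "V r \<equiv> r ^ DIM('a) * g r"

lemma rho_pos: "0 < \<rho>" and C2_U: "C2_on (ball 0 \<rho>) U"
  and U_pos: "norm x < \<rho> \<Longrightarrow> 0 < U x"
  using gs unfolding normalized_ground_state_def dirichlet_eigenproblem_def by auto

lemma laplacian_U: "norm x < \<rho> \<Longrightarrow> laplacian U x = - U x"
  using gs unfolding normalized_ground_state_def dirichlet_eigenproblem_def by (metis minus_minus mult_1)

lemma U_zero: "\<rho> \<le> norm x \<Longrightarrow> U x = 0"
  using gs unfolding normalized_ground_state_def dirichlet_eigenproblem_def by (auto simp: order_le_less)

lemma U_nonneg: "0 \<le> U x"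
  using U_pos[of x] U_zero[of x] by (cases "norm x < \<rho>") auto

lemma continuous_U: "continuous_on UNIV U"
proof -
  have "continuous_on (cball 0 \<rho> \<union> {x. \<rho> \<le> norm x}) U"
  proof (rule continuous_on_closed_Un)
    show "continuous_on (cball 0 \<rho>) U" using gs by (simp add: normalized_ground_state_def dirichlet_eigenproblem_def)
    have "continuous_on {x::'a. \<rho> \<le> norm x} (\<lambda>x. 0::real)" by simp
    then show "continuous_on {x. \<rho> \<le> norm x} U"
      by (rule continuous_on_eq) (simp add: U_zero)
  qed (auto intro!: closed_Collect_le continuous_intros)
  moreover have "cball 0 \<rho> \<union> {x::'a. \<rho> \<le> norm x} = UNIV" by auto
  ultimately show ?thesis by simp
qed

lemma measurable_U: "U \<in> borel_measurable borel"
  by (intro borel_measurable_continuous_onI continuous_U)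

lemma integral_U: "(\<integral>x. U x \<partial>lborel) = 1"
proof -
  have "(\<lambda>x. indicator (ball 0 \<rho>) x *\<^sub>R U x) = U" using U_zero by (auto simp: fun_eq_iff indicator_def)
  then show ?thesis using gs by (simp add: normalized_ground_state_def set_lebesgue_integral_def)
qed

lemma g_uminus: "g (- r) = g r"
  unfolding g_def by (rule dilint_uminus[OF measurable_U])

lemma continuous_g: "continuous_on S g"
  unfolding g_def using continuous_dilint[OF continuous_U] continuous_on_subset by blast

lemma g_full: "V \<rho> = 1"
proof -
  have "(\<lambda>x. indicator (cball 0 \<rho>) x *\<^sub>R U x) = U" using U_zero by (auto simp: fun_eq_iff indicator_def)
  then show ?thesis unfolding g_def dilint_eq[OF measurable_U rho_pos] set_lebesgue_integral_def
    using integral_U by simp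
qed

lemma U_lower_bound:
  assumes "r < \<rho>"
  obtains c where "c > 0" "\<And>x. norm x \<le> r \<Longrightarrow> c \<le> U x"
proof (cases "r < 0")
  case True
  have "1 \<le> U x" if "norm x \<le> r" for x
    using order_trans[OF norm_ge_zero that] True by simp
  then show thesis using that[of 1] by simp
next
  case False
  have "\<exists>x\<in>cball 0 r. \<forall>y\<in>cball 0 r. U x \<le> U y"
    by (rule continuous_attains_inf) (use False in \<open>auto intro: continuous_on_subset[OF continuous_U]\<close>)
  then obtain x where "norm x \<le> r" "\<And>y. norm y \<le> r \<Longrightarrow> U x \<le> U y" by auto
  then show thesis using U_pos[of x] assms by (intro that[of "U x"]) auto
qed

lemma V_mono: "0 \<le> r \<Longrightarrow> r \<le> s \<Longrightarrow> V r \<le> V s"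
  using mass_annulus_ge[OF continuous_U, of r s 0] U_nonneg by (simp add: g_def)

lemma V_strict_mono:
  assumes "0 \<le> r" "r < s" "s < \<rho>" shows "V r < V s"
proof -
  obtain c where c: "c > 0" "\<And>x. norm x \<le> s \<Longrightarrow> c \<le> U x" using U_lower_bound[OF assms(3)] by blast
  have "0 < c * unit_ball_vol DIM('a) * (s ^ DIM('a) - r ^ DIM('a))"
    using c(1) power_dim_strict_mono[OF assms(1,2), where 'a='a] by simp
  also have "\<dots> \<le> V s - V r"
    using mass_annulus_ge[OF continuous_U, of r s c] assms c by (simp add: g_def)
  finally show ?thesis by simp
qed

lemma V_le_1: "0 \<le> r \<Longrightarrow> r \<le> \<rho> \<Longrightarrow> V r \<le> 1"
  using V_mono[of r \<rho>] g_full by simp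

lemma V_lt_1: assumes "0 \<le> r" "r < \<rho>" shows "V r < 1"
proof -
  have "V r < V ((r + \<rho>) / 2)"
    by (rule V_strict_mono) (use assms in auto)
  also have "\<dots> \<le> 1" by (rule V_le_1) (use assms in auto)
  finally show ?thesis .
qed

lemma g_zero: "g 0 = unit_ball_vol DIM('a) * U 0"
  unfolding g_def by (rule dilint_zero)

lemma g_pos: assumes "0 \<le> r" "r \<le> \<rho>" shows "0 < g r"
proof (cases "r = 0")
  case True
  then show ?thesis using g_zero U_pos[of 0] rho_pos by simp
next
  case False
  have "0 < V r"
  proof (cases "r = \<rho>")
    case True then show ?thesis using g_full by simp
  next
    case F: False
    have "V 0 < V r" by (rule V_strict_mono) (use assms False F in auto)
    then show ?thesis by (simp add: zero_power)
  qed
  then show ?thesis using assms False by (simp add: zero_less_mult_iff)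
qed

lemma radial_op_g:
  assumes "\<bar>r\<bar> < \<rho>" shows "radial_op (DIM('a) + 1) g r (- g r)"
proof -
  have "(LINT z:cball 0 1|lborel. laplacian U (r *\<^sub>R z)) = (LINT z:cball 0 1|lborel. - U (r *\<^sub>R z))"
  proof (rule set_lebesgue_integral_cong)
    have "laplacian U (r *\<^sub>R z) = - U (r *\<^sub>R z)" if "z \<in> cball 0 1" for z
      by (rule laplacian_U) (use scaled_unit_ball[OF that assms] in simp)
    then show "\<forall>z. z \<in> cball 0 1 \<longrightarrow> laplacian U (r *\<^sub>R z) = - U (r *\<^sub>R z)" by blast
  qed simp
  also have "\<dots> = - g r" by (simp add: g_def dilint_def set_lebesgue_integral_def)
  finally show ?thesis using radial_op_dilint[OF C2_U assms] by (simp add: g_def)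
qed

text \<open>\<open>U\<close> vanishes on the sphere of radius \<open>\<rho>\<close>, so
  \<open>V\<close> reaches 1 with slope zero. In the lower barrier this has the role that the
  flatness of \<open>M\<close> at full mass has in the upper one.\<close>

lemma V_flat:
  assumes "e > 0"
  obtains r1 where "0 < r1" "r1 < \<rho>" "\<And>r. r1 \<le> r \<Longrightarrow> r \<le> \<rho> \<Longrightarrow>
    1 - V r \<le> e * unit_ball_vol DIM('a) * (\<rho> ^ DIM('a) - r ^ DIM('a))"
proof -
  obtain r1 where r1: "0 < r1" "r1 < \<rho>" "\<And>x. r1 \<le> norm x \<Longrightarrow> norm x \<le> \<rho> \<Longrightarrow> U x < e"
    using small_near_sphere[OF continuous_U _ rho_pos assms] U_zero by auto
  show thesis
  proof (rule that[OF r1(1,2)])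
    fix r assume r: "r1 \<le> r" "r \<le> \<rho>"
    show "1 - V r \<le> e * unit_ball_vol DIM('a) * (\<rho> ^ DIM('a) - r ^ DIM('a))"
      using mass_annulus_le[OF continuous_U, of r \<rho> e] r r1 g_full by (force simp: g_def)
  qed
qed

end

section \<open>Comparison principle and rescaled ground states as barriers\<close>

context fbp
begin

text \<open>The sign \<open>s\<close> allows to treat upper and lower barriers at once.\<close>

lemma comparison:
  fixes s :: real and G :: "real \<Rightarrow> real \<Rightarrow> real"
  assumes t0: "0 < t0" and r0: "0 < r0"
    and contG: "continuous_on ({0..r0} \<times> {t0..T}) (\<lambda>(r, t). G r t)"
    and even: "\<And>r t. G (- r) t = G r t"
    and init: "\<And>r. 0 \<le> r \<Longrightarrow> r \<le> r0 \<Longrightarrow> s * (A r t0 - G r t0) \<le> 0"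
    and good: "\<And>r t. 0 \<le> r \<Longrightarrow> r \<le> r0 \<Longrightarrow> t0 < t \<Longrightarrow> t \<le> T \<Longrightarrow> 0 < s * (A r t - G r t) \<Longrightarrow>
        (\<And>r'. 0 \<le> r' \<Longrightarrow> r' \<le> r0 \<Longrightarrow> s * (A r' t - G r' t) \<le> s * (A r t - G r t)) \<Longrightarrow> r < r0 \<and> M r t < 1"
    and evol: "\<And>r t. 0 \<le> r \<Longrightarrow> r < r0 \<Longrightarrow> t0 < t \<Longrightarrow> t \<le> T \<Longrightarrow> 0 < s * (A r t - G r t) \<Longrightarrow>
        \<exists>l g. radial_op (DIM('a) + 1) (\<lambda>r. G r t) r l \<and> (G r has_real_derivative g) (at t) \<and> s * (l + G r t) \<le> s * g"
    and r: "0 \<le> r" "r \<le> r0" and t: "t0 \<le> t" "t \<le> T"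
  shows "s * (A r t - G r t) \<le> 0"
proof (rule parabolic_max_principle[where K="{0..r0}" and D="\<lambda>r t. s * (A r t - G r t)" and T=T and ?t0.0=t0])
  show "compact {0..r0}" by simp
  show "continuous_on ({0..r0} \<times> {t0..T}) (\<lambda>(r, t). s * (A r t - G r t))"
    unfolding split_beta
    by (intro continuous_intros contG[unfolded split_beta] continuous_on_subset[OF continuous_A[unfolded split_beta]])
       (use t0 in auto)
  show "s * (A r t0 - G r t0) \<le> 0" if "r \<in> {0..r0}" for r using init that by simp
  show "r \<in> {0..r0}" "t0 \<le> t" "t \<le> T" using r t by auto
  fix r t assume *: "r \<in> {0..r0}" "t0 < t" "t \<le> T" "0 < s * (A r t - G r t)"
    "\<And>r'. r' \<in> {0..r0} \<Longrightarrow> s * (A r' t - G r' t) \<le> s * (A r t - G r t)"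
  \<comment> \<open>The obstacle enters through \<open>good\<close>: at a positive maximum it
    excludes both the outer radius \<open>r0\<close> and the contact set \<open>M = 1\<close>, so
    that \<open>A_evolution\<close> is available.\<close>
  then have rr: "0 \<le> r" "r < r0" "M r t < 1" using good[of r t] by auto
  have tp: "t > 0" using * t0 by simp
  obtain l where l: "radial_op (DIM('a) + 1) (\<lambda>r. A r t) r l" "(A r has_real_derivative l + A r t) (at t)"
    using A_evolution[OF tp rr(1,3)] by blast
  obtain m g where m: "radial_op (DIM('a) + 1) (\<lambda>r. G r t) r m" "(G r has_real_derivative g) (at t)"
      "s * (m + G r t) \<le> s * g"
    using evol[OF rr(1,2) *(2-4)] by blast
  have "s * (l - m) \<le> 0"
  proof (rule radial_op_local_max)
    show "radial_op (DIM('a) + 1) (\<lambda>r. s * (A r t - G r t)) r (s * (l - m))"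
      by (intro radial_op_cmult radial_op_diff l m)
    \<comment> \<open>For \<open>r = 0\<close> every neighbourhood contains negative radii; evenness
      of \<open>A\<close> and \<open>G\<close> reduces them to positive ones.\<close>
    have "\<forall>\<^sub>F q in nhds r. q \<in> {-r0<..<r0}" by (rule eventually_nhds_in_open) (use rr in auto)
    then show "\<forall>\<^sub>F q in nhds r. s * (A q t - G q t) \<le> s * (A r t - G r t)"
    proof eventually_elim
      case (elim q)
      have "A q t - G q t = A \<bar>q\<bar> t - G \<bar>q\<bar> t"
        using A_uminus[OF tp, of q] even[of q t] by (simp add: abs_if)
      then show ?case using *(5)[of "\<bar>q\<bar>"] elim by auto
    qed
  qed simp
  then have "s * (l + A r t - g) \<le> s * (A r t - G r t)"
    using m(3) by (simp add: algebra_simps)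
  moreover have "((\<lambda>t. s * (A r t - G r t)) has_real_derivative s * (l + A r t - g)) (at t)"
    by (intro DERIV_cmult DERIV_diff l m)
  ultimately show "\<exists>d. ((\<lambda>t. s * (A r t - G r t)) has_real_derivative d) (at t) \<and> d \<le> s * (A r t - G r t)"
    by blast
qed

end

locale fbp_ground = fbp u R + ground_state \<rho> U
  for u :: "'a::euclidean_space \<Rightarrow> real \<Rightarrow> real" and R :: "real \<Rightarrow> ennreal" and \<rho> :: real and U :: "'a \<Rightarrow> real"
begin

text \<open>\<open>q ^ DIM('a) * g (q * r)\<close> is \<open>dilint\<close> of the rescaled state
  \<open>q^d U(q x)\<close> at \<open>r\<close>. The exact growth rate would be
  \<open>1 - q\<^sup>2\<close>; the condition on \<open>k\<close> leaves room on the admissible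
  side, so that later \<open>k = 0\<close> can be used to keep the factor constant.\<close>

lemma barrier_comparison:
  fixes s :: real
  assumes G: "G = (\<lambda>r t. c0 * exp (k * (t - t0)) * (q ^ DIM('a) * g (q * r)))"
    and q: "0 < q" and t0: "0 < t0" and c0: "0 < c0" and k: "0 \<le> s * (k - (1 - q\<^sup>2))"
    and init: "\<And>r. 0 \<le> r \<Longrightarrow> r \<le> \<rho> / q \<Longrightarrow> s * (A r t0 - c0 * (q ^ DIM('a) * g (q * r))) \<le> 0"
    and good: "\<And>r t. 0 \<le> r \<Longrightarrow> r \<le> \<rho> / q \<Longrightarrow> t0 < t \<Longrightarrow> t \<le> T \<Longrightarrow> 0 < s * (A r t - G r t) \<Longrightarrow>
        (\<And>r'. 0 \<le> r' \<Longrightarrow> r' \<le> \<rho> / q \<Longrightarrow> s * (A r' t - G r' t) \<le> s * (A r t - G r t)) \<Longrightarrow> r < \<rho> / q \<and> M r t < 1"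
    and r: "0 \<le> r" "r \<le> \<rho> / q" and t: "t0 \<le> t" "t \<le> T"
  shows "s * (A r t - G r t) \<le> 0"
proof (rule comparison[OF t0 _ _ _ _ good _ r t])
  show "0 < \<rho> / q" using rho_pos q by simp
  show "continuous_on ({0..\<rho> / q} \<times> {t0..T}) (\<lambda>(r, t). G r t)"
    unfolding G split_beta
    by (intro continuous_intros continuous_on_compose2[OF continuous_g[of UNIV]]) auto
  show "G (- r) t = G r t" for r t using g_uminus[of "q * r"] by (simp add: G)
  show "s * (A r t0 - G r t0) \<le> 0" if "0 \<le> r" "r \<le> \<rho> / q" for r
    using init[OF that] by (simp add: G)
  fix r t assume r: "0 \<le> r" "r < \<rho> / q"
  define c where "c = c0 * exp (k * (t - t0))"
  have qr: "0 \<le> q * r" "\<bar>q * r\<bar> < \<rho>" using r q by (simp_all add: field_simps)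
  then have "radial_op (DIM('a) + 1) (\<lambda>r. g (q * r)) r (q\<^sup>2 * - g (q * r))"
    by (intro radial_op_scale radial_op_g) (use q in auto)
  then have op: "radial_op (DIM('a) + 1) (\<lambda>r. G r t) r (c * (q ^ DIM('a) * (q\<^sup>2 * - g (q * r))))"
    unfolding G c_def by (intro radial_op_cmult)
  have der: "(G r has_real_derivative k * G r t) (at t)"
    unfolding G by (rule derivative_eq_intros refl | simp)+
  have "0 < g (q * r)" using qr by (intro g_pos) auto
  then have "0 \<le> s * (k - (1 - q\<^sup>2)) * G r t" unfolding G using k q c0 by simp
  then have "s * (- q\<^sup>2 * G r t + G r t) \<le> s * (k * G r t)" by (simp add: algebra_simps)
  also have "- q\<^sup>2 * G r t = c * (q ^ DIM('a) * (q\<^sup>2 * - g (q * r)))" by (simp add: G c_def)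
  finally have "s * (c * (q ^ DIM('a) * (q\<^sup>2 * - g (q * r))) + G r t) \<le> s * (k * G r t)" .
  then show "\<exists>l h. radial_op (DIM('a) + 1) (\<lambda>r. G r t) r l \<and> (G r has_real_derivative h) (at t) \<and> s * (l + G r t) \<le> s * h"
    using op der by blast
qed

lemma barrier_mass: "q > 0 \<Longrightarrow> r ^ DIM('a) * (c * (q ^ DIM('a) * g (q * r))) = c * (V (q * r))"
  by (simp add: power_mult_distrib)

text \<open>Since \<open>c \<ge> 1\<close> up to time \<open>T\<close>, the barrier has mass at
  least 1 at \<open>\<rho> / q\<close>, and \<open>A\<close> cannot exceed it there. If a positive
  maximum \<open>m\<close> of \<open>A - G\<close> occurred at full mass, maximality together with
  monotonicity of the barrier mass would force \<open>M\<close> to rise by at least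
  \<open>m * (r^d - r1^d)\<close> between \<open>r1\<close> and \<open>r\<close>; but
  \<open>u\<close> vanishes at radius \<open>r\<close>, so \<open>M\<close> rises by at most half of
  that for \<open>r1\<close> close to \<open>r\<close>.\<close>

lemma upper_barrier:
  assumes q: "1 < q" and t0: "0 < t0" and c0: "0 < c0" and k: "1 - q\<^sup>2 \<le> k" "k \<le> 0"
    and T: "1 \<le> c0 * exp (k * (T - t0))"
    and init: "\<And>r. 0 \<le> r \<Longrightarrow> r \<le> \<rho> / q \<Longrightarrow> A r t0 \<le> c0 * (q ^ DIM('a) * g (q * r))"
    and r: "0 \<le> r" "r \<le> \<rho> / q" and t: "t0 \<le> t" "t \<le> T"
  shows "A r t \<le> c0 * exp (k * (t - t0)) * (q ^ DIM('a) * g (q * r))"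
proof -
  define G where "G = (\<lambda>r t. c0 * exp (k * (t - t0)) * (q ^ DIM('a) * g (q * r)))"
  have "1 * (A r t - G r t) \<le> 0"
  proof (rule barrier_comparison[OF G_def _ t0 c0 _ _ _ r t])
    show "1 * (A r t0 - c0 * (q ^ DIM('a) * g (q * r))) \<le> 0" if "0 \<le> r" "r \<le> \<rho> / q" for r
      using init[OF that] by simp
    fix r t assume rt: "0 \<le> r" "t0 < t" "t \<le> T" "0 < 1 * (A r t - G r t)"
    then have tp: "t > 0" using t0 by simp
    assume rr: "r \<le> \<rho> / q" and mx: "\<And>r'. 0 \<le> r' \<Longrightarrow> r' \<le> \<rho> / q \<Longrightarrow> 1 * (A r' t - G r' t) \<le> 1 * (A r t - G r t)"
    define c where "c = c0 * exp (k * (t - t0))"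
    have "k * (T - t0) \<le> k * (t - t0)" using k rt by (intro mult_left_mono_neg) auto
    then have "c0 * exp (k * (T - t0)) \<le> c" unfolding c_def using c0 by simp
    then have c: "1 \<le> c" using T by simp
    have GV: "x ^ DIM('a) * G x t = c * (V (q * x))" for x
      unfolding G_def c_def[symmetric] by (rule barrier_mass) (use q in simp)
    define m where "m = A r t - G r t"
    have m: "m > 0" using rt by (simp add: m_def)
    show "r < \<rho> / q \<and> M r t < 1"
    proof
      show "r < \<rho> / q"
      proof (rule ccontr)
        assume "\<not> ?thesis"
        then have r: "r = \<rho> / q" using rr by simp
        then have "r ^ DIM('a) * G r t = c" using GV[of r] q g_full by simp
        moreover have "r ^ DIM('a) * G r t < M r t"
          using rt r rho_pos q by (intro mult_strict_left_mono) auto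
        ultimately show False using mass_le_1[OF tp rt(1)] c by simp
      qed
      show "M r t < 1"
      proof (rule ccontr)
        assume "\<not> ?thesis"
        then have full: "M r t = 1" using mass_le_1[OF tp rt(1)] by simp
        then have "r \<noteq> 0" by (auto simp: zero_power)
        then have rp: "r > 0" using rt by simp
        \<comment> \<open>Chosen so that \<open>u < \<epsilon>\<close> on an annulus bounds its mass
          by \<open>m / 2\<close> times the difference of the \<open>d\<close>-th powers of the
          radii.\<close>
        define \<epsilon> where "\<epsilon> = m / (2 * unit_ball_vol DIM('a))"
        have \<epsilon>: "\<epsilon> > 0" "\<epsilon> * unit_ball_vol DIM('a) = m / 2" using m unit_ball_vol_pos[of "real DIM('a)"] by (auto simp: \<epsilon>_def simp del: unit_ball_vol_pos)
        have "\<And>x. norm x = r \<Longrightarrow> u x t = 0" using mass_full_imp_zero[OF tp rp full] by simp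
        then obtain r1 where r1: "0 < r1" "r1 < r" "\<And>x. r1 \<le> norm x \<Longrightarrow> norm x \<le> r \<Longrightarrow> u x t < \<epsilon>"
          using small_near_sphere[OF continuous_slice[OF tp] _ rp \<epsilon>(1)] by auto
        have up: "M r t - M r1 t \<le> m / 2 * (r ^ DIM('a) - r1 ^ DIM('a))"
          using mass_annulus_le[OF continuous_slice[OF tp], of r1 r \<epsilon>] r1 unfolding \<epsilon>(2) A_def
          by (simp add: less_imp_le)
        have "A r1 t \<le> G r1 t + m" using mx[of r1] r1 rr by (simp add: m_def)
        then have "M r1 t \<le> r1 ^ DIM('a) * (G r1 t + m)" using r1 by (intro mult_left_mono) auto
        moreover have "r1 ^ DIM('a) * G r1 t \<le> r ^ DIM('a) * G r t"
          unfolding GV using c r1 q by (intro mult_left_mono V_mono) auto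
        moreover have "M r t = r ^ DIM('a) * G r t + m * r ^ DIM('a)"
          by (simp add: m_def algebra_simps)
        ultimately have "m * (r ^ DIM('a) - r1 ^ DIM('a)) \<le> m / 2 * (r ^ DIM('a) - r1 ^ DIM('a))"
          using up by (simp add: algebra_simps)
        moreover have "0 < r ^ DIM('a) - r1 ^ DIM('a)"
          using power_dim_strict_mono[of r1 r, where 'a='a] r1 by simp
        ultimately show False using m by (simp add: mult_le_cancel_right)
      qed
    qed
  qed (use q k in auto)
  then show ?thesis by (simp add: G_def)
qed

text \<open>The mirror image: \<open>c \<le> 1\<close> keeps the barrier mass at most 1, so
  \<open>A < G\<close> already implies \<open>M < 1\<close>. At \<open>\<rho> / q\<close> the
  flatness of \<open>V\<close> plays the part that the flatness of \<open>M\<close> played before,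
  and \<open>M\<close> itself is nondecreasing in \<open>r\<close>.\<close>

lemma lower_barrier:
  assumes q: "0 < q" "q < 1" and t0: "0 < t0" and c0: "0 < c0" and k: "0 \<le> k" "k \<le> 1 - q\<^sup>2"
    and T: "c0 * exp (k * (T - t0)) \<le> 1"
    and init: "\<And>r. 0 \<le> r \<Longrightarrow> r \<le> \<rho> / q \<Longrightarrow> c0 * (q ^ DIM('a) * g (q * r)) \<le> A r t0"
    and r: "0 \<le> r" "r \<le> \<rho> / q" and t: "t0 \<le> t" "t \<le> T"
  shows "c0 * exp (k * (t - t0)) * (q ^ DIM('a) * g (q * r)) \<le> A r t"
proof -
  define G where "G = (\<lambda>r t. c0 * exp (k * (t - t0)) * (q ^ DIM('a) * g (q * r)))"
  have gp: "0 < g (q * r)" if "0 \<le> r" "r \<le> \<rho> / q" for r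
    by (rule g_pos) (use that q in \<open>auto simp: field_simps\<close>)
  have "(-1) * (A r t - G r t) \<le> 0"
  proof (rule barrier_comparison[OF G_def _ t0 c0 _ _ _ r t])
    show "(-1) * (A r t0 - c0 * (q ^ DIM('a) * g (q * r))) \<le> 0" if "0 \<le> r" "r \<le> \<rho> / q" for r
      using init[OF that] by simp
    fix r t assume rt: "0 \<le> r" "t0 < t" "t \<le> T" "0 < (-1) * (A r t - G r t)"
    then have tp: "t > 0" using t0 by simp
    assume rr: "r \<le> \<rho> / q" and mx: "\<And>r'. 0 \<le> r' \<Longrightarrow> r' \<le> \<rho> / q \<Longrightarrow> (-1) * (A r' t - G r' t) \<le> (-1) * (A r t - G r t)"
    define c where "c = c0 * exp (k * (t - t0))"
    have "k * (t - t0) \<le> k * (T - t0)" using k rt by (intro mult_left_mono) auto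
    then have "c \<le> c0 * exp (k * (T - t0))" unfolding c_def using c0 by simp
    then have "c \<le> 1" using T by linarith
    then have c: "0 < c" "c \<le> 1" using c0 by (simp_all add: c_def)
    have GV: "x ^ DIM('a) * G x t = c * (V (q * x))" for x
      unfolding G_def c_def[symmetric] by (rule barrier_mass) (use q in simp)
    define m where "m = G r t - A r t"
    have m: "m > 0" using rt by (simp add: m_def)
    show "r < \<rho> / q \<and> M r t < 1"
    proof
      show "M r t < 1"
      proof (cases "r = 0")
        case False
        then have "M r t < r ^ DIM('a) * G r t"
          using rt by (intro mult_strict_left_mono) auto
        also have "\<dots> \<le> 1 * 1" unfolding GV using c q rt rr
          by (intro mult_mono V_le_1) (auto simp: field_simps intro!: mult_nonneg_nonneg less_imp_le[OF gp])
        finally show ?thesis by simp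
      qed (simp add: zero_power)
      show "r < \<rho> / q"
      proof (rule ccontr)
        assume "\<not> ?thesis"
        then have r: "r = \<rho> / q" using rr by simp
        then have qr: "q * r = \<rho>" using q by simp
        define \<epsilon> where "\<epsilon> = m / (2 * unit_ball_vol DIM('a))"
        have \<epsilon>: "\<epsilon> > 0" "\<epsilon> * unit_ball_vol DIM('a) = m / 2" using m unit_ball_vol_pos[of "real DIM('a)"] by (auto simp: \<epsilon>_def simp del: unit_ball_vol_pos)
        obtain s1 where s1: "0 < s1" "s1 < \<rho>" "\<And>s. s1 \<le> s \<Longrightarrow> s \<le> \<rho> \<Longrightarrow>
            1 - V s \<le> \<epsilon> * unit_ball_vol DIM('a) * (\<rho> ^ DIM('a) - s ^ DIM('a))"
          using V_flat[OF \<epsilon>(1)] by blast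
        define r1 where "r1 = s1 / q"
        have r1: "0 < r1" "r1 < r" "q * r1 = s1" using s1 q by (auto simp: r1_def r divide_strict_right_mono)
        have pos: "0 < r ^ DIM('a) - r1 ^ DIM('a)"
          using power_dim_strict_mono[of r1 r, where 'a='a] r1 by simp
        have "r ^ DIM('a) * G r t - r1 ^ DIM('a) * G r1 t = c * (1 - V s1)"
          unfolding GV qr r1(3) using g_full by (simp add: algebra_simps)
        also have "\<dots> \<le> 1 * (m / 2 * (\<rho> ^ DIM('a) - s1 ^ DIM('a)))"
          using s1(3)[of s1] V_le_1[of s1] c s1(1,2) unfolding \<epsilon>(2) by (intro mult_mono) auto
        also have "\<rho> ^ DIM('a) - s1 ^ DIM('a) = q ^ DIM('a) * (r ^ DIM('a) - r1 ^ DIM('a))"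
          unfolding qr[symmetric] r1(3)[symmetric] power_mult_distrib by (simp add: algebra_simps)
        also have "1 * (m / 2 * (q ^ DIM('a) * (r ^ DIM('a) - r1 ^ DIM('a)))) \<le> m / 2 * (1 * (r ^ DIM('a) - r1 ^ DIM('a)))"
          using m pos q by (simp add: power_le_one mult_right_le_one_le mult_left_le_one_le)
        finally have up: "r ^ DIM('a) * G r t - r1 ^ DIM('a) * G r1 t \<le> m / 2 * (r ^ DIM('a) - r1 ^ DIM('a))" by simp
        have "G r1 t - m \<le> A r1 t" using mx[of r1] r1 rr by (simp add: m_def)
        then have "r1 ^ DIM('a) * (G r1 t - m) \<le> M r1 t" using r1 by (intro mult_left_mono) auto
        also have "\<dots> \<le> M r t" using mass_mono[OF tp, of r1 r] r1 by simp
        also have "\<dots> = r ^ DIM('a) * G r t - m * r ^ DIM('a)" by (simp add: m_def algebra_simps)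
        finally have "m * (r ^ DIM('a) - r1 ^ DIM('a)) \<le> m / 2 * (r ^ DIM('a) - r1 ^ DIM('a))"
          using up by (simp add: algebra_simps)
        then show False using m pos by (simp add: mult_le_cancel_right)
      qed
    qed
  qed (use q k in auto)
  then show ?thesis by (simp add: G_def)
qed

end

section \<open>Strict positivity of the mass after a positive time\<close>

context fbp
begin

lemma exists_large_mass:
  assumes t: "t > 0" obtains n :: nat where "n > 0" "1 / 2 < M (real n) t"
proof -
  have "(\<lambda>n. \<integral>x. indicator (cball 0 (real n)) x * u x t \<partial>lborel) \<longlonglongrightarrow> (\<integral>x. u x t \<partial>lborel)"
  proof (rule integral_dominated_convergence[where w="\<lambda>x. u x t"])
    show "(\<lambda>x. u x t) \<in> borel_measurable lborel" using measurable_slice[OF t] by simp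
    show "(\<lambda>x. indicator (cball 0 (real n)) x * u x t) \<in> borel_measurable lborel" for n
      using integrable_ball_slice[OF t] by auto
    show "AE x in lborel. (\<lambda>n. indicator (cball 0 (real n)) x * u x t) \<longlonglongrightarrow> u x t"
    proof (rule AE_I2)
      fix x :: 'a
      have "\<forall>\<^sub>F n in sequentially. norm x \<le> real n"
        using eventually_ge_at_top[of "nat \<lceil>norm x\<rceil>"] by eventually_elim linarith
      then have "\<forall>\<^sub>F n in sequentially. indicator (cball 0 (real n)) x * u x t = u x t"
        by eventually_elim (simp add: indicator_def)
      then show "(\<lambda>n. indicator (cball 0 (real n)) x * u x t) \<longlonglongrightarrow> u x t"
        by (rule tendsto_eventually)
    qed
    show "AE x in lborel. norm (indicator (cball 0 (real n)) x * u x t) \<le> u x t" for n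
      by (auto simp: indicator_def nonneg[OF t])
  qed (rule integrable_slice[OF t])
  then have "\<forall>\<^sub>F n in sequentially. 1 / 2 < (\<integral>x. indicator (cball 0 (real n)) x * u x t \<partial>lborel)"
    unfolding mass[OF t] by (rule order_tendstoD(1)) simp
  then have "\<forall>\<^sub>F n in sequentially. 0 < n \<and> 1 / 2 < (\<integral>x. indicator (cball 0 (real n)) x * u x t \<partial>lborel)"
    using eventually_gt_at_top[of "0::nat"] by eventually_elim simp
  then obtain n :: nat where "0 < n" "1 / 2 < (\<integral>x. indicator (cball 0 (real n)) x * u x t \<partial>lborel)"
    using eventually_happens'[OF sequentially_bot] by blast
  then show thesis using that[of n] mass_ball[OF t, of "real n"] by simp
qed

lemma continuous_A_time: "continuous_on {0<..} (A r)"
  by (rule continuous_on_compose2[OF continuous_A, of _ "\<lambda>t. (r, t)", unfolded prod.case])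
     (auto intro!: continuous_intros)

lemma continuous_A_space: "t > 0 \<Longrightarrow> continuous_on S (\<lambda>r. A r t)"
  by (rule continuous_on_compose2[OF continuous_A, of _ "\<lambda>r. (r, t)", unfolded prod.case])
     (auto intro!: continuous_intros)

text \<open>Finitely many radii suffice on the compact time interval, and monotonicity of
  \<open>M\<close> in the radius allows the largest one to serve for all times. This is the lateral
  boundary bound for \<open>positive_at_origin\<close>.\<close>

lemma uniform_large_mass:
  obtains K where "K > 0" "\<And>t. 1 \<le> t \<Longrightarrow> t \<le> 2 \<Longrightarrow> 1 / 2 < M K t"
proof -
  define N where "N = (\<lambda>t. SOME n::nat. n > 0 \<and> 1 / 2 < M (real n) t)"
  have N: "N t > 0" "1 / 2 < M (real (N t)) t" if "t > 0" for t
    using someI_ex[of "\<lambda>n::nat. n > 0 \<and> 1 / 2 < M (real n) t"] exists_large_mass[OF that]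
    unfolding N_def by blast+
  define O' where "O' = (\<lambda>n::nat. {t\<in>{0<..}. 1 / 2 < M (real n) t})"
  have op: "open (O' n)" for n
  proof -
    have "continuous_on {0<..} (\<lambda>t. M (real n) t)"
      by (intro continuous_intros continuous_A_time)
    then have "open ((\<lambda>t. M (real n) t) -` {1 / 2<..} \<inter> {0<..})"
      by (subst (asm) continuous_on_open_vimage) auto
    moreover have "(\<lambda>t. M (real n) t) -` {1 / 2<..} \<inter> {0<..} = O' n"
      by (auto simp: O'_def)
    ultimately show ?thesis by simp
  qed
  obtain F where F: "F \<subseteq> N ` {1..2}" "finite F" "{1..2::real} \<subseteq> (\<Union>n\<in>F. O' n)"
  proof (rule compactE_image[of "{1..2::real}" "N ` {1..2}" O'])
    show "{1..2} \<subseteq> (\<Union>n\<in>N ` {1..2}. O' n)" using N by (auto simp: O'_def)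
  qed (use op in auto)
  define K where "K = real (Max (insert 1 F))"
  show thesis
  proof (rule that)
    have fin: "finite (insert 1 F)" using F by simp
    show K: "K > 0" using Max_ge[OF fin, of 1] by (simp add: K_def)
    fix t :: real assume t: "1 \<le> t" "t \<le> 2"
    then obtain n where n: "n \<in> F" "1 / 2 < M (real n) t" using F(3) by (auto simp: O'_def)
    have "real n \<le> K" using Max_ge[OF fin, of n] n by (simp add: K_def)
    then show "1 / 2 < M K t" using mass_mono[of t "real n" K] n t by simp
  qed
qed

text \<open>The function \<open>exp (b\<^sup>2 t) cosh (b r)\<close> is a subsolution of the radial heat equation in any
  dimension. Subtracting its value \<open>cosh (b K)\<close> at time 0 on the sphere of radius \<open>K\<close> gives a
  barrier that is nonpositive at time 0, but positive at the origin at time 1 as soon as \<open>b > K\<close>.\<close>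

lemma positive_at_origin: "0 < A 0 2"
proof -
  obtain K where K: "K > 0" "\<And>t. 1 \<le> t \<Longrightarrow> t \<le> 2 \<Longrightarrow> 1 / 2 < M K t"
    using uniform_large_mass by blast
  define b where "b = K + 1"
  have b: "b > 0" using K by (simp add: b_def)
  \<comment> \<open>Normalized so that \<open>K ^ DIM('a) * G\<close> is at most
    \<open>1 / 2\<close> up to time 2: the barrier stays below the mass at radius \<open>K\<close>
    and away from the obstacle.\<close>
  define \<kappa> where "\<kappa> = 1 / (2 * K ^ DIM('a) * exp (b\<^sup>2) * cosh (b * K))"
  have \<kappa>: "\<kappa> > 0" "K ^ DIM('a) * (\<kappa> * (exp (b\<^sup>2) * cosh (b * K))) = 1 / 2"
    using K by (auto simp: \<kappa>_def)
  define G where "G = (\<lambda>r t. \<kappa> * (exp (b\<^sup>2 * (t - 1)) * cosh (b * r) - cosh (b * K)))"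
  have ch: "cosh (b * r) \<le> cosh (b * K)" if "0 \<le> r" "r \<le> K" for r
    using that b K by (subst cosh_real_nonneg_le_iff) auto
  have G_le: "K ^ DIM('a) * G r t \<le> 1 / 2" if "0 \<le> r" "r \<le> K" "t \<le> 2" for r t
  proof -
    have "exp (b\<^sup>2 * (t - 1)) \<le> exp (b\<^sup>2)" using that mult_left_mono[of "t - 1" 1 "b\<^sup>2"] by simp
    then have "exp (b\<^sup>2 * (t - 1)) * cosh (b * r) \<le> exp (b\<^sup>2) * cosh (b * K)"
      using ch[OF that(1,2)] by (intro mult_mono) auto
    then have "exp (b\<^sup>2 * (t - 1)) * cosh (b * r) - cosh (b * K) \<le> exp (b\<^sup>2) * cosh (b * K)"
      using cosh_real_pos[of "b * K"] by linarith
    then have "K ^ DIM('a) * G r t \<le> K ^ DIM('a) * (\<kappa> * (exp (b\<^sup>2) * cosh (b * K)))"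
      unfolding G_def using \<kappa> K by (intro mult_left_mono) auto
    then show ?thesis using \<kappa> by simp
  qed
  have "(-1) * (A 0 2 - G 0 2) \<le> 0"
  proof (rule comparison[where T=2 and ?r0.0=K and ?t0.0=1])
    show "continuous_on ({0..K} \<times> {1..2}) (\<lambda>(r, t). G r t)"
      unfolding G_def split_beta by (intro continuous_intros)
    show "G (- r) t = G r t" for r t by (simp add: G_def)
    show "(-1) * (A r 1 - G r 1) \<le> 0" if "0 \<le> r" "r \<le> K" for r
    proof -
      have "G r 1 \<le> 0" unfolding G_def using ch[OF that] \<kappa> by (simp add: mult_le_0_iff)
      then show ?thesis using A_nonneg[of 1 r] by simp
    qed
    fix r t :: real assume rt: "0 \<le> r" "1 < t" "t \<le> 2" "0 < (-1) * (A r t - G r t)"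
    \<comment> \<open>The second-order part alone gives \<open>l\<close> at least the time
      derivative of \<open>G\<close>; the extra term \<open>+ G\<close> has the right sign because
      \<open>0 \<le> A < G\<close> at the points in question.\<close>
    have Gp: "0 < G r t" using A_nonneg[of t r] rt by simp
    {
      assume rr: "r < K"
      define E where "E = \<kappa> * exp (b\<^sup>2 * (t - 1))"
      have E: "E > 0" using \<kappa> by (simp add: E_def)
      define l where "l = (if r = 0 then (DIM('a) + 1 + 1) * (E * (b\<^sup>2 * cosh (b * r))) else E * (b\<^sup>2 * cosh (b * r)) + (DIM('a) + 1) / r * (E * (b * sinh (b * r))))"
      have "radial_op (DIM('a) + 1) (\<lambda>r. G r t) r l"
        unfolding radial_op_def
      proof (intro exI conjI)
        show "\<forall>\<^sub>F s in nhds r. ((\<lambda>r. G r t) has_real_derivative E * (b * sinh (b * s))) (at s)"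
          unfolding G_def E_def
          by (intro always_eventually allI) (rule derivative_eq_intros refl | simp)+
        show "((\<lambda>s. E * (b * sinh (b * s))) has_real_derivative E * (b\<^sup>2 * cosh (b * r))) (at r)"
          by (rule derivative_eq_intros refl | simp add: power2_eq_square)+
      qed (auto simp: l_def)
      moreover have "(G r has_real_derivative E * (b\<^sup>2 * cosh (b * r))) (at t)"
        unfolding G_def E_def by (rule derivative_eq_intros refl | simp)+
      moreover have "E * (b\<^sup>2 * cosh (b * r)) \<le> l"
      proof (cases "r = 0")
        case False
        have "0 \<le> (DIM('a) + 1) / r * (E * (b * sinh (b * r)))"
          using rt b E by (intro mult_nonneg_nonneg) auto
        then show ?thesis using False by (simp add: l_def)
      next
        case True
        have "0 \<le> E * b\<^sup>2 * (DIM('a) + 1)" using E by simp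
        then show ?thesis using True by (simp add: l_def algebra_simps)
      qed
      ultimately show "\<exists>l g. radial_op (DIM('a) + 1) (\<lambda>r. G r t) r l \<and> (G r has_real_derivative g) (at t) \<and> (-1) * (l + G r t) \<le> (-1) * g"
        using Gp by (intro exI[of _ l] exI[of _ "E * (b\<^sup>2 * cosh (b * r))"]) auto
    }
    assume rr: "r \<le> K"
    show "r < K \<and> M r t < 1"
    proof
      have "M r t \<le> K ^ DIM('a) * G r t"
        using rt rr A_nonneg[of t r] by (intro mult_mono power_mono) auto
      also have "\<dots> \<le> 1 / 2" by (rule G_le) (use rt rr in auto)
      finally show "M r t < 1" by simp
      have "r \<noteq> K"
      proof
        assume "r = K"
        then have "M K t \<le> K ^ DIM('a) * G K t"
          using rt K by (intro mult_left_mono) auto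
        then show False using K(2)[of t] G_le[of K t] rt K(1) by linarith
      qed
      then show "r < K" using rr by simp
    qed
  qed (use K in auto)
  moreover have "0 < G 0 2"
  proof -
    have "cosh (b * K) \<le> exp (b * K)" using K b by (simp add: cosh_def)
    also have "\<dots> < exp (b\<^sup>2)" using b by (simp add: b_def power2_eq_square algebra_simps)
    finally show ?thesis using \<kappa> by (simp add: G_def)
  qed
  ultimately show ?thesis by simp
qed

text \<open>Positivity at the origin passes to small radii by continuity and from there to all radii
  because \<open>M\<close> is nondecreasing.\<close>

lemma A_positive: assumes "0 \<le> r" shows "0 < A r 2"
proof (cases "r = 0")
  case False
  have "isCont (\<lambda>r. A r 2) 0"
    using continuous_A_space[of 2 UNIV] continuous_on_eq_continuous_at[of UNIV "\<lambda>r. A r 2"] by simp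
  then have "((\<lambda>r. A r 2) \<longlongrightarrow> A 0 2) (at_right 0)"
    unfolding isCont_def by (rule tendsto_within_subset) simp
  then have "\<forall>\<^sub>F s in at_right 0. 0 < A s 2" using positive_at_origin by (rule order_tendstoD(1))
  moreover have "\<forall>\<^sub>F s in at_right 0. s \<in> {0<..<r}" using False assms by (intro eventually_at_right_real) auto
  ultimately have "\<forall>\<^sub>F s in at_right 0. 0 < A s 2 \<and> 0 < s \<and> s < r" by eventually_elim auto
  then obtain s where s: "0 < A s 2" "0 < s" "s < r"
    using eventually_happens'[OF trivial_limit_at_right_real] by blast
  have "0 < M s 2" using s by simp
  also have "\<dots> \<le> M r 2" using s by (intro mass_mono) auto
  finally show ?thesis using False assms by (simp add: zero_less_mult_iff)
qed (use positive_at_origin in simp)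

end

section \<open>Trapping the mass between rescaled ground states\<close>

context fbp_ground
begin

lemma ratio_continuous:
  assumes "0 < q" "t > 0"
  shows "continuous_on {0..\<rho> / q} (\<lambda>r. A r t / (q ^ DIM('a) * g (q * r)))"
    and "\<And>r. r \<in> {0..\<rho> / q} \<Longrightarrow> 0 < q ^ DIM('a) * g (q * r)"
proof -
  show p: "0 < q ^ DIM('a) * g (q * r)" if "r \<in> {0..\<rho> / q}" for r
    using that assms g_pos[of "q * r"] by (simp add: field_simps)
  then have "\<forall>r\<in>{0..\<rho> / q}. q ^ DIM('a) * g (q * r) \<noteq> 0" by (metis less_irrefl)
  then show "continuous_on {0..\<rho> / q} (\<lambda>r. A r t / (q ^ DIM('a) * g (q * r)))"
    by (intro continuous_on_divide continuous_intros continuous_A_space assms continuous_on_compose2[OF continuous_g[of UNIV]])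
       auto
qed

text \<open>On a compact interval the positive ratio of \<open>A\<close> at time 2 to the barrier
  profile has a positive minimum. Starting from it, capped at 1, the barrier grows at rate
  \<open>1 - q\<^sup>2\<close> until its factor is exactly 1, and is then continued with rate
  0.\<close>

lemma eventually_lower:
  assumes q: "0 < q" "q < 1"
  obtains T where "T > 0" "\<And>t r. T \<le> t \<Longrightarrow> 0 \<le> r \<Longrightarrow> r \<le> \<rho> / q \<Longrightarrow> q ^ DIM('a) * g (q * r) \<le> A r t"
proof -
  have ne: "{0..\<rho> / q} \<noteq> {}" using q rho_pos by simp
  obtain x where x: "x \<in> {0..\<rho> / q}" "\<And>y. y \<in> {0..\<rho> / q} \<Longrightarrow>
      A x 2 / (q ^ DIM('a) * g (q * x)) \<le> A y 2 / (q ^ DIM('a) * g (q * y))"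
    using continuous_attains_inf[OF compact_Icc ne ratio_continuous(1)[OF q(1), of 2]] by auto
  define c0 where "c0 = min 1 (A x 2 / (q ^ DIM('a) * g (q * x)))"
  have c0: "0 < c0" "c0 \<le> 1"
    using x(1) ratio_continuous(2)[OF q(1), of 2 x] A_positive[of x] by (auto simp: c0_def)
  define k where "k = 1 - q\<^sup>2"
  have k: "k > 0" using q by (simp add: k_def power_less_one_iff)
  \<comment> \<open>The time at which the factor \<open>c0 * exp (k * (t - 2))\<close> reaches
    1.\<close>
  define T where "T = 2 + ln (1 / c0) / k"
  have T2: "2 \<le> T" using c0 k by (simp add: T_def)
  have cT: "c0 * exp (k * (T - 2)) = 1" using c0 k by (simp add: T_def exp_minus ln_div)
  have at_T: "q ^ DIM('a) * g (q * r) \<le> A r T" if "0 \<le> r" "r \<le> \<rho> / q" for r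
  proof -
    have "c0 * exp (k * (T - 2)) * (q ^ DIM('a) * g (q * r)) \<le> A r T"
    proof (rule lower_barrier[where T=T])
      fix s assume s: "0 \<le> s" "s \<le> \<rho> / q"
      have "c0 * (q ^ DIM('a) * g (q * s)) \<le> (A s 2 / (q ^ DIM('a) * g (q * s))) * (q ^ DIM('a) * g (q * s))"
        using x(2)[of s] s ratio_continuous(2)[OF q(1), of 2 s] by (intro mult_right_mono) (auto simp: c0_def)
      also have "\<dots> = A s 2"
        by (rule nonzero_eq_divide_eq[THEN iffD1, OF _ refl]) (use ratio_continuous(2)[OF q(1), of 2 s] s in force)
      finally show "c0 * (q ^ DIM('a) * g (q * s)) \<le> A s 2" .
    qed (use q c0 k that T2 cT in \<open>auto simp: k_def\<close>)
    then show ?thesis unfolding cT by simp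
  qed
  show thesis
  proof (rule that)
    show "T > 0" using T2 by simp
    fix t r assume *: "T \<le> t" "0 \<le> r" "r \<le> \<rho> / q"
    \<comment> \<open>The second run of the barrier, with factor 1 and rate 0; it may last for any
      length of time.\<close>
    have "1 * exp (0 * (t - T)) * (q ^ DIM('a) * g (q * r)) \<le> A r t"
      by (rule lower_barrier[where T=t]) (use q T2 * at_T k in \<open>auto simp: k_def\<close>)
    then show "q ^ DIM('a) * g (q * r) \<le> A r t" by simp
  qed
qed

lemma eventually_upper:
  assumes q: "1 < q"
  obtains T where "T > 0" "\<And>t r. T \<le> t \<Longrightarrow> 0 \<le> r \<Longrightarrow> r \<le> \<rho> / q \<Longrightarrow> A r t \<le> q ^ DIM('a) * g (q * r)"
proof -
  have q0: "0 < q" using q by simp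
  have ne: "{0..\<rho> / q} \<noteq> {}" using q rho_pos by simp
  obtain x where x: "x \<in> {0..\<rho> / q}" "\<And>y. y \<in> {0..\<rho> / q} \<Longrightarrow>
      A y 2 / (q ^ DIM('a) * g (q * y)) \<le> A x 2 / (q ^ DIM('a) * g (q * x))"
    using continuous_attains_sup[OF compact_Icc ne ratio_continuous(1)[OF q0, of 2]] by auto
  define c0 where "c0 = max 1 (A x 2 / (q ^ DIM('a) * g (q * x)))"
  have c0: "1 \<le> c0" by (auto simp: c0_def)
  define k where "k = 1 - q\<^sup>2"
  have k: "k < 0" using q by (simp add: k_def)
  define T where "T = 2 + ln (1 / c0) / k"
  have T2: "2 \<le> T" using c0 k by (simp add: T_def ln_div divide_nonneg_neg)
  have cT: "c0 * exp (k * (T - 2)) = 1" using c0 k by (simp add: T_def exp_minus ln_div)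
  have at_T: "A r T \<le> q ^ DIM('a) * g (q * r)" if "0 \<le> r" "r \<le> \<rho> / q" for r
  proof -
    have "A r T \<le> c0 * exp (k * (T - 2)) * (q ^ DIM('a) * g (q * r))"
    proof (rule upper_barrier[where T=T])
      fix s assume s: "0 \<le> s" "s \<le> \<rho> / q"
      have "A s 2 = (A s 2 / (q ^ DIM('a) * g (q * s))) * (q ^ DIM('a) * g (q * s))"
        by (rule nonzero_eq_divide_eq[THEN iffD1, OF _ refl, symmetric]) (use ratio_continuous(2)[OF q0, of 2 s] s in force)
      also have "\<dots> \<le> c0 * (q ^ DIM('a) * g (q * s))"
        using x(2)[of s] s ratio_continuous(2)[OF q0, of 2 s] by (intro mult_right_mono) (auto simp: c0_def)
      finally show "A s 2 \<le> c0 * (q ^ DIM('a) * g (q * s))" .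
    qed (use q c0 k that T2 cT in \<open>auto simp: k_def\<close>)
    then show ?thesis unfolding cT by simp
  qed
  show thesis
  proof (rule that)
    show "T > 0" using T2 by simp
    fix t r assume *: "T \<le> t" "0 \<le> r" "r \<le> \<rho> / q"
    have "A r t \<le> 1 * exp (0 * (t - T)) * (q ^ DIM('a) * g (q * r))"
      by (rule upper_barrier[where T=t]) (use q T2 * at_T k in \<open>auto simp: k_def\<close>)
    then show "A r t \<le> q ^ DIM('a) * g (q * r)" by simp
  qed
qed

text \<open>At \<open>r = \<rho> / q\<close> the lower bound for the mass equals
  \<open>V \<rho> = 1\<close>, so no mass is left outside.\<close>

lemma eventually_supported:
  assumes q: "0 < q" "q < 1"
  obtains T where "T > 0" "\<And>t x. T \<le> t \<Longrightarrow> \<rho> / q \<le> norm x \<Longrightarrow> u x t = 0"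
proof -
  obtain T where T: "T > 0" "\<And>t r. T \<le> t \<Longrightarrow> 0 \<le> r \<Longrightarrow> r \<le> \<rho> / q \<Longrightarrow> q ^ DIM('a) * g (q * r) \<le> A r t"
    using eventually_lower[OF q] by blast
  show thesis
  proof (rule that[OF T(1)])
    fix t and x :: 'a assume *: "T \<le> t" "\<rho> / q \<le> norm x"
    have r: "0 < \<rho> / q" using rho_pos q by simp
    have "1 = (\<rho> / q) ^ DIM('a) * (q ^ DIM('a) * g (q * (\<rho> / q)))"
      using g_full q by (simp add: power_divide)
    also have "\<dots> \<le> M (\<rho> / q) t" using T(2)[of t "\<rho> / q"] * r by (intro mult_left_mono) auto
    finally have "M (\<rho> / q) t = 1"
      using mass_le_1[of t "\<rho> / q"] * T(1) r by simp
    then show "u x t = 0" using mass_full_imp_zero[OF _ r _ *(2), of t] T(1) * by simp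
  qed
qed

end

lemma radial_op_unique:
  assumes "radial_op k f r l" "radial_op k h r m" and eq: "\<forall>\<^sub>F s in nhds r. f s = h s"
  shows "l = m"
proof -
  obtain f' f'' where f: "\<forall>\<^sub>F s in nhds r. (f has_real_derivative f' s) (at s)"
     "(f' has_real_derivative f'') (at r)"
     "if r = 0 then f' 0 = 0 \<and> l = (k + 1) * f'' else l = f'' + k / r * f' r"
    using assms(1) unfolding radial_op_def by blast
  obtain h' h'' where h: "\<forall>\<^sub>F s in nhds r. (h has_real_derivative h' s) (at s)"
     "(h' has_real_derivative h'') (at r)"
     "if r = 0 then h' 0 = 0 \<and> m = (k + 1) * h'' else m = h'' + k / r * h' r"
    using assms(2) unfolding radial_op_def by blast
  have eq': "\<forall>\<^sub>F s in nhds r. \<forall>\<^sub>F s' in nhds s. f s' = h s'"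
    using eq by (simp add: eventually_eventually)
  have ev: "\<forall>\<^sub>F s in nhds r. f' s = h' s"
    using f(1) h(1) eq'
  proof eventually_elim
    case (elim s)
    have "(h has_real_derivative f' s) (at s)"
      using elim(1) DERIV_cong_ev[OF refl elim(3) refl] by blast
    then show ?case using elim(2) DERIV_unique by blast
  qed
  have "(h' has_real_derivative f'') (at r)" using f(2) DERIV_cong_ev[OF refl ev refl] by blast
  then have "f'' = h''" using h(2) DERIV_unique by blast
  moreover have "f' r = h' r" using eventually_nhds_x_imp_x[OF ev] .
  ultimately show ?thesis using f(3) h(3) by (auto split: if_splits)
qed

text \<open>For \<open>n = - d\<close> this is the fundamental solution of dimension
  \<open>d + 2\<close>. It is the form that \<open>A\<close> takes outside the support, where
  \<open>M = 1\<close>.\<close>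

lemma radial_op_power_int:
  assumes r: "r > 0"
  shows "radial_op (1 - of_int n) (\<lambda>s. s powi n) r 0"
  unfolding radial_op_def
proof (intro exI conjI)
  have "\<forall>\<^sub>F s in nhds r. s > 0" using r by (intro order_tendstoD(1)[OF filterlim_ident]) 
  then show "\<forall>\<^sub>F s in nhds r. ((\<lambda>s. s powi n) has_real_derivative of_int n * s powi (n - 1)) (at s)"
    by eventually_elim (rule derivative_eq_intros refl | simp)+
  show "((\<lambda>s. of_int n * s powi (n - 1)) has_real_derivative of_int n * (of_int (n - 1) * r powi (n - 1 - 1))) (at r)"
    using r by (auto intro!: derivative_eq_intros)
  have "r powi (n - 1) = r powi (n - 1 - 1) * r"
    using r power_int_add_1[of r "n - 1 - 1"] by simp
  then show "if r = 0 then of_int n * 0 powi (n - 1) = (0::real) \<and> 0 = (1 - of_int n + 1) * (of_int n * (of_int (n - 1) * r powi (n - 1 - 1)))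
    else 0 = of_int n * (of_int (n - 1) * r powi (n - 1 - 1)) + (1 - of_int n) / r * (of_int n * r powi (n - 1))"
    using r by (simp add: field_simps)
qed

text \<open>The derivative bound is known only where \<open>\<phi>\<close> is positive, as for
  \<open>u x\<close> in time. A faster drop would make \<open>\<phi> s + e' * (s - a)\<close> with
  some \<open>e' > e\<close> attain its maximum before \<open>b\<close>, at a point with
  \<open>\<phi> > 0\<close>, where its derivative is positive: a contradiction.\<close>

lemma nonneg_slow_decrease:
  fixes \<phi> :: "real \<Rightarrow> real"
  assumes ab: "a \<le> b" and c: "continuous_on {a..b} \<phi>" and nn: "\<And>s. a \<le> s \<Longrightarrow> s \<le> b \<Longrightarrow> 0 \<le> \<phi> s"
    and e: "0 \<le> e"
    and d: "\<And>s. a \<le> s \<Longrightarrow> s \<le> b \<Longrightarrow> 0 < \<phi> s \<Longrightarrow> \<exists>D. (\<phi> has_real_derivative D) (at s) \<and> - e \<le> D"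
  shows "\<phi> a \<le> \<phi> b + e * (b - a)"
proof (rule ccontr)
  assume n: "\<not> ?thesis"
  then have "a \<noteq> b" by auto
  then have lt: "a < b" using ab by simp
  \<comment> \<open>The midpoint between \<open>e\<close> and the average rate of decrease on the
    interval.\<close>
  define e' where "e' = e + (\<phi> a - \<phi> b - e * (b - a)) / (2 * (b - a))"
  have e': "e < e'" using n lt by (simp add: e'_def)
  have "(\<phi> a - \<phi> b - e * (b - a)) / (2 * (b - a)) * (b - a) = (\<phi> a - \<phi> b - e * (b - a)) / 2"
    using lt by (simp add: field_simps)
  then have "e' * (b - a) = e * (b - a) + (\<phi> a - \<phi> b - e * (b - a)) / 2"
    by (simp add: e'_def distrib_right)
  then have gap: "\<phi> b + e' * (b - a) < \<phi> a" using n by argo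
  define \<psi> where "\<psi> = (\<lambda>s. \<phi> s + e' * (s - a))"
  have "continuous_on {a..b} \<psi>" unfolding \<psi>_def by (intro continuous_intros c)
  then obtain s where s: "s \<in> {a..b}" "\<And>y. y \<in> {a..b} \<Longrightarrow> \<psi> y \<le> \<psi> s"
    using continuous_attains_sup[of "{a..b}" \<psi>] lt by force
  have "\<psi> b < \<psi> a" using gap by (simp add: \<psi>_def)
  moreover have "\<psi> a \<le> \<psi> s" using s lt by simp
  ultimately have "s \<noteq> b" by auto
  then have sb: "a \<le> s" "s < b" using s by auto
  have "\<phi> a \<le> \<phi> s + e' * (s - a)" using s(2)[of a] lt by (simp add: \<psi>_def)
  then have gs: "\<phi> b + e' * (b - s) < \<phi> s" using gap by (simp add: algebra_simps)
  moreover have "0 \<le> e' * (b - s)" using e e' sb by simp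
  ultimately have "0 < \<phi> s" using nn[of b] lt by linarith
  then obtain D where D: "(\<phi> has_real_derivative D) (at s)" "- e \<le> D" using d[of s] sb by auto
  have "(\<psi> has_real_derivative D + e') (at s)"
    unfolding \<psi>_def by (rule derivative_eq_intros D refl | simp)+
  then obtain \<delta> where \<delta>: "\<delta> > 0" "\<And>h. 0 < h \<Longrightarrow> h < \<delta> \<Longrightarrow> \<psi> s < \<psi> (s + h)"
    using DERIV_pos_inc_right[of \<psi> "D + e'" s] D e' by auto
  define h where "h = min \<delta> (b - s) / 2"
  have "0 < h" "h < \<delta>" "h < b - s" using \<delta>(1) sb by (auto simp: h_def min_def)
  then show False using \<delta>(2)[of h] s(2)[of "s + h"] sb by simp
qed

lemma ennreal_gap:
  assumes "ennreal a < b" "0 \<le> a"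
  obtains a' where "a < a'" "ennreal a' < b"
proof (cases b)
  case (real b')
  then have "a < b'" using assms by (simp add: ennreal_less_iff)
  then show thesis using that[of "(a + b') / 2"] assms real by (simp add: ennreal_less_iff)
next
  case top
  then show thesis using that[of "a + 1"] by simp
qed

section \<open>The free boundary\<close>

context fbp_ground
begin

text \<open>If \<open>R t = s < \<rho> / q\<close>, the upper bound gives
  \<open>M s t \<le> V (q * s) < 1\<close>, so there is mass beyond radius \<open>R t\<close>, where
  \<open>u\<close> vanishes.\<close>

lemma eventually_radius_ge:
  assumes q: "1 < q"
  obtains T where "T > 0" "\<And>t. T \<le> t \<Longrightarrow> ennreal (\<rho> / q) \<le> R t"
proof -
  obtain T where T: "T > 0" "\<And>t r. T \<le> t \<Longrightarrow> 0 \<le> r \<Longrightarrow> r \<le> \<rho> / q \<Longrightarrow> A r t \<le> q ^ DIM('a) * g (q * r)"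
    using eventually_upper[OF q] by blast
  show thesis
  proof (rule that[OF T(1)])
    fix t assume t: "T \<le> t"
    show "ennreal (\<rho> / q) \<le> R t"
    proof (rule ccontr)
      assume "\<not> ?thesis"
      then obtain s where s: "R t = ennreal s" "0 \<le> s" "s < \<rho> / q"
        by (cases "R t") (auto simp: not_le ennreal_less_iff)
      have "M s t \<le> s ^ DIM('a) * (q ^ DIM('a) * g (q * s))"
        using T(2)[OF t, of s] s by (intro mult_left_mono) auto
      also have "\<dots> = V (q * s)" by (simp add: power_mult_distrib)
      also have "\<dots> < 1" using s q by (intro V_lt_1) (auto simp: field_simps)
      finally have lt: "M s t < 1" .
      have "t > 0" using T(1) t by simp
      from mass_lt_1_nbhd[OF this s(2) lt] obtain r' e where
        r': "s < r'" "0 < e" "\<And>s'. \<bar>s' - t\<bar> < e \<Longrightarrow> ennreal r' < R s'" by blast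
      have "ennreal r' < ennreal s" using r'(3)[of t] r'(2) s(1) by simp
      then show False using \<open>s < r'\<close> s(2) by (simp add: ennreal_less_iff)
    qed
  qed
qed

text \<open>If the radius \<open>R t\<close> exceeded the support of \<open>u(\<cdot>, t)\<close>, then the total flux through the
  boundary of the support would vanish at time \<open>t\<close>, so that mass would be created at unit rate.
  As the time derivative vanishes outside the support, the mass slightly before \<open>t\<close> would be less
  than 1.\<close>

lemma radius_le_support:
  assumes T: "0 < T" "T < t" and R1: "0 < R1" and supp: "\<And>s x. T \<le> s \<Longrightarrow> R1 \<le> norm x \<Longrightarrow> u x s = 0"
  shows "R t \<le> ennreal R1"
proof (rule ccontr)
  assume "\<not> ?thesis"
  then have "ennreal R1 < R t" by simp
  then obtain R2 where R2: "R1 < R2" "ennreal R2 < R t" using ennreal_gap R1 by (metis less_imp_le)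
  have tp: "t > 0" using T by simp
  define \<Omega> where "\<Omega> = (positive_region R :: ('a \<times> real) set)"
  have full: "M r s = 1" if "R1 \<le> r" "T \<le> s" for r s
    by (rule zero_imp_mass_full) (use that R1 T supp in auto)
  have C: "C2_on (ball 0 R2) (\<lambda>x. u x t)" by (rule C2_slice[OF tp less_imp_le[OF R2(2)]])
  have inO: "(x, t) \<in> \<Omega>" if "norm x \<le> R2" for x
    using le_less_trans[OF ennreal_leI[OF that] R2(2)] tp by (simp add: \<Omega>_def positive_region_def)
  define v where "v = (\<lambda>x. deriv (u x) t)"
  have v: "v x = laplacian (\<lambda>y. u y t) x + u x t" if "norm x \<le> R2" for x
    unfolding v_def using pde inO[OF that] by (simp add: \<Omega>_def)
  \<comment> \<open>Zeros of \<open>u\<close> inside the positive region are minima in time of a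
    function that is differentiable there.\<close>
  have v0: "v x = 0" if "norm x \<le> R2" "u x t = 0" for x
  proof -
    have "(u x has_real_derivative v x) (at t)"
      using time_derivative[of x t] inO[OF that(1)] v[OF that(1)] by (simp add: \<Omega>_def)
    then show ?thesis
      by (rule DERIV_local_min[where d=t]) (use nonneg that(2) tp in \<open>auto simp: abs_less_iff\<close>)
  qed
  \<comment> \<open>\<open>L\<close> is the radius of the support of \<open>u(\<cdot>, t)\<close>.\<close>
  define S where "S = {r\<in>{0..R1}. M r t = 1}"
  have "closed S"
  proof -
    have "S = {0..R1} \<inter> (\<lambda>r. M r t) -` {1}" by (auto simp: S_def)
    then show ?thesis
      by (auto intro!: continuous_closed_preimage continuous_intros continuous_A_space tp)
  qed
  moreover have "R1 \<in> S" using full[of R1 t] R1 T by (simp add: S_def)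
  moreover have bdd: "bdd_below S" by (auto simp: S_def intro!: bdd_belowI[of _ 0])
  ultimately have LS: "Inf S \<in> S" using closed_contains_Inf by blast
  define L where "L = Inf S"
  have L: "0 \<le> L" "L \<le> R1" "M L t = 1" using LS by (auto simp: S_def L_def)
  then have "L \<noteq> 0" by (auto simp: zero_power)
  then have Lp: "L > 0" using L by simp
  have uL: "u x t = 0" if "L \<le> norm x" for x using mass_full_imp_zero[OF tp Lp L(3) that] .
  have lt1: "M r t < 1" if "0 \<le> r" "r < L" for r
  proof -
    have "r \<notin> S" using that cInf_lower[OF _ bdd, of r] by (auto simp: L_def)
    then show ?thesis using mass_le_1[OF tp that(1)] that L by (auto simp: S_def)
  qed
  \<comment> \<open>\<open>v\<close> vanishes for radii between \<open>L\<close> and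
    \<open>R2\<close>. Cutting it off at \<open>R1 \<ge> L\<close> changes nothing on
    \<open>ball 0 R2\<close> and makes it continuous on the whole space.\<close>
  define w where "w = (\<lambda>x. if norm x \<le> R1 then v x else 0)"
  have w_eq: "w x = v x" if "norm x < R2" for x
    using v0[of x] uL[of x] that L by (auto simp: w_def)
  have w0: "w x = 0" if "L \<le> norm x" for x
    using v0[of x] uL[OF that] R2 by (auto simp: w_def)
  have cv: "continuous_on (ball 0 R2) v"
  proof (rule continuous_on_eq)
    show "continuous_on (ball 0 R2) (\<lambda>x. laplacian (\<lambda>y. u y t) x + u x t)"
      by (intro continuous_on_add continuous_on_laplacian C continuous_on_subset[OF continuous_slice[OF tp]]) simp
  qed (use v in auto)
  have cw: "continuous_on UNIV w"
  proof -
    have "continuous_on (cball 0 R1 \<union> {x::'a. R1 \<le> norm x}) w"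
    proof (rule continuous_on_closed_Un)
      have "continuous_on (cball 0 R1) v" by (rule continuous_on_subset[OF cv]) (use R2 in auto)
      then show "continuous_on (cball 0 R1) w" by (rule continuous_on_eq) (simp add: w_def)
      have "continuous_on {x::'a. R1 \<le> norm x} (\<lambda>x. 0::real)" by simp
      then show "continuous_on {x. R1 \<le> norm x} w"
        by (rule continuous_on_eq) (use w0 L in auto)
    qed (auto intro!: closed_Collect_le continuous_intros)
    moreover have "cball 0 R1 \<union> {x::'a. R1 \<le> norm x} = UNIV" by auto
    ultimately show ?thesis by simp
  qed
  define r2 where "r2 = (R1 + R2) / 2"
  have r2: "R1 < r2" "r2 < R2" "0 < r2" using R2 R1 by (auto simp: r2_def)
  \<comment> \<open>Beyond \<open>R1\<close>, \<open>A\<close> is \<open>r^(-d)\<close>, which is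
    annihilated by the radial operator: the flux term \<open>l\<close> is zero, and only the unit
    rate of mass creation remains.\<close>
  have w_int: "r2 ^ DIM('a) * dilint w r2 = 1"
  proof -
    define l where "l = (LINT z:cball 0 1|lborel. laplacian (\<lambda>x. u x t) (r2 *\<^sub>R z))"
    have rr: "\<bar>r2\<bar> < R2" using r2 by simp
    have op: "radial_op (DIM('a) + 1) (\<lambda>r. A r t) r2 l"
      using radial_op_dilint[OF C rr] by (simp add: A_def l_def)
    have "\<forall>\<^sub>F r in nhds r2. R1 < r" using r2 by (intro order_tendstoD(1)[OF filterlim_ident])
    then have ev: "\<forall>\<^sub>F r in nhds r2. A r t = r powi (- int DIM('a))"
    proof eventually_elim
      case (elim r)
      then have "M r t = 1" "r > 0" using full[of r t] T R1 by auto
      then show ?case by (simp add: power_int_minus field_simps)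
    qed
    have "l = 0"
      using radial_op_unique[OF op _ ev] radial_op_power_int[OF r2(3), of "- int DIM('a)"] by (simp add: add.commute)
    moreover have "dilint w r2 = l + A r2 t"
    proof -
      have "dilint w r2 = (LINT z:cball 0 1|lborel. laplacian (\<lambda>x. u x t) (r2 *\<^sub>R z) + u (r2 *\<^sub>R z) t)"
        unfolding dilint_def
      proof (rule set_lebesgue_integral_cong)
        show "\<forall>z. z \<in> cball 0 1 \<longrightarrow> w (r2 *\<^sub>R z) = laplacian (\<lambda>x. u x t) (r2 *\<^sub>R z) + u (r2 *\<^sub>R z) t"
        proof (intro allI impI)
          fix z :: 'a assume "z \<in> cball 0 1"
          then have "norm (r2 *\<^sub>R z) < R2" using scaled_unit_ball[OF _ rr, of z] by simp
          then show "w (r2 *\<^sub>R z) = laplacian (\<lambda>x. u x t) (r2 *\<^sub>R z) + u (r2 *\<^sub>R z) t"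
            using w_eq v by simp
        qed
      qed simp
      also have "\<dots> = l + A r2 t"
        unfolding l_def A_def dilint_def
        by (rule set_integral_add)
           (auto intro!: set_integrable_compact_continuous continuous_on_dilated_slice[OF _ rr] continuous_on_laplacian C
              continuous_on_subset[OF continuous_slice[OF tp]])
      finally show ?thesis .
    qed
    ultimately show ?thesis using full[of r2 t] r2 T by simp
  qed
  \<comment> \<open>Makes the annulus between \<open>r1\<close> and any radius up to
    \<open>r2\<close> contribute at most \<open>1 / 4\<close> to a rate of change of mass. The same
    \<open>\<epsilon>\<close> is used at time \<open>t\<close> and for the earlier times.\<close>
  define \<epsilon> where "\<epsilon> = 1 / (4 * unit_ball_vol DIM('a) * r2 ^ DIM('a))"
  have \<epsilon>: "\<epsilon> > 0" "\<epsilon> * unit_ball_vol DIM('a) * r2 ^ DIM('a) = 1 / 4"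
    using r2 unit_ball_vol_pos[of "real DIM('a)"] by (auto simp: \<epsilon>_def simp del: unit_ball_vol_pos)
  have cw': "continuous_on UNIV (\<lambda>x. \<bar>w x\<bar>)" by (intro continuous_intros cw)
  obtain r1 where r1: "0 < r1" "r1 < L" "\<And>x. r1 \<le> norm x \<Longrightarrow> norm x \<le> L \<Longrightarrow> \<bar>w x\<bar> < \<epsilon>"
    using small_near_sphere[OF cw' _ Lp \<epsilon>(1)] w0 by auto
  have w_small: "\<bar>w x\<bar> < \<epsilon>" if "r1 \<le> norm x" for x
    using r1(3)[OF that] w0[of x] \<epsilon>(1) by (cases "norm x \<le> L") auto
  have r12: "r1 < R1" "r1 < r2" using r1 L r2 by auto
  have annulus: "\<epsilon> * unit_ball_vol DIM('a) * (r ^ DIM('a) - r1 ^ DIM('a)) \<le> 1 / 4" if "0 \<le> r" "r \<le> r2" for r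
  proof -
    have "\<epsilon> * unit_ball_vol DIM('a) * (r ^ DIM('a) - r1 ^ DIM('a)) \<le> \<epsilon> * unit_ball_vol DIM('a) * r2 ^ DIM('a)"
    proof (rule mult_left_mono)
      have "r ^ DIM('a) \<le> r2 ^ DIM('a)" using that by (intro power_mono)
      moreover have "0 \<le> r1 ^ DIM('a)" using r1 by simp
      ultimately show "r ^ DIM('a) - r1 ^ DIM('a) \<le> r2 ^ DIM('a)" by linarith
    qed (use \<epsilon>(1) in simp)
    then show ?thesis using \<epsilon>(2) by simp
  qed
  define D1 where "D1 = r1 ^ DIM('a) * dilint w r1"
  have "r2 ^ DIM('a) * dilint w r2 - D1 \<le> \<epsilon> * unit_ball_vol DIM('a) * (r2 ^ DIM('a) - r1 ^ DIM('a))"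
    unfolding D1_def by (rule mass_annulus_le[OF cw]) (use r1 r12 w_small in \<open>auto intro: less_imp_le abs_le_D1\<close>)
  also have "\<dots> \<le> 1 / 4" by (rule annulus) (use r2 in auto)
  finally have D1: "3 / 4 \<le> D1" using w_int by simp
  have dA: "((\<lambda>s. M r1 s) has_real_derivative D1) (at t)"
  proof -
    have "(LINT z:cball 0 1|lborel. deriv (u (r1 *\<^sub>R z)) t) = dilint w r1"
      unfolding dilint_def
    proof (rule set_lebesgue_integral_cong)
      show "\<forall>z. z \<in> cball 0 1 \<longrightarrow> deriv (u (r1 *\<^sub>R z)) t = w (r1 *\<^sub>R z)"
      proof (intro allI impI)
        fix z :: 'a assume "z \<in> cball 0 1"
        then have "norm (r1 *\<^sub>R z) < R2" using scaled_unit_ball[of z r1 R2] r1 r12 R2 by simp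
        then show "deriv (u (r1 *\<^sub>R z)) t = w (r1 *\<^sub>R z)" using w_eq by (simp add: v_def)
      qed
    qed simp
    then have "(A r1 has_real_derivative dilint w r1) (at t)"
      using A_time_derivative[OF tp less_imp_le[OF r1(1)] lt1] r1 by simp
    then show ?thesis unfolding D1_def by (rule DERIV_cmult)
  qed
  define K1 where "K1 = {x::'a. r1 \<le> norm x \<and> norm x \<le> R1}"
  have "compact K1"
  proof -
    have "K1 = cball 0 R1 \<inter> {x. r1 \<le> norm x}" by (auto simp: K1_def)
    moreover have "closed {x::'a. r1 \<le> norm x}" by (intro closed_Collect_le continuous_intros)
    ultimately show ?thesis by (simp add: compact_Int_closed)
  qed
  then have cK: "compact (K1 \<times> {t})" by (intro compact_Times) auto
  have "continuous_on \<Omega> (\<lambda>(x, t). deriv (u x) t)" unfolding \<Omega>_def by (rule C21_onD(2)[OF C21])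
  \<comment> \<open>\<open>\<Omega>\<close> is not known to be open, so the lower bound on the time
    derivative is spread from \<open>K1 \<times> {t}\<close> to a neighbourhood only relative to
    \<open>\<Omega>\<close>.\<close>
  then obtain W where W: "open W" "W \<inter> \<Omega> = (\<lambda>(x, t). deriv (u x) t) -` {- \<epsilon><..} \<inter> \<Omega>"
    unfolding continuous_on_open_invariant using open_greaterThan by blast
  have ne: "K1 \<times> {t} \<noteq> {}"
  proof -
    obtain x :: 'a where "norm x = R1" using vector_choose_size R1 by (metis less_imp_le)
    then have "x \<in> K1" using r12 by (simp add: K1_def)
    then show ?thesis by blast
  qed
  have "K1 \<times> {t} \<subseteq> W"
  proof
    fix p assume "p \<in> K1 \<times> {t}"
    then obtain x where x: "p = (x, t)" "r1 \<le> norm x" "norm x \<le> R1" by (auto simp: K1_def)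
    have "- \<epsilon> < deriv (u x) t" using w_small[OF x(2)] x by (simp add: w_def v_def abs_less_iff)
    moreover have "(x, t) \<in> \<Omega>" using x R2 by (intro inO) simp
    ultimately show "p \<in> W" using W(2) x by auto
  qed
  then obtain \<delta> where \<delta>: "\<delta> > 0" "{p. infdist p (K1 \<times> {t}) \<le> \<delta>} \<subseteq> W"
    using compact_in_open_separated[OF _ cK W(1)] ne by blast
  have slow: "u x s \<le> u x t + \<epsilon> * (t - s)" if x: "x \<in> K1" and s: "t - \<delta> \<le> s" "T \<le> s" "s \<le> t" for x s
  proof (rule nonneg_slow_decrease)
    show "continuous_on {s..t} (u x)" by (rule continuous_on_subset[OF continuous_time]) (use s T in auto)
    fix s' assume s': "s \<le> s'" "s' \<le> t"
    then have sp: "s' > 0" using s T by simp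
    show "0 \<le> u x s'" by (rule nonneg[OF sp])
    assume "0 < u x s'"
    then have "(x, s') \<in> \<Omega>" using vanish[OF sp, of x] sp by (force simp: \<Omega>_def positive_region_def not_le[symmetric])
    moreover have "infdist (x, s') (K1 \<times> {t}) \<le> dist (x, s') (x, t)" by (rule infdist_le) (use x in auto)
    then have "(x, s') \<in> W" using \<delta>(2) s s' by (auto simp: dist_Pair_Pair dist_real_def)
    ultimately have "(x, s') \<in> W \<inter> \<Omega>" by simp
    then have "- \<epsilon> < deriv (u x) s'" "(x, s') \<in> positive_region R" unfolding W(2) by (auto simp: \<Omega>_def)
    then show "\<exists>D. (u x has_real_derivative D) (at s') \<and> - \<epsilon> \<le> D"
      using time_derivative[of x s'] pde[of x s'] by (intro exI[of _ "deriv (u x) s'"]) auto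
  qed (use s \<epsilon> in auto)
  \<comment> \<open>The mass within \<open>R1\<close> is 1 at both times, so a bound on how much the
    annulus can lose bounds how much the inner ball can gain. The rate \<open>1 / 4\<close>
    contradicts \<open>3 / 4 \<le> D1\<close>.\<close>
  have drop: "M r1 t \<le> M r1 s + 1 / 4 * (t - s)" if s: "t - \<delta> \<le> s" "T \<le> s" "s \<le> t" for s
  proof -
    have sp: "s > 0" using s T by simp
    have dl: "dilint (\<lambda>x. u x s - u x t) r = A r s - A r t" for r
      unfolding A_def dilint_def
      by (rule set_integral_diff; rule set_integrable_compact_continuous)
         (auto intro!: continuous_on_compose2[OF continuous_slice[OF sp]] continuous_on_compose2[OF continuous_slice[OF tp]] continuous_intros)
    have "R1 ^ DIM('a) * dilint (\<lambda>x. u x s - u x t) R1 - r1 ^ DIM('a) * dilint (\<lambda>x. u x s - u x t) r1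
        \<le> (\<epsilon> * (t - s)) * unit_ball_vol DIM('a) * (R1 ^ DIM('a) - r1 ^ DIM('a))"
    proof (rule mass_annulus_le)
      fix x :: 'a assume "r1 \<le> norm x" "norm x \<le> R1"
      then show "u x s - u x t \<le> \<epsilon> * (t - s)" using slow[of x s] s by (simp add: K1_def)
    qed (use r1 r12 in \<open>auto intro!: continuous_intros continuous_slice sp tp\<close>)
    also have "\<dots> = (t - s) * (\<epsilon> * unit_ball_vol DIM('a) * (R1 ^ DIM('a) - r1 ^ DIM('a)))" by simp
    also have "\<dots> \<le> (t - s) * (1 / 4)" using s R1 r2 by (intro mult_left_mono annulus) auto
    finally have "(M R1 s - M R1 t) - (M r1 s - M r1 t)
        \<le> (t - s) * (1 / 4)" by (simp only: dl right_diff_distrib)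
    moreover have "M R1 s = 1" "M R1 t = 1" using full[of R1 s] full[of R1 t] s T by simp_all
    ultimately show ?thesis by argo
  qed
  have "((\<lambda>s. M r1 s - 1 / 4 * s) has_real_derivative D1 - 1 / 4) (at t)"
    by (rule derivative_eq_intros dA refl | simp)+
  then obtain \<eta> where \<eta>: "\<eta> > 0" "\<And>h. 0 < h \<Longrightarrow> h < \<eta> \<Longrightarrow>
      M r1 (t - h) - 1 / 4 * (t - h) < M r1 t - 1 / 4 * t"
    using DERIV_pos_inc_left[of _ "D1 - 1 / 4" t] D1 by auto
  define h where "h = Min {\<eta>, \<delta>, t - T} / 2"
  have h: "h > 0" "h < \<eta>" "h \<le> \<delta>" "h \<le> t - T" using \<eta>(1) \<delta>(1) T by (auto simp: h_def min_def)
  have "M r1 t \<le> M r1 (t - h) + 1 / 4 * (t - (t - h))"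
    by (rule drop) (use h in auto)
  with \<eta>(2)[OF h(1,2)] show False by argo
qed

lemma eventually_radius_le:
  assumes q: "0 < q" "q < 1"
  obtains T where "T > 0" "\<And>t. T < t \<Longrightarrow> R t \<le> ennreal (\<rho> / q)"
proof -
  obtain T where T: "T > 0" "\<And>t x. T \<le> t \<Longrightarrow> \<rho> / q \<le> norm x \<Longrightarrow> u x t = 0"
    using eventually_supported[OF q] by blast
  then show thesis using that[OF T(1)] radius_le_support[OF T(1) _ _ T(2)] rho_pos q by simp
qed

lemma radius_tendsto: "(R \<longlongrightarrow> ennreal \<rho>) at_top"
proof (rule order_tendstoI)
  fix a assume "a < ennreal \<rho>"
  then obtain a' where a: "a = ennreal a'" "0 \<le> a'" "a' < \<rho>"
    by (cases a) (auto simp: ennreal_less_iff)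
  define q where "q = \<rho> / ((a' + \<rho>) / 2)"
  have q: "1 < q" "a' < \<rho> / q" using a rho_pos by (auto simp: q_def field_simps)
  obtain T where "\<And>t. T \<le> t \<Longrightarrow> ennreal (\<rho> / q) \<le> R t" using eventually_radius_ge[OF q(1)] by blast
  moreover have "a < ennreal (\<rho> / q)" using a q by (simp add: ennreal_less_iff)
  ultimately show "\<forall>\<^sub>F t in at_top. a < R t"
    unfolding eventually_at_top_linorder by (meson less_le_trans)
next
  fix a assume "ennreal \<rho> < a"
  then obtain a' where a: "\<rho> < a'" "ennreal a' < a" using ennreal_gap rho_pos by (metis less_imp_le)
  define q where "q = \<rho> / a'"
  have q: "0 < q" "q < 1" "\<rho> / q = a'" using a rho_pos by (auto simp: q_def)
  obtain T where "\<And>t. T < t \<Longrightarrow> R t \<le> ennreal (\<rho> / q)" using eventually_radius_le[OF q(1,2)] by blast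
  then have "\<And>t. T < t \<Longrightarrow> R t < a" using a(2) q(3) by (metis le_less_trans)
  then show "\<forall>\<^sub>F t in at_top. R t < a"
    unfolding eventually_at_top_dense by blast
qed

end

section \<open>Reflections\<close>

text \<open>The trace of the Hessian may be taken in any orthonormal frame. The hypotheses are those
  satisfied by a reflection: symmetric and isometric on the basis.\<close>

lemma sum_hessian_orthogonal:
  fixes f :: "'a::euclidean_space \<Rightarrow> real"
  assumes sym: "\<And>a b. a \<in> Basis \<Longrightarrow> b \<in> Basis \<Longrightarrow> S a \<bullet> b = a \<bullet> S b"
    and iso: "\<And>a b. a \<in> Basis \<Longrightarrow> b \<in> Basis \<Longrightarrow> S a \<bullet> S b = a \<bullet> b"
  shows "(\<Sum>i\<in>Basis. hessian f x (S i)) = laplacian f x"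
proof -
  define F where "F = (\<lambda>a b. partial_deriv b (partial_deriv a f) x)"
  have "(\<Sum>i\<in>Basis. hessian f x (S i)) = (\<Sum>i\<in>Basis. \<Sum>a\<in>Basis. \<Sum>b\<in>Basis. (S i \<bullet> a) * ((S i \<bullet> b) * F a b))"
    by (simp add: hessian_def dirderiv_def sum_distrib_left F_def)
  also have "\<dots> = (\<Sum>a\<in>Basis. \<Sum>i\<in>Basis. \<Sum>b\<in>Basis. (S i \<bullet> a) * ((S i \<bullet> b) * F a b))"
    by (rule sum.swap)
  also have "\<dots> = (\<Sum>a\<in>Basis. \<Sum>b\<in>Basis. \<Sum>i\<in>Basis. (S i \<bullet> a) * ((S i \<bullet> b) * F a b))"
    by (rule sum.cong[OF refl sum.swap])
  also have "\<dots> = (\<Sum>a\<in>Basis. \<Sum>b\<in>Basis. (a \<bullet> b) * F a b)"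
  proof (intro sum.cong refl)
    fix a b :: 'a assume ab: "a \<in> Basis" "b \<in> Basis"
    have "(\<Sum>i\<in>Basis. (S i \<bullet> a) * ((S i \<bullet> b) * F a b)) = (\<Sum>i\<in>Basis. (S a \<bullet> i) * (S b \<bullet> i)) * F a b"
      unfolding sum_distrib_right
    proof (rule sum.cong[OF refl])
      fix i :: 'a assume i: "i \<in> Basis"
      have "S i \<bullet> a = S a \<bullet> i" "S i \<bullet> b = S b \<bullet> i"
        using sym[OF i ab(1)] sym[OF i ab(2)] by (simp_all only: inner_commute)
      then show "(S i \<bullet> a) * ((S i \<bullet> b) * F a b) = (S a \<bullet> i) * (S b \<bullet> i) * F a b" by simp
    qed
    also have "(\<Sum>i\<in>Basis. (S a \<bullet> i) * (S b \<bullet> i)) = a \<bullet> b"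
      using euclidean_inner[of "S a" "S b"] iso[OF ab] by simp
    finally show "(\<Sum>i\<in>Basis. (S i \<bullet> a) * ((S i \<bullet> b) * F a b)) = (a \<bullet> b) * F a b" .
  qed
  also have "\<dots> = (\<Sum>a\<in>Basis. F a a)" by (intro sum.cong refl sum_inner_Basis)
  finally show ?thesis by (simp add: laplacian_def F_def)
qed

lemma norm_line_derivative:
  fixes y v :: "'a::euclidean_space"
  assumes "y + h *\<^sub>R v \<noteq> 0"
  shows "((\<lambda>h. norm (y + h *\<^sub>R v)) has_real_derivative ((y + h *\<^sub>R v) \<bullet> v) / norm (y + h *\<^sub>R v)) (at h)"
proof -
  have d: "((\<lambda>h. (y + h *\<^sub>R v) \<bullet> (y + h *\<^sub>R v)) has_real_derivative 2 * ((y + h *\<^sub>R v) \<bullet> v)) (at h)"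
    by (auto simp: inner_left_distrib inner_right_distrib inner_commute algebra_simps intro!: derivative_eq_intros)
  have p: "(y + h *\<^sub>R v) \<bullet> (y + h *\<^sub>R v) > 0" using assms by simp
  have "((\<lambda>h. sqrt ((y + h *\<^sub>R v) \<bullet> (y + h *\<^sub>R v))) has_real_derivative
      inverse (sqrt ((y + h *\<^sub>R v) \<bullet> (y + h *\<^sub>R v))) / 2 * (2 * ((y + h *\<^sub>R v) \<bullet> v))) (at h)"
    by (rule DERIV_chain2[OF DERIV_real_sqrt[OF p] d])
  then show ?thesis unfolding norm_eq_sqrt_inner by (simp add: field_simps)
qed

text \<open>A linear function times a radial function of dimension \<open>d + 2\<close> behaves under the
  Laplacian like the radial factor: \<open>\<Delta> ((y \<bullet> e) G(|y|)) = (y \<bullet> e) (G'' + (d + 1) / r G')(|y|)\<close>.\<close>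

lemma laplacian_linear_radial:
  fixes y e :: "'a::euclidean_space"
  assumes op: "radial_op (DIM('a) + 1) G (norm y) l" and y: "y \<noteq> 0"
  obtains \<phi>' \<phi>'' where
    "\<And>i. i \<in> Basis \<Longrightarrow> \<forall>\<^sub>F h in nhds 0. ((\<lambda>h. ((y + h *\<^sub>R i) \<bullet> e) * G (norm (y + h *\<^sub>R i))) has_real_derivative \<phi>' i h) (at h)"
    "\<And>i. i \<in> Basis \<Longrightarrow> (\<phi>' i has_real_derivative \<phi>'' i) (at 0)"
    "(\<Sum>i\<in>Basis. \<phi>'' i) = (y \<bullet> e) * l"
proof -
  define r where "r = norm y"
  have r: "r > 0" using y by (simp add: r_def)
  obtain G1 G2 where G: "\<forall>\<^sub>F s in nhds r. (G has_real_derivative G1 s) (at s)"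
     "(G1 has_real_derivative G2) (at r)" "l = G2 + (DIM('a) + 1) / r * G1 r"
    using op y unfolding radial_op_def r_def by auto
  define N where "N = (\<lambda>i h. norm (y + h *\<^sub>R i))"
  define \<phi>' where "\<phi>' = (\<lambda>i h. (i \<bullet> e) * G (N i h) + ((y + h *\<^sub>R i) \<bullet> e) * (G1 (N i h) * (((y + h *\<^sub>R i) \<bullet> i) / N i h)))"
  define \<phi>'' where "\<phi>'' = (\<lambda>i. (i \<bullet> e) * (G1 r * ((y \<bullet> i) / r)) + ((i \<bullet> e) * (G1 r * ((y \<bullet> i) / r)) +
      (y \<bullet> e) * (G2 * ((y \<bullet> i) / r) * ((y \<bullet> i) / r) + G1 r * ((1 * r - (y \<bullet> i) * ((y \<bullet> i) / r)) / (r * r)))))"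
  have lin: "((\<lambda>h. (y + h *\<^sub>R i) \<bullet> c) has_real_derivative i \<bullet> c) (at h)" for i c h
    by (auto simp: inner_left_distrib intro!: derivative_eq_intros)
  have N0: "N i 0 = r" for i by (simp add: N_def r_def)
  have dN: "(N i has_real_derivative ((y + h *\<^sub>R i) \<bullet> i) / N i h) (at h)" if "N i h > 0" for i h
    unfolding N_def by (rule norm_line_derivative) (use that in \<open>auto simp: N_def\<close>)
  have dN0: "(N i has_real_derivative (y \<bullet> i) / r) (at 0)" for i
    using dN[of i 0] N0 r by simp
  have ev: "\<forall>\<^sub>F h in nhds 0. (G has_real_derivative G1 (N i h)) (at (N i h)) \<and> N i h > 0" for i
  proof -
    have "isCont (N i) 0" using dN0 by (rule DERIV_isCont)
    then have lim: "(N i \<longlongrightarrow> r) (nhds 0)"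
      using tendsto_at_iff_tendsto_nhds[of "N i" 0] N0 by (simp add: isCont_def)
    show ?thesis
      using eventually_compose_filterlim[OF G(1) lim] order_tendstoD(1)[OF lim r] by eventually_elim simp
  qed
  show thesis
  proof (rule that)
    fix i :: 'a assume i: "i \<in> Basis"
    show "\<forall>\<^sub>F h in nhds 0. ((\<lambda>h. ((y + h *\<^sub>R i) \<bullet> e) * G (norm (y + h *\<^sub>R i))) has_real_derivative \<phi>' i h) (at h)"
      using ev[of i]
    proof eventually_elim
      case (elim h)
      have "((\<lambda>h. G (N i h)) has_real_derivative G1 (N i h) * (((y + h *\<^sub>R i) \<bullet> i) / N i h)) (at h)"
        by (rule DERIV_chain2[OF conjunct1[OF elim] dN[OF conjunct2[OF elim]]])
      from DERIV_mult[OF lin[of i e h] this] show ?case by (simp add: \<phi>'_def N_def mult_ac)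
    qed
    have GN: "((\<lambda>h. G (N i h)) has_real_derivative G1 r * ((y \<bullet> i) / r)) (at 0)"
    proof -
      have "(G has_real_derivative G1 r) (at (N i 0))"
        using eventually_nhds_x_imp_x[OF ev[of i]] N0 by simp
      from DERIV_chain2[OF this dN0] show ?thesis .
    qed
    have G1N: "((\<lambda>h. G1 (N i h)) has_real_derivative G2 * ((y \<bullet> i) / r)) (at 0)"
    proof -
      have "(G1 has_real_derivative G2) (at (N i 0))" using G(2) N0 by simp
      from DERIV_chain2[OF this dN0] show ?thesis .
    qed
    have Q: "((\<lambda>h. ((y + h *\<^sub>R i) \<bullet> i) / N i h) has_real_derivative (1 * r - (y \<bullet> i) * ((y \<bullet> i) / r)) / (r * r)) (at 0)"
      using DERIV_divide[OF lin[of i i 0] dN0[of i]] N0 r i by simp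
    have P: "((\<lambda>h. G1 (N i h) * (((y + h *\<^sub>R i) \<bullet> i) / N i h)) has_real_derivative
        G2 * ((y \<bullet> i) / r) * ((y \<bullet> i) / r) + G1 r * ((1 * r - (y \<bullet> i) * ((y \<bullet> i) / r)) / (r * r))) (at 0)"
      using DERIV_mult[OF G1N Q] N0 by (simp add: mult_ac)
    have "(\<phi>' i has_real_derivative (i \<bullet> e) * (G1 r * ((y \<bullet> i) / r)) +
       ((i \<bullet> e) * (G1 (N i 0) * (((y + 0 *\<^sub>R i) \<bullet> i) / N i 0)) +
        (G2 * ((y \<bullet> i) / r) * ((y \<bullet> i) / r) + G1 r * ((1 * r - (y \<bullet> i) * ((y \<bullet> i) / r)) / (r * r))) * ((y + 0 *\<^sub>R i) \<bullet> e))) (at 0)"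
      unfolding \<phi>'_def by (intro DERIV_add DERIV_cmult DERIV_mult GN lin P)
    then show "(\<phi>' i has_real_derivative \<phi>'' i) (at 0)" by (simp add: \<phi>''_def N0 mult.commute)
  next
    have s1: "(\<Sum>i\<in>Basis. (i \<bullet> e) * (y \<bullet> i)) = y \<bullet> e"
      using euclidean_inner[of y e] by (simp add: mult.commute inner_commute)
    have s2: "(\<Sum>i\<in>Basis. (y \<bullet> i) * (y \<bullet> i)) = r * r"
      using euclidean_inner[of y y] by (simp add: r_def dot_square_norm power2_eq_square)
    have "\<phi>'' i = (2 * G1 r / r) * ((i \<bullet> e) * (y \<bullet> i)) + (y \<bullet> e) * ((G2 / (r * r) - G1 r / (r * r * r)) * ((y \<bullet> i) * (y \<bullet> i)) + G1 r / r)" for i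
      using r by (simp add: \<phi>''_def field_simps)
    then have "(\<Sum>i\<in>Basis. \<phi>'' i) = (2 * G1 r / r) * (\<Sum>i\<in>Basis. (i \<bullet> e) * (y \<bullet> i)) +
        (y \<bullet> e) * ((G2 / (r * r) - G1 r / (r * r * r)) * (\<Sum>i\<in>Basis. (y \<bullet> i) * (y \<bullet> i)) + DIM('a) * (G1 r / r))"
      by (simp add: sum.distrib sum_distrib_left distrib_left)
    also have "\<dots> = (2 * G1 r / r) * (y \<bullet> e) + (y \<bullet> e) * ((G2 / (r * r) - G1 r / (r * r * r)) * (r * r) + DIM('a) * (G1 r / r))"
      unfolding s1 s2 ..
    also have "\<dots> = (y \<bullet> e) * l" using r by (simp add: G(3) field_simps)
    finally show "(\<Sum>i\<in>Basis. \<phi>'' i) = (y \<bullet> e) * l" .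
  qed
qed

lemma radial_op_square: "radial_op k (\<lambda>s. s\<^sup>2) r (2 * (k + 1))"
  unfolding radial_op_def
proof (intro exI conjI)
  show "\<forall>\<^sub>F s in nhds r. ((\<lambda>s. s\<^sup>2) has_real_derivative 2 * s) (at s)"
    by (intro always_eventually allI) (rule derivative_eq_intros refl | simp)+
  show "((\<lambda>s. 2 * s) has_real_derivative 2) (at r)"
    by (rule derivative_eq_intros refl | simp)+
qed (auto simp: field_simps)

lemma reflection_norm:
  fixes x e :: "'a::euclidean_space"
  assumes e: "e \<bullet> e = 1" and s: "0 \<le> s" "s \<le> x \<bullet> e"
  shows "norm (x - (2 * (x \<bullet> e - s)) *\<^sub>R e) \<le> norm x"
proof (rule power2_le_imp_le)
  have "(norm (x - (2 * (x \<bullet> e - s)) *\<^sub>R e))\<^sup>2 = (norm x)\<^sup>2 - 4 * (x \<bullet> e - s) * s"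
    unfolding power2_norm_eq_inner using e
    by (simp add: inner_diff_left inner_diff_right inner_commute algebra_simps)
  also have "\<dots> \<le> (norm x)\<^sup>2" using s by simp
  finally show "(norm (x - (2 * (x \<bullet> e - s)) *\<^sub>R e))\<^sup>2 \<le> (norm x)\<^sup>2" .
qed simp

context ground_state
begin

text \<open>A strict supersolution on a ball slightly larger than \<open>ball 0 \<rho>\<close>: the function
  \<open>g (p s) - \<delta> (p s)\<^sup>2\<close> with \<open>p < 1\<close> close to 1 and small \<open>\<delta>\<close>. Multiplied by a
  linear function it shows that the principal eigenvalue of a half ball exceeds 1.\<close>

lemma half_ball_supersolution:
  obtains p \<kappa> m M \<Gamma> where "0 < p" "p < 1" "0 < \<kappa>" "0 < m"
    "\<forall>s\<ge>0. p * s \<le> \<rho> \<longrightarrow> m \<le> \<Gamma> s \<and> \<Gamma> s \<le> M"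
    "\<forall>s\<ge>0. p * s < \<rho> \<longrightarrow> (\<exists>l. radial_op (DIM('a) + 1) \<Gamma> s l \<and> l \<le> - (1 + \<kappa>) * \<Gamma> s)"
proof -
  have ne: "{0..\<rho>} \<noteq> {}" using rho_pos by simp
  obtain x where x: "x \<in> {0..\<rho>}" "\<And>y. y \<in> {0..\<rho>} \<Longrightarrow> g x \<le> g y"
    using continuous_attains_inf[OF compact_Icc ne continuous_g] by blast
  obtain z where z: "z \<in> {0..\<rho>}" "\<And>y. y \<in> {0..\<rho>} \<Longrightarrow> g y \<le> g z"
    using continuous_attains_sup[OF compact_Icc ne continuous_g] by blast
  define a where "a = g x"
  define b where "b = g z"
  have a: "0 < a" "a \<le> b" using g_pos[of x] x z by (auto simp: a_def b_def)
  have ab: "a \<le> g y" "g y \<le> b" if "0 \<le> y" "y \<le> \<rho>" for y using x z that by (auto simp: a_def b_def)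
  \<comment> \<open>Keeps the subtracted term at most half of the minimum \<open>a\<close> of
    \<open>g\<close>, so that \<open>\<Gamma>\<close> stays above \<open>a / 2\<close>.\<close>
  define \<delta> where "\<delta> = a / (2 * \<rho>\<^sup>2)"
  have \<delta>: "0 < \<delta>" "\<delta> * \<rho>\<^sup>2 = a / 2" using a rho_pos by (auto simp: \<delta>_def)
  \<comment> \<open>\<open>\<delta>\<close> times the radial operator of the square function: the
    amount gained over the equation of \<open>g\<close>. One half of it pays for the factor
    \<open>p\<^sup>2\<close> through the choice of \<open>\<eta>\<close>, the other half becomes the
    rate \<open>\<kappa>\<close>.\<close>
  define \<beta> where "\<beta> = 2 * (DIM('a) + 2) * \<delta>"
  have \<beta>: "0 < \<beta>" using \<delta> by (simp add: \<beta>_def)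
  define \<eta> where "\<eta> = (\<beta> / 4) / (b + \<beta>)"
  have \<eta>: "0 < \<eta>" "\<eta> < 1" "2 * \<eta> * (b + \<beta>) = \<beta> / 2" 
  proof -
    have bb: "0 < b + \<beta>" using \<beta> a by simp
    show "0 < \<eta>" using \<beta> bb by (simp add: \<eta>_def)
    have "\<beta> / 4 < b + \<beta>" using \<beta> a by simp
    then show "\<eta> < 1" using bb by (simp add: \<eta>_def)
    have "\<eta> * (b + \<beta>) = \<beta> / 4"
      unfolding \<eta>_def using bb by (intro nonzero_eq_divide_eq[THEN iffD1, OF _ refl]) simp
    then show "2 * \<eta> * (b + \<beta>) = \<beta> / 2" by (simp only: mult.assoc)
  qed
  define p where "p = 1 - \<eta>"
  define \<kappa> where "\<kappa> = \<beta> / (2 * b)"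
  have \<kappa>: "0 < \<kappa>" "\<kappa> * b = \<beta> / 2" using \<beta> a by (auto simp: \<kappa>_def)
  define \<Gamma> where "\<Gamma> = (\<lambda>s. g (p * s) - \<delta> * (p * s)\<^sup>2)"
  have p: "0 < p" "p < 1" using \<eta> by (auto simp: p_def)
  show thesis
  proof (rule that[of p \<kappa> "a / 2" \<Gamma> b]; (intro allI impI)?)
    show "0 < p" "p < 1" "0 < \<kappa>" "0 < a / 2" using p \<kappa> a by auto
    fix s assume s: "0 \<le> s" "p * s \<le> \<rho>"
    have ps: "0 \<le> p * s" using s p by simp
    have "\<delta> * (p * s)\<^sup>2 \<le> a / 2"
      unfolding \<delta>(2)[symmetric] using \<delta>(1) ps s by (intro mult_left_mono power_mono) auto
    moreover have "0 \<le> \<delta> * (p * s)\<^sup>2" using \<delta> by simp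
    ultimately show "a / 2 \<le> \<Gamma> s \<and> \<Gamma> s \<le> b" using ab[OF ps s(2)] by (simp add: \<Gamma>_def)
  next
    fix s assume s: "0 \<le> s" "p * s < \<rho>"
    have ps: "0 \<le> p * s" "p * s \<le> \<rho>" "\<bar>p * s\<bar> < \<rho>" using s p by auto
    define l where "l = p\<^sup>2 * - g (p * s) - \<delta> * (p\<^sup>2 * (2 * (real (DIM('a) + 1) + 1)))"
    have "radial_op (DIM('a) + 1) \<Gamma> s l"
      unfolding \<Gamma>_def l_def using p ps
      by (intro radial_op_diff radial_op_cmult radial_op_scale[where g=g] radial_op_scale[where g="\<lambda>s. s\<^sup>2"] radial_op_g radial_op_square) auto
    moreover have "l \<le> - (1 + \<kappa>) * \<Gamma> s"
    proof -
      define G where "G = g (p * s)"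
      have G: "0 < G" "G \<le> b" using ab[OF ps(1,2)] a by (auto simp: G_def)
      have "1 - p\<^sup>2 \<le> 2 * \<eta>" by (simp add: p_def power2_eq_square algebra_simps)
      then have "(1 - p\<^sup>2) * (G + \<beta>) \<le> 2 * \<eta> * (b + \<beta>)"
        using G \<eta> \<beta> p by (intro mult_mono) auto
      then have 1: "G + \<beta> / 2 \<le> p\<^sup>2 * (G + \<beta>)" unfolding \<eta>(3) by (simp add: algebra_simps)
      have "\<kappa> * G \<le> \<beta> / 2" unfolding \<kappa>(2)[symmetric] using \<kappa> G by (intro mult_left_mono) auto
      then have "(1 + \<kappa>) * G \<le> p\<^sup>2 * (G + \<beta>)" using 1 by (simp add: algebra_simps)
      moreover have "(1 + \<kappa>) * \<Gamma> s \<le> (1 + \<kappa>) * G"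
        using \<kappa> \<delta> by (intro mult_left_mono) (auto simp: \<Gamma>_def G_def)
      moreover have "l = - (p\<^sup>2 * (G + \<beta>))" by (simp add: l_def G_def \<beta>_def algebra_simps)
      ultimately show ?thesis by linarith
    qed
    ultimately show "\<exists>l. radial_op (DIM('a) + 1) \<Gamma> s l \<and> l \<le> - (1 + \<kappa>) * \<Gamma> s" by blast
  qed
qed

end

context fbp
begin

lemma line_derivatives:
  assumes t: "t > 0" and x: "ennreal (norm x) < R t"
  shows "\<forall>\<^sub>F h in nhds 0. ((\<lambda>h. u (x + h *\<^sub>R v) t) has_real_derivative dirderiv (\<lambda>y. u y t) (x + h *\<^sub>R v) v) (at h)"
    and "((\<lambda>h. dirderiv (\<lambda>y. u y t) (x + h *\<^sub>R v) v) has_real_derivative hessian (\<lambda>y. u y t) x v) (at 0)"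
proof -
  obtain r where r: "norm x < r" "ennreal r < R t" using ennreal_gap[OF x] by auto
  have C: "C2_on (ball 0 r) (\<lambda>x. u x t)" by (rule C2_slice[OF t less_imp_le[OF r(2)]])
  have "((\<lambda>h. x + h *\<^sub>R v) \<longlongrightarrow> x + 0 *\<^sub>R v) (nhds 0)" by (intro tendsto_intros filterlim_ident)
  moreover have "\<forall>\<^sub>F y in nhds (x + 0 *\<^sub>R v). y \<in> ball 0 r" by (rule eventually_nhds_in_open) (use r in auto)
  ultimately have "\<forall>\<^sub>F h in nhds 0. x + h *\<^sub>R v \<in> ball 0 r" using eventually_compose_filterlim by blast
  then show "\<forall>\<^sub>F h in nhds 0. ((\<lambda>h. u (x + h *\<^sub>R v) t) has_real_derivative dirderiv (\<lambda>y. u y t) (x + h *\<^sub>R v) v) (at h)"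
    by eventually_elim (rule C2_on_line_derivative[OF C open_ball])
  show "((\<lambda>h. dirderiv (\<lambda>y. u y t) (x + h *\<^sub>R v) v) has_real_derivative hessian (\<lambda>y. u y t) x v) (at 0)"
    using C2_on_line_derivative2[OF C open_ball, of x 0 v] r by simp
qed

end

context fbp_ground
begin

text \<open>On the part of the ball beyond a hyperplane, the difference of \<open>u\<close> and its reflection solves
  the linear equation where it is positive, and it vanishes on the flat part of the boundary. It
  therefore decays like the half ball supersolution, which is centred at \<open>- \<sigma> e\<close> in order to be
  bounded below up to that flat part.\<close>

lemma reflection_decay:
  obtains C \<kappa> T where "0 < \<kappa>" "0 < T"
    "\<And>t x y. T \<le> t \<Longrightarrow> norm y \<le> norm x \<Longrightarrow> u x t \<le> u y t + C * exp (- (\<kappa> * (t - T)))"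
proof -
  obtain p \<kappa> m M \<Gamma> where p: "0 < p" "p < 1" and \<kappa>: "0 < \<kappa>" and m: "0 < m"
    and \<Gamma>': "\<forall>s\<ge>0. p * s \<le> \<rho> \<longrightarrow> m \<le> \<Gamma> s \<and> \<Gamma> s \<le> M"
    and \<Gamma>op': "\<forall>s\<ge>0. p * s < \<rho> \<longrightarrow> (\<exists>l. radial_op (DIM('a) + 1) \<Gamma> s l \<and> l \<le> - (1 + \<kappa>) * \<Gamma> s)"
    by (rule half_ball_supersolution)
  note \<Gamma> = \<Gamma>'[rule_format] and \<Gamma>op = \<Gamma>op'[rule_format]
  \<comment> \<open>Strictly between \<open>p\<close> and 1, so that the eventual support radius
    \<open>\<rho> / q\<close> is smaller than \<open>\<rho> / p\<close>, up to which
    \<open>\<Gamma>\<close> is controlled.\<close>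
  define q where "q = (1 + p) / 2"
  have q: "0 < q" "q < 1" "p < q" using p by (auto simp: q_def)
  define R1 where "R1 = \<rho> / q"
  have qR1: "q * R1 = \<rho>" using q by (simp add: R1_def)
  have R1: "0 < R1" using q rho_pos by (simp add: R1_def)
  then have pR1: "p * R1 < \<rho>" unfolding qR1[symmetric] using q by (intro mult_strict_right_mono)
  \<comment> \<open>Half of the room available: \<open>p * (R1 + \<sigma>)\<close> is the midpoint
    of \<open>p * R1\<close> and \<open>\<rho>\<close>, so the ball of radius \<open>R1\<close>
    stays in the domain of \<open>\<Gamma>\<close> after the shift.\<close>
  define \<sigma> where "\<sigma> = (\<rho> - p * R1) / (2 * p)"
  have "p * \<sigma> = (\<rho> - p * R1) / 2" using p by (simp add: \<sigma>_def)
  then have "p * (R1 + \<sigma>) < \<rho>" using pR1 unfolding distrib_left by argo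
  then have \<sigma>: "0 < \<sigma>" "p * (R1 + \<sigma>) < \<rho>" using pR1 p by (simp_all add: \<sigma>_def)
  obtain T where T: "T > 0" "\<And>t x. T \<le> t \<Longrightarrow> R1 \<le> norm x \<Longrightarrow> u x t = 0"
    using eventually_supported[OF q(1,2)] unfolding R1_def by blast
  have "bounded ((\<lambda>x. u x T) ` cball 0 R1)"
    by (intro compact_imp_bounded compact_continuous_image continuous_on_subset[OF continuous_slice[OF T(1)]]) auto
  then obtain B where B': "\<forall>y\<in>(\<lambda>x. u x T) ` cball 0 R1. norm y \<le> B" unfolding bounded_iff by blast
  have B: "u x T \<le> B" if "norm x \<le> R1" for x
    using bspec[OF B', of "u x T"] that by auto
  have B0: "0 \<le> B" using B[of 0] nonneg[OF T(1), of 0] R1 by simp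
  \<comment> \<open>Makes the barrier at least \<open>B\<close>, hence at least \<open>u\<close>, at
    time \<open>T\<close>.\<close>
  define C1 where "C1 = B / (\<sigma> * m)"
  have C1: "0 \<le> C1" "C1 * (\<sigma> * m) = B" using B0 \<sigma> m by (auto simp: C1_def)
  define C where "C = C1 * ((R1 + \<sigma>) * M)"
  have M: "0 < M" using \<Gamma>[of 0] m rho_pos by simp
  have C0: "0 \<le> C" using C1 R1 \<sigma> M by (simp add: C_def)
  have main: "u x t - u (x - (2 * (x \<bullet> e - s)) *\<^sub>R e) t \<le> C * exp (- (\<kappa> * (t - T)))"
    if e: "e \<bullet> e = 1" and s: "0 \<le> s" and x: "s \<le> x \<bullet> e" "norm x \<le> R1" and t: "T \<le> t" for x e s t
  proof -
    define K where "K = {x. s \<le> x \<bullet> e} \<inter> cball 0 R1"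
    define rf where "rf = (\<lambda>x. x - (2 * (x \<bullet> e - s)) *\<^sub>R e)"
    define h where "h = (\<lambda>x. ((x + \<sigma> *\<^sub>R e) \<bullet> e) * \<Gamma> (norm (x + \<sigma> *\<^sub>R e)))"
    define D where "D = (\<lambda>x t. u x t - u (rf x) t - C1 * exp (- (\<kappa> * (t - T))) * h x)"
    have ne: "norm e = 1" using e by (simp add: norm_eq_sqrt_inner)
    have xe: "(x + \<sigma> *\<^sub>R e) \<bullet> e = x \<bullet> e + \<sigma>" for x using e by (simp add: inner_add_left)
    have xn: "p * norm (x + \<sigma> *\<^sub>R e) < \<rho>" if "x \<in> K" for x
    proof -
      have "norm (x + \<sigma> *\<^sub>R e) \<le> R1 + \<sigma>"
        using norm_triangle_ineq[of x "\<sigma> *\<^sub>R e"] that ne \<sigma> by (simp add: K_def)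
      then have "p * norm (x + \<sigma> *\<^sub>R e) \<le> p * (R1 + \<sigma>)" using p by (intro mult_left_mono) auto
      then show ?thesis using \<sigma> by simp
    qed
    have h: "\<sigma> * m \<le> h x" "h x \<le> (R1 + \<sigma>) * M" if "x \<in> K" for x
    proof -
      have G: "m \<le> \<Gamma> (norm (x + \<sigma> *\<^sub>R e))" "\<Gamma> (norm (x + \<sigma> *\<^sub>R e)) \<le> M"
        using \<Gamma>[of "norm (x + \<sigma> *\<^sub>R e)"] xn[OF that] by auto
      have "x \<bullet> e \<le> R1" using norm_cauchy_schwarz[of x e] ne that by (simp add: K_def)
      moreover have "0 \<le> x \<bullet> e" using that s by (simp add: K_def)
      ultimately show "\<sigma> * m \<le> h x" "h x \<le> (R1 + \<sigma>) * M"
        unfolding h_def xe using G \<sigma> m by (auto intro!: mult_mono)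
    qed
    have Gc: "continuous_on {r. 0 \<le> r \<and> p * r < \<rho>} \<Gamma>"
    proof (intro continuous_at_imp_continuous_on ballI)
      fix r assume "r \<in> {r. 0 \<le> r \<and> p * r < \<rho>}"
      then obtain l where "radial_op (DIM('a) + 1) \<Gamma> r l" using \<Gamma>op by blast
      then obtain g' where "\<forall>\<^sub>F s in nhds r. (\<Gamma> has_real_derivative g' s) (at s)" unfolding radial_op_def by blast
      then show "isCont \<Gamma> r" using eventually_nhds_x_imp_x DERIV_isCont by blast
    qed
    have hc: "continuous_on K h" unfolding h_def
      by (intro continuous_intros continuous_on_compose2[OF Gc]) (use xn in auto)
    have rf_norm: "norm (rf x) \<le> norm x" if "x \<in> K" for x
      unfolding rf_def by (rule reflection_norm[OF e s]) (use that in \<open>auto simp: K_def\<close>)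
    have rf_cont: "continuous_on S rf" for S unfolding rf_def by (intro continuous_intros)
    have "D x t \<le> 0"
    proof (rule parabolic_max_principle[where D=D and K=K and T=t and ?t0.0=T and x=x and t=t])
      have "closed {x. s \<le> x \<bullet> e}" by (intro closed_Collect_le continuous_intros)
      then show "compact K" unfolding K_def using compact_cball closed_Int_compact by blast
      show "continuous_on (K \<times> {T..t}) (\<lambda>(x, t). D x t)"
        unfolding D_def split_beta
        by (intro continuous_intros continuous_on_compose2[OF cont, of _ "\<lambda>p. (rf (fst p), snd p)", unfolded prod.case]
              continuous_on_compose2[OF rf_cont[of UNIV]] continuous_on_compose2[OF hc] continuous_on_subset[OF cont[unfolded split_beta]])
           (use T in auto)
      show "x \<in> K" using x by (simp add: K_def)
      show "D x T \<le> 0" if xK: "x \<in> K" for x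
      proof -
        have "u x T \<le> B" using B xK by (simp add: K_def)
        moreover have "B \<le> C1 * h x" unfolding C1(2)[symmetric] using h(1)[OF xK] C1 by (intro mult_left_mono)
        ultimately show ?thesis using nonneg[OF T(1), of "rf x"] by (simp add: D_def)
      qed
      fix x t assume xK: "x \<in> K" and tt: "T < t" and Dp: "0 < D x t" and mx: "\<And>y. y \<in> K \<Longrightarrow> D y t \<le> D x t"
      have tp: "t > 0" using T tt by simp
      define c where "c = C1 * exp (- (\<kappa> * (t - T)))"
      have c: "0 \<le> c" using C1 by (simp add: c_def)
      have hp: "0 < h x" using h(1)[OF xK] \<sigma> m by (auto intro: less_le_trans[of 0 "\<sigma> * m"])
      have "0 \<le> c * h x" using c hp by simp
      \<comment> \<open>A positive value of \<open>D\<close> makes \<open>u x t\<close> positive, so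
        \<open>x\<close> lies in the positive region, and so does its image, which is no farther
        from the origin. It also keeps \<open>x\<close> off the flat and the spherical part of the
        boundary.\<close>
      then have up: "u (rf x) t < u x t" using Dp by (simp add: D_def c_def)
      then have ux: "0 < u x t" using nonneg[OF tp, of "rf x"] by simp
      have xR: "ennreal (norm x) < R t" using vanish[OF tp, of x] ux by (force simp: not_le[symmetric])
      have rR: "ennreal (norm (rf x)) < R t"
        using le_less_trans[OF ennreal_leI[OF rf_norm[OF xK]] xR] .
      have i1: "norm x < R1" using T(2)[of t x] tt ux by (force simp: not_le[symmetric])
      have i2: "s < x \<bullet> e"
      proof (rule ccontr)
        assume "\<not> ?thesis"
        then have "x \<bullet> e = s" using xK by (simp add: K_def)
        then have "rf x = x" by (simp add: rf_def)
        then show False using up by simp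
      qed
      have y0: "x + \<sigma> *\<^sub>R e \<noteq> 0"
      proof
        assume "x + \<sigma> *\<^sub>R e = 0"
        then have "x \<bullet> e + \<sigma> = 0" using xe[of x] by simp
        then show False using i2 s \<sigma> by simp
      qed
      obtain l where l: "radial_op (DIM('a) + 1) \<Gamma> (norm (x + \<sigma> *\<^sub>R e)) l" "l \<le> - (1 + \<kappa>) * \<Gamma> (norm (x + \<sigma> *\<^sub>R e))"
        using \<Gamma>op[of "norm (x + \<sigma> *\<^sub>R e)"] xn[OF xK] by auto
      obtain \<phi>' \<phi>'' where \<phi>:
        "\<And>i. i \<in> Basis \<Longrightarrow> \<forall>\<^sub>F k in nhds 0. ((\<lambda>k. (((x + \<sigma> *\<^sub>R e) + k *\<^sub>R i) \<bullet> e) * \<Gamma> (norm ((x + \<sigma> *\<^sub>R e) + k *\<^sub>R i))) has_real_derivative \<phi>' i k) (at k)"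
        "\<And>i. i \<in> Basis \<Longrightarrow> (\<phi>' i has_real_derivative \<phi>'' i) (at 0)"
        "(\<Sum>i\<in>Basis. \<phi>'' i) = ((x + \<sigma> *\<^sub>R e) \<bullet> e) * l"
        using laplacian_linear_radial[OF l(1) y0, of e] by blast
      define f where "f = (\<lambda>y. u y t)"
      define S where "S = (\<lambda>i::'a. i - (2 * (i \<bullet> e)) *\<^sub>R e)"
      have rfS: "rf (x + k *\<^sub>R i) = rf x + k *\<^sub>R S i" for k i
        by (simp add: rf_def S_def inner_add_left algebra_simps)
      \<comment> \<open>Second derivative test along each coordinate line through \<open>x\<close>;
        its mirror image passes through \<open>rf x\<close> in direction \<open>S i\<close>.
        Summation recovers both Laplacians.\<close>
      have "hessian f x i - hessian f (rf x) (S i) - c * \<phi>'' i \<le> 0" if i: "i \<in> Basis" for i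
      proof (rule real_local_max_second_derivative(2))
        show "((\<lambda>k. dirderiv f (x + k *\<^sub>R i) i - dirderiv f (rf x + k *\<^sub>R S i) (S i) - c * \<phi>' i k) has_real_derivative
            hessian f x i - hessian f (rf x) (S i) - c * \<phi>'' i) (at 0)"
          unfolding f_def by (intro DERIV_diff DERIV_cmult line_derivatives(2)[OF tp] xR rR \<phi>(2)[OF i])
        show "\<forall>\<^sub>F k in nhds 0. ((\<lambda>k. D (x + k *\<^sub>R i) t) has_real_derivative
            dirderiv f (x + k *\<^sub>R i) i - dirderiv f (rf x + k *\<^sub>R S i) (S i) - c * \<phi>' i k) (at k)"
          using line_derivatives(1)[OF tp xR, of i] line_derivatives(1)[OF tp rR, of "S i"] \<phi>(1)[OF i]
        proof eventually_elim
          case (elim k)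
          have "D (x + k *\<^sub>R i) t = u (x + k *\<^sub>R i) t - u (rf x + k *\<^sub>R S i) t
              - c * ((((x + \<sigma> *\<^sub>R e) + k *\<^sub>R i) \<bullet> e) * \<Gamma> (norm ((x + \<sigma> *\<^sub>R e) + k *\<^sub>R i)))" for k
            by (simp add: D_def h_def c_def rfS add_ac)
          then show ?case unfolding f_def by (simp only:) (intro DERIV_diff DERIV_cmult elim)
        qed
        have "((\<lambda>k. x + k *\<^sub>R i) \<longlongrightarrow> x + 0 *\<^sub>R i) (nhds 0)" by (intro tendsto_intros filterlim_ident)
        moreover have "\<forall>\<^sub>F y in nhds (x + 0 *\<^sub>R i). y \<in> {y. s < y \<bullet> e} \<inter> ball 0 R1"
        proof (rule eventually_nhds_in_open)
          have "open {y. s < y \<bullet> e}" by (intro open_Collect_less continuous_intros)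
          then show "open ({y. s < y \<bullet> e} \<inter> ball 0 R1)" by auto
        qed (use i1 i2 in auto)
        ultimately have "\<forall>\<^sub>F k in nhds 0. x + k *\<^sub>R i \<in> {y. s < y \<bullet> e} \<inter> ball 0 R1"
          using eventually_compose_filterlim by blast
        then show "\<forall>\<^sub>F k in nhds 0. D (x + k *\<^sub>R i) t \<le> D (x + 0 *\<^sub>R i) t"
        proof eventually_elim
          case (elim k)
          then have "x + k *\<^sub>R i \<in> K" by (simp add: K_def)
          then show ?case using mx by simp
        qed
      qed
      then have "(\<Sum>i\<in>Basis. hessian f x i - hessian f (rf x) (S i) - c * \<phi>'' i) \<le> 0"
        by (intro sum_nonpos)
      moreover have "(\<Sum>i\<in>Basis. hessian f x i) = laplacian f x"
        using sum_hessian_orthogonal[of "\<lambda>i. i" f x] by simp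
      moreover have "(\<Sum>i\<in>Basis. hessian f (rf x) (S i)) = laplacian f (rf x)"
        by (rule sum_hessian_orthogonal)
           (simp_all add: S_def inner_diff_left inner_diff_right inner_commute e)
      ultimately have lap: "laplacian f x - laplacian f (rf x) \<le> c * (((x + \<sigma> *\<^sub>R e) \<bullet> e) * l)"
        by (simp add: sum_subtractf sum_distrib_left[symmetric] \<phi>(3))
      have "((x + \<sigma> *\<^sub>R e) \<bullet> e) * l \<le> ((x + \<sigma> *\<^sub>R e) \<bullet> e) * (- (1 + \<kappa>) * \<Gamma> (norm (x + \<sigma> *\<^sub>R e)))"
        using l(2) i2 s \<sigma> unfolding xe by (intro mult_left_mono) auto
      also have "\<dots> = - (1 + \<kappa>) * h x" by (simp add: h_def)
      finally have "c * (((x + \<sigma> *\<^sub>R e) \<bullet> e) * l) \<le> c * (- (1 + \<kappa>) * h x)" using c by (rule mult_left_mono)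
      then have lap': "laplacian f x - laplacian f (rf x) \<le> - (c * h x) - \<kappa> * (c * h x)"
        using lap by (simp add: algebra_simps)
      have dx: "(u x has_real_derivative laplacian f x + u x t) (at t)"
        unfolding f_def by (rule time_derivative) (use xR tp in \<open>simp add: positive_region_def\<close>)
      have dr: "(u (rf x) has_real_derivative laplacian f (rf x) + u (rf x) t) (at t)"
        unfolding f_def by (rule time_derivative) (use rR tp in \<open>simp add: positive_region_def\<close>)
      have de: "((\<lambda>t. C1 * exp (- (\<kappa> * (t - T))) * h x) has_real_derivative - \<kappa> * (c * h x)) (at t)"
        unfolding c_def by (rule derivative_eq_intros refl | simp)+
      have "(D x has_real_derivative laplacian f x + u x t - (laplacian f (rf x) + u (rf x) t) - - \<kappa> * (c * h x)) (at t)"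
        unfolding D_def by (intro DERIV_diff dx dr de)
      moreover have "laplacian f x + u x t - (laplacian f (rf x) + u (rf x) t) - - \<kappa> * (c * h x) \<le> D x t"
        using lap' by (simp add: D_def c_def)
      ultimately show "\<exists>d. (D x has_real_derivative d) (at t) \<and> d \<le> D x t" by blast
    qed (use t in auto)
    moreover have "C1 * exp (- (\<kappa> * (t - T))) * h x \<le> C * exp (- (\<kappa> * (t - T)))"
    proof -
      have "C1 * exp (- (\<kappa> * (t - T))) * h x \<le> C1 * exp (- (\<kappa> * (t - T))) * ((R1 + \<sigma>) * M)"
        using h(2)[of x] x C1 by (intro mult_left_mono) (auto simp: K_def)
      then show ?thesis by (simp add: C_def mult_ac)
    qed
    ultimately show ?thesis unfolding D_def rf_def by linarith
  qed
  show thesis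
  proof (rule that[OF \<kappa> T(1)])
    fix t and x y :: 'a assume t: "T \<le> t" and xy: "norm y \<le> norm x"
    have tp: "t > 0" using t T by simp
    have E: "0 \<le> C * exp (- (\<kappa> * (t - T)))" using C0 by simp
    show "u x t \<le> u y t + C * exp (- (\<kappa> * (t - T)))"
    proof (cases "R1 \<le> norm x \<or> x = y")
      case True
      then show ?thesis using T(2)[OF t, of x] nonneg[OF tp, of y] E by auto
    next
      case False
      \<comment> \<open>The reflection in the perpendicular bisector of \<open>x\<close> and
        \<open>y\<close> exchanges the two points; \<open>norm y \<le> norm x\<close> says that the
        origin lies on the side of \<open>y\<close>, that is \<open>0 \<le> s\<close>.\<close>
      define n where "n = norm (x - y)"
      define e where "e = (1 / n) *\<^sub>R (x - y)"
      define s where "s = ((norm x)\<^sup>2 - (norm y)\<^sup>2) / (2 * n)"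
      have n: "n > 0" using False by (simp add: n_def)
      have nn: "(x - y) \<bullet> (x - y) = n * n" by (simp add: n_def dot_square_norm power2_eq_square)
      have e: "e \<bullet> e = 1" using n nn by (simp add: e_def)
      have s: "0 \<le> s" using xy n by (simp add: s_def power_mono)
      have "x \<bullet> e - s = (2 * (x \<bullet> (x - y)) - (x \<bullet> x - y \<bullet> y)) / (2 * n)"
      proof -
        have "x \<bullet> e = (2 * (x \<bullet> (x - y))) / (2 * n)" by (simp add: e_def)
        then show ?thesis by (simp only: s_def power2_norm_eq_inner diff_divide_distrib)
      qed
      also have "2 * (x \<bullet> (x - y)) - (x \<bullet> x - y \<bullet> y) = n * n"
        unfolding nn[symmetric] by (simp add: inner_diff_left inner_diff_right inner_commute)
      finally have xes: "x \<bullet> e - s = n / 2" using n by simp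
      have "x - (2 * (x \<bullet> e - s)) *\<^sub>R e = y" unfolding xes using n by (simp add: e_def)
      then show ?thesis using main[OF e s _ _ t, of x] xes n False by simp
    qed
  qed
qed

end

section \<open>Convergence\<close>

lemma power_superadditive:
  fixes a b :: real
  assumes "0 \<le> a" "0 \<le> b" "0 < n" shows "a ^ n + b ^ n \<le> (a + b) ^ n"
  using \<open>0 < n\<close>
proof (induction n rule: nat_induct_non_zero)
  case (Suc n)
  have "a ^ Suc n + b ^ Suc n \<le> (a + b) * (a ^ n + b ^ n)"
    using assms by (simp add: algebra_simps)
  also have "\<dots> \<le> (a + b) * (a + b) ^ n" using assms Suc by (intro mult_left_mono) auto
  finally show ?case by simp
qed simp

lemma exp_decay: "0 < k \<Longrightarrow> ((\<lambda>t::real. C * exp (- (k * (t - T)))) \<longlongrightarrow> 0) at_top"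
proof -
  assume k: "0 < k"
  have "filterlim (\<lambda>t. - T + t) at_top at_top"
    by (rule filterlim_tendsto_add_at_top[OF tendsto_const filterlim_ident])
  then have "filterlim (\<lambda>t. k * (- T + t)) at_top at_top"
    by (rule filterlim_tendsto_pos_mult_at_top[OF tendsto_const k])
  then have "filterlim (\<lambda>t. - (k * (- T + t))) at_bot at_top" by (simp add: filterlim_uminus_at_top)
  then have "((\<lambda>t. exp (- (k * (- T + t)))) \<longlongrightarrow> 0) at_top" by (rule filterlim_compose[OF exp_at_bot])
  from tendsto_mult_right_zero[OF this, of C] show ?thesis by simp
qed

lemma eventually_near_1:
  assumes "(f \<longlongrightarrow> f 1) (at 1)" "0 < e" "f 1 = (0::real)"
  shows "\<exists>q>1::real. f q < e" "\<exists>q. 0 < q \<and> q < 1 \<and> f q < e"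
proof -
  have ev: "\<forall>\<^sub>F q in at 1. f q < e" using assms order_tendstoD(2) by metis
  then have r: "\<forall>\<^sub>F q in at_right 1. f q < e" and l: "\<forall>\<^sub>F q in at_left 1. f q < e"
    by (simp_all add: eventually_at_split)
  have "\<forall>\<^sub>F q in at_right (1::real). f q < e \<and> 1 < q"
    using r eventually_at_right_less by (rule eventually_conj)
  then show "\<exists>q>1. f q < e" using eventually_happens'[OF trivial_limit_at_right_real] by blast
  have "\<forall>\<^sub>F q in at_left (1::real). q \<in> {0<..<1}" by (rule eventually_at_left_real) simp
  with l have "\<forall>\<^sub>F q in at_left (1::real). f q < e \<and> q \<in> {0<..<1}" by (rule eventually_conj)
  then show "\<exists>q. 0 < q \<and> q < 1 \<and> f q < e" using eventually_happens'[OF trivial_limit_at_left_real] by force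
qed

context ground_state
begin

lemma stationary_solution: "fbp (\<lambda>x t. U x) (\<lambda>t. ennreal \<rho>)"
proof
  define \<Omega> where "\<Omega> = (positive_region (\<lambda>t. ennreal \<rho>) :: ('a \<times> real) set)"
  have \<Omega>: "\<Omega> = ball 0 \<rho> \<times> {0<..}"
    by (auto simp: \<Omega>_def positive_region_def ennreal_less_iff)
  have c: "continuous_on \<Omega> (\<lambda>(x, t). f x)" if "continuous_on (ball 0 \<rho>) f" for f :: "'a \<Rightarrow> real"
    unfolding split_beta by (rule continuous_on_compose2[OF that]) (auto simp: \<Omega> intro!: continuous_intros)
  show "C21_on (positive_region (\<lambda>t. ennreal \<rho>)) (\<lambda>x t. U x)"
    unfolding C21_on_def \<Omega>_def[symmetric]
  proof (intro conjI ballI)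
    show "continuous_on \<Omega> (\<lambda>(x, t). U x)" by (rule c[OF continuous_on_subset[OF continuous_U]]) simp
    show "continuous_on \<Omega> (\<lambda>(x, t). deriv (\<lambda>t. U x) t)" by (simp add: split_beta)
    show "case p of (x, t) \<Rightarrow> (\<lambda>t. U x) field_differentiable at t" for p by (simp add: split_beta)
    fix i :: 'a assume i: "i \<in> Basis"
    show "case p of (x, t) \<Rightarrow> partially_differentiable i U x" if "p \<in> \<Omega>" for p
      using that C2_onD(4)[OF C2_U i i] by (auto simp: \<Omega>)
    show "continuous_on \<Omega> (\<lambda>(x, t). partial_deriv i U x)" by (rule c[OF C2_onD(2)[OF C2_U i i]])
    fix j :: 'a assume j: "j \<in> Basis"
    show "case p of (x, t) \<Rightarrow> partially_differentiable j (partial_deriv i U) x" if "p \<in> \<Omega>" for p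
      using that C2_onD(5)[OF C2_U i j] by (auto simp: \<Omega>)
    show "continuous_on \<Omega> (\<lambda>(x, t). partial_deriv j (partial_deriv i U) x)" by (rule c[OF C2_onD(3)[OF C2_U i j]])
  qed
  show "continuous_on (UNIV \<times> {0<..}) (\<lambda>(x, t). U x)"
    unfolding split_beta by (rule continuous_on_compose2[OF continuous_U]) (auto intro!: continuous_intros)
  show "deriv (\<lambda>t. U x) t = laplacian U x + U x" if "(x, t) \<in> positive_region (\<lambda>t. ennreal \<rho>)" for x and t :: real
    using that laplacian_U[of x] \<Omega> by (simp add: \<Omega>_def[symmetric])
  show "U x = 0" if "ennreal \<rho> \<le> ennreal (norm x)" for x
    using that U_zero by (simp add: ennreal_le_iff)
qed (use U_nonneg integral_U in auto)

text \<open>In \<open>reflection_decay\<close> for the stationary solution only the error term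
  depends on time, and it tends to 0.\<close>

lemma U_radially_decreasing: "norm y \<le> norm x \<Longrightarrow> U x \<le> U y"
proof -
  assume xy: "norm y \<le> norm x"
  interpret st: fbp_ground "\<lambda>x t. U x" "\<lambda>t. ennreal \<rho>" \<rho> U
    by (intro fbp_ground.intro stationary_solution ground_state_axioms)
  obtain C \<kappa> T where *: "0 < \<kappa>" "0 < T"
      "\<And>t x y. T \<le> t \<Longrightarrow> norm y \<le> norm x \<Longrightarrow> U x \<le> U y + C * exp (- (\<kappa> * (t - T)))"
    using st.reflection_decay by metis
  have "((\<lambda>t. U y + C * exp (- (\<kappa> * (t - T)))) \<longlongrightarrow> U y + 0) at_top"
    by (intro tendsto_intros exp_decay *(1))
  moreover have "\<forall>\<^sub>F t in at_top. U x \<le> U y + C * exp (- (\<kappa> * (t - T)))"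
    using eventually_ge_at_top[of T] by eventually_elim (rule *(3)[OF _ xy])
  ultimately have "U x \<le> U y + 0" by (rule tendsto_lowerbound) simp
  then show ?thesis by simp
qed

lemma V_eq_1: "\<rho> \<le> r \<Longrightarrow> V r = 1"
proof -
  assume r: "\<rho> \<le> r"
  interpret st: fbp "\<lambda>x t. U x" "\<lambda>t. ennreal \<rho>" by (rule stationary_solution)
  have "r ^ DIM('a) * st.A r 1 = 1"
    by (rule st.zero_imp_mass_full) (use r rho_pos U_zero in auto)
  then show ?thesis by (simp add: g_def st.A_def)
qed

lemma V_increment:
  assumes "0 \<le> r" "r \<le> s"
  shows "V s - V r \<le> U 0 * unit_ball_vol DIM('a) * (s ^ DIM('a) - r ^ DIM('a))"
  unfolding g_def by (rule mass_annulus_le[OF continuous_U assms]) (simp add: U_radially_decreasing)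

end

context fbp_ground
begin

lemma A_zero: "A 0 t = unit_ball_vol DIM('a) * u 0 t"
  unfolding A_def by (rule dilint_zero)

text \<open>\<open>U\<close> is bounded by its value at the origin, so replacing
  \<open>V (q * r)\<close> by \<open>V r\<close> costs at most a multiple of \<open>q^d - 1\<close>.
  The value at the origin is recorded as well, because close to it no inner annulus of fixed width
  is available for \<open>uniform_convergence\<close>.\<close>

lemma mass_convergence_upper:
  assumes e: "0 < e"
  obtains T where "T > 0" "\<And>t r. T \<le> t \<Longrightarrow> 0 \<le> r \<Longrightarrow> M r t \<le> V r + e"
    "\<And>t. T \<le> t \<Longrightarrow> u 0 t \<le> U 0 + e"
proof -
  \<comment> \<open>The first summand covers the change of \<open>V\<close> under rescaling, the
    second the change of the value at the origin.\<close>
  define W where "W = U 0 * unit_ball_vol DIM('a) * \<rho> ^ DIM('a) + U 0"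
  have W: "0 \<le> U 0 * unit_ball_vol DIM('a) * \<rho> ^ DIM('a)" "0 \<le> U 0" using U_nonneg rho_pos by auto
  have "((\<lambda>q. W * (q ^ DIM('a) - 1)) \<longlongrightarrow> W * (1 ^ DIM('a) - 1)) (at 1)" by (intro tendsto_intros)
  then obtain q where q: "1 < q" "W * (q ^ DIM('a) - 1) < e"
    using eventually_near_1(1)[of "\<lambda>q. W * (q ^ DIM('a) - 1)" e] e by auto
  have q1: "0 \<le> q ^ DIM('a) - 1" using q by (simp add: one_le_power)
  obtain T where T: "T > 0" "\<And>t r. T \<le> t \<Longrightarrow> 0 \<le> r \<Longrightarrow> r \<le> \<rho> / q \<Longrightarrow> A r t \<le> q ^ DIM('a) * g (q * r)"
    using eventually_upper[OF q(1)] by blast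
  show thesis
  proof (rule that[OF T(1)])
    fix t r :: real assume t: "T \<le> t" and r: "0 \<le> r"
    have le: "M r t \<le> V (q * r)"
    proof (cases "r \<le> \<rho> / q")
      case True
      have "M r t \<le> r ^ DIM('a) * (q ^ DIM('a) * g (q * r))"
        using T(2)[OF t r True] r by (intro mult_left_mono) auto
      then show ?thesis by (simp add: power_mult_distrib mult_ac)
    next
      case False
      then have "\<rho> \<le> q * r" using q by (simp add: field_simps)
      then show ?thesis using V_eq_1 mass_le_1[of t r] t T r by simp
    qed
    show "M r t \<le> V r + e"
    proof (cases "r \<le> \<rho>")
      case True
      have "V (q * r) - V r \<le> U 0 * unit_ball_vol DIM('a) * ((q * r) ^ DIM('a) - r ^ DIM('a))"
        using q r mult_right_mono[of 1 q r] by (intro V_increment) auto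
      also have "(q * r) ^ DIM('a) - r ^ DIM('a) = (q ^ DIM('a) - 1) * r ^ DIM('a)"
        by (simp add: power_mult_distrib algebra_simps)
      also have "U 0 * unit_ball_vol DIM('a) * ((q ^ DIM('a) - 1) * r ^ DIM('a)) \<le> U 0 * unit_ball_vol DIM('a) * ((q ^ DIM('a) - 1) * \<rho> ^ DIM('a))"
        using q1 r True U_nonneg by (intro mult_left_mono power_mono) auto
      also have "\<dots> \<le> W * (q ^ DIM('a) - 1)" using mult_nonneg_nonneg[OF W(2) q1] by (simp add: W_def algebra_simps)
      finally show ?thesis using le q(2) by linarith
    next
      case False
      then show ?thesis using V_eq_1[of r] mass_le_1[of t r] t T r e by simp
    qed
  next
    fix t assume t: "T \<le> t"
    have "unit_ball_vol DIM('a) * u 0 t \<le> unit_ball_vol DIM('a) * (q ^ DIM('a) * U 0)"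
      using T(2)[OF t, of 0] rho_pos q unfolding A_zero by (simp add: g_zero mult_ac)
    then have "u 0 t \<le> q ^ DIM('a) * U 0" by (simp add: mult_le_cancel_left_pos)
    also have "\<dots> = U 0 + U 0 * (q ^ DIM('a) - 1)" by (simp add: algebra_simps)
    also have "\<dots> \<le> U 0 + W * (q ^ DIM('a) - 1)" using mult_nonneg_nonneg[OF W(1) q1] by (simp add: W_def algebra_simps)
    finally show "u 0 t \<le> U 0 + e" using q(2) by linarith
  qed
qed

lemma mass_convergence_lower:
  assumes e: "0 < e"
  obtains T where "T > 0" "\<And>t r. T \<le> t \<Longrightarrow> 0 \<le> r \<Longrightarrow> V r \<le> M r t + e"
proof -
  define W where "W = U 0 * unit_ball_vol DIM('a) * \<rho> ^ DIM('a)"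
  have "((\<lambda>q. W * (1 / q ^ DIM('a) - 1)) \<longlongrightarrow> W * (1 / 1 ^ DIM('a) - 1)) (at 1)" by (intro tendsto_intros) simp
  then obtain q where q: "0 < q" "q < 1" "W * (1 / q ^ DIM('a) - 1) < e"
    using eventually_near_1(2)[of "\<lambda>q. W * (1 / q ^ DIM('a) - 1)" e] e by auto
  have q1: "0 \<le> 1 - q ^ DIM('a)" using q by (simp add: power_le_one)
  obtain T where T: "T > 0" "\<And>t r. T \<le> t \<Longrightarrow> 0 \<le> r \<Longrightarrow> r \<le> \<rho> / q \<Longrightarrow> q ^ DIM('a) * g (q * r) \<le> A r t"
    using eventually_lower[OF q(1,2)] by blast
  show thesis
  proof (rule that[OF T(1)])
    fix t r :: real assume t: "T \<le> t" and r: "0 \<le> r"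
    have main: "V s \<le> M s t + e" if s: "0 \<le> s" "s \<le> \<rho> / q" for s
    proof -
      have "V (q * s) = s ^ DIM('a) * (q ^ DIM('a) * g (q * s))" by (simp add: power_mult_distrib)
      also have "\<dots> \<le> M s t" using T(2)[OF t s] s by (intro mult_left_mono) auto
      finally have le: "V (q * s) \<le> M s t" .
      have "V s - V (q * s) \<le> U 0 * unit_ball_vol DIM('a) * (s ^ DIM('a) - (q * s) ^ DIM('a))"
        using q s mult_right_mono[of q 1 s] by (intro V_increment) auto
      also have "s ^ DIM('a) - (q * s) ^ DIM('a) = (1 - q ^ DIM('a)) * s ^ DIM('a)"
        by (simp add: power_mult_distrib algebra_simps)
      also have "U 0 * unit_ball_vol DIM('a) * ((1 - q ^ DIM('a)) * s ^ DIM('a)) \<le> U 0 * unit_ball_vol DIM('a) * ((1 - q ^ DIM('a)) * (\<rho> / q) ^ DIM('a))"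
        using q1 s U_nonneg by (intro mult_left_mono power_mono) auto
      also have "\<dots> = W * (1 / q ^ DIM('a) - 1)" using q by (simp add: W_def power_divide field_simps)
      finally show ?thesis using le q(3) by linarith
    qed
    show "V r \<le> M r t + e"
    proof (cases "r \<le> \<rho> / q")
      case False
      have rq: "0 \<le> \<rho> / q" "\<rho> \<le> \<rho> / q" using rho_pos q by (auto simp: field_simps)
      have "1 \<le> M (\<rho> / q) t + e" using main[of "\<rho> / q"] V_eq_1[OF rq(2)] rq by simp
      also have "\<dots> \<le> M r t + e" using mass_mono[of t "\<rho> / q" r] False rq t T by simp
      finally show ?thesis using V_eq_1[of r] False rq by simp
    qed (use main r in blast)
  qed
qed

text \<open>Masses of an annulus determine the values of an almost radially decreasing function up
  to the error in the masses divided by the volume. The annulus outside \<open>norm x\<close> bounds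
  \<open>u x t\<close> from below, the one inside bounds it from above.\<close>

lemma uniform_convergence:
  assumes e: "0 < e"
  shows "\<exists>T. \<forall>t\<ge>T. \<forall>x. \<bar>u x t - U x\<bar> \<le> e"
proof -
  define vol where "vol = unit_ball_vol DIM('a)"
  have vol: "vol > 0" by (simp add: vol_def)
  have e4: "0 < e / 4" using e by simp
  have "uniformly_continuous_on (cball 0 (\<rho> + 2)) U"
    by (rule compact_uniformly_continuous) (auto intro: continuous_on_subset[OF continuous_U])
  then obtain \<eta>0 where \<eta>0: "\<eta>0 > 0" "\<And>x y. x \<in> cball 0 (\<rho> + 2) \<Longrightarrow> y \<in> cball 0 (\<rho> + 2) \<Longrightarrow> dist y x < \<eta>0 \<Longrightarrow> dist (U y) (U x) < e / 4"
    using uniformly_continuous_onE[OF _ e4] by metis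
  define \<eta> where "\<eta> = min \<eta>0 1 / 2"
  have \<eta>: "0 < \<eta>" "\<eta> < \<eta>0" "\<eta> < 1" using \<eta>0 by (auto simp: \<eta>_def min_def)
  \<comment> \<open>Two mass errors divided by the volume of any annulus of width
    \<open>\<eta>\<close> then amount to at most \<open>e / 4\<close>.\<close>
  define E where "E = e / 8 * (vol * \<eta> ^ DIM('a))"
  have E: "0 < E" using e vol \<eta> by (simp add: E_def)
  obtain T1 where T1: "T1 > 0" "\<And>t r. T1 \<le> t \<Longrightarrow> 0 \<le> r \<Longrightarrow> M r t \<le> V r + E"
    using mass_convergence_upper[OF E] by metis
  obtain T2 where T2: "T2 > 0" "\<And>t r. T2 \<le> t \<Longrightarrow> 0 \<le> r \<Longrightarrow> V r \<le> M r t + E"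
    using mass_convergence_lower[OF E] by metis
  obtain T3 where T3: "\<And>t. T3 \<le> t \<Longrightarrow> u 0 t \<le> U 0 + e / 4"
    using mass_convergence_upper[OF e4] by metis
  define q where "q = \<rho> / (\<rho> + 1)"
  have q: "0 < q" "q < 1" "\<rho> / q = \<rho> + 1" using rho_pos by (auto simp: q_def)
  obtain T4 where T4: "\<And>t x. T4 \<le> t \<Longrightarrow> \<rho> + 1 \<le> norm x \<Longrightarrow> u x t = 0"
    using eventually_supported[OF q(1,2)] unfolding q(3) by metis
  obtain C \<kappa> T5 where T5: "0 < \<kappa>" "0 < T5"
      "\<And>t x y. T5 \<le> t \<Longrightarrow> norm y \<le> norm x \<Longrightarrow> u x t \<le> u y t + C * exp (- (\<kappa> * (t - T5)))"
    using reflection_decay by metis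
  have "\<forall>\<^sub>F t in at_top. C * exp (- (\<kappa> * (t - T5))) < e / 4"
    using exp_decay[OF T5(1)] by (rule order_tendstoD(2)) (use e in simp)
  then obtain T6 where T6: "\<And>t. T6 \<le> t \<Longrightarrow> C * exp (- (\<kappa> * (t - T5))) < e / 4"
    unfolding eventually_at_top_linorder by blast
  define T where "T = Max {T1, T2, T3, T4, T5, T6}"
  have T: "T1 \<le> T" "T2 \<le> T" "T3 \<le> T" "T4 \<le> T" "T5 \<le> T" "T6 \<le> T"
    unfolding T_def by (rule Max_ge; simp)+
  show ?thesis
  proof (intro exI allI impI)
    fix t and x :: 'a assume t: "T \<le> t"
    then have tp: "t > 0" using T T1(1) by linarith
    have mono: "u y t \<le> u z t + e / 4" if "norm z \<le> norm y" for y z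
      using T5(3)[of t z y] T6[of t] that t T by linarith
    have Mu: "M r t \<le> V r + E" if "0 \<le> r" for r using T1(2) that t T by simp
    have Ml: "V r \<le> M r t + E" if "0 \<le> r" for r using T2(2) that t T by simp
    show "\<bar>u x t - U x\<bar> \<le> e"
    proof (cases "\<rho> + 1 \<le> norm x")
      case True
      then show ?thesis using T4[of t x] U_zero[of x] t T e by simp
    next
      case False
      define r where "r = norm x"
      have r: "0 \<le> r" "r < \<rho> + 1" using False by (auto simp: r_def)
      have close: "\<bar>U y - U x\<bar> < e / 4" if "dist y x \<le> \<eta>" for y
      proof -
        have "norm y \<le> norm x + dist y x" by (simp add: dist_norm norm_triangle_sub)
        then have "dist (U y) (U x) < e / 4"
          using that r \<eta> by (intro \<eta>0(2)) (auto simp: r_def)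
        then show ?thesis by (simp add: dist_real_def)
      qed
      \<comment> \<open>Superadditivity of powers bounds the volume below independently of the inner
        radius; the smallest case is the ball.\<close>
      have annulus: "vol * \<eta> ^ DIM('a) \<le> vol * ((a + \<eta>) ^ DIM('a) - a ^ DIM('a))" if "0 \<le> a" for a
        using power_superadditive[of a \<eta> "DIM('a)"] that \<eta> vol by (intro mult_left_mono) auto
      have lower: "U x \<le> u x t + e"
      proof -
        obtain b :: 'a where b: "norm b = 1" "x = r *\<^sub>R b"
        proof (cases "x = 0")
          case True
          obtain b :: 'a where "norm b = 1" using vector_choose_size[of 1] by auto
          then show thesis using that[of b] True by (simp add: r_def)
        next
          case False
          then show thesis using that[of "(1 / norm x) *\<^sub>R x"] by (simp add: r_def)
        qed
        \<comment> \<open>On the annulus between \<open>r\<close> and \<open>r + \<eta>\<close>,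
          \<open>U\<close> is at least its value at the outermost point \<open>y\<close>, while
          \<open>u\<close> is at most \<open>u x t + e / 4\<close>.\<close>
        define y where "y = x + \<eta> *\<^sub>R b"
        have ny: "norm y = r + \<eta>"
        proof -
          have "y = (r + \<eta>) *\<^sub>R b" by (simp add: y_def b(2) scaleR_add_left)
          then show ?thesis using b(1) r \<eta> by simp
        qed
        have "dist y x \<le> \<eta>" using b(1) \<eta> by (simp add: y_def dist_norm)
        then have Uy: "U x - e / 4 \<le> U y" using close[of y] by linarith
        define v where "v = vol * ((r + \<eta>) ^ DIM('a) - r ^ DIM('a))"
        have v: "vol * \<eta> ^ DIM('a) \<le> v" "0 < v"
          using annulus[OF r(1)] vol \<eta> by (auto simp: v_def intro: less_le_trans[of 0 "vol * \<eta> ^ DIM('a)"])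
        have "U y * unit_ball_vol DIM('a) * ((r + \<eta>) ^ DIM('a) - r ^ DIM('a)) \<le> V (r + \<eta>) - V r"
          unfolding g_def using r \<eta> by (intro mass_annulus_ge[OF continuous_U] U_radially_decreasing) (auto simp: ny)
        also have "\<dots> \<le> (M (r + \<eta>) t - M r t) + 2 * E"
          using Ml[of "r + \<eta>"] Mu[of r] r \<eta> by simp
        also have "M (r + \<eta>) t - M r t \<le> (u x t + e / 4) * unit_ball_vol DIM('a) * ((r + \<eta>) ^ DIM('a) - r ^ DIM('a))"
          unfolding A_def using r \<eta> by (intro mass_annulus_le[OF continuous_slice[OF tp]] mono) (auto simp: r_def)
        finally have "U y * v \<le> (u x t + e / 4) * v + 2 * E" by (simp add: v_def vol_def mult.assoc)
        also have "2 * E \<le> e / 4 * v" using v(1) e by (simp add: E_def)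
        finally have "U y * v \<le> (u x t + e / 2) * v" by (simp add: algebra_simps)
        then have "U y \<le> u x t + e / 2" using v(2) by simp
        then show ?thesis using Uy e by linarith
      qed
      have upper: "u x t \<le> U x + e"
      \<comment> \<open>If no annulus of width \<open>\<eta>\<close> fits inside, the bound at the
        origin takes its place.\<close>
      proof (cases "r < \<eta>")
        case True
        have "u x t \<le> u 0 t + e / 4" by (rule mono) simp
        also have "u 0 t \<le> U 0 + e / 4" using T3 t T by simp
        also have "U 0 \<le> U x + e / 4"
        proof -
          have "\<bar>U 0 - U x\<bar> < e / 4" using True by (intro close) (simp add: r_def)
          then show ?thesis by linarith
        qed
        finally show ?thesis using e by linarith
      next
        case False
        then have r0: "0 < r" using \<eta> by simp
        define y where "y = (1 - \<eta> / r) *\<^sub>R x"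
        have ny: "norm y = r - \<eta>"
        proof -
          have "norm y = \<bar>1 - \<eta> / r\<bar> * r" by (simp add: y_def r_def)
          also have "\<bar>1 - \<eta> / r\<bar> = 1 - \<eta> / r" using False r0 by simp
          also have "(1 - \<eta> / r) * r = r - \<eta>" using r0 by (simp add: left_diff_distrib)
          finally show ?thesis .
        qed
        have "y - x = - ((\<eta> / r) *\<^sub>R x)" by (simp add: y_def scaleR_diff_left)
        then have "dist y x \<le> \<eta>" using r0 \<eta> by (simp add: dist_norm r_def)
        then have Uy: "U y \<le> U x + e / 4" using close[of y] by linarith
        define v where "v = vol * (r ^ DIM('a) - (r - \<eta>) ^ DIM('a))"
        have v: "vol * \<eta> ^ DIM('a) \<le> v" "0 < v"
          using annulus[of "r - \<eta>"] False vol \<eta> by (auto simp: v_def intro: less_le_trans[of 0 "vol * \<eta> ^ DIM('a)"])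
        have "(u x t - e / 4) * unit_ball_vol DIM('a) * (r ^ DIM('a) - (r - \<eta>) ^ DIM('a)) \<le> M r t - M (r - \<eta>) t"
          unfolding A_def
        proof (rule mass_annulus_ge[OF continuous_slice[OF tp]])
          show "u x t - e / 4 \<le> u z t" if "norm z \<le> r" for z using mono[of z x] that by (simp add: r_def)
        qed (use False \<eta> in auto)
        also have "\<dots> \<le> (V r - V (r - \<eta>)) + 2 * E"
          using Mu[of r] Ml[of "r - \<eta>"] r False by simp
        also have "V r - V (r - \<eta>) \<le> U y * unit_ball_vol DIM('a) * (r ^ DIM('a) - (r - \<eta>) ^ DIM('a))"
          unfolding g_def using False \<eta> by (intro mass_annulus_le[OF continuous_U] U_radially_decreasing) (auto simp: ny)
        finally have "(u x t - e / 4) * v \<le> U y * v + 2 * E" by (simp add: v_def vol_def mult.assoc)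
        also have "2 * E \<le> e / 4 * v" using v(1) e by (simp add: E_def)
        finally have "(u x t - e / 4) * v \<le> (U y + e / 4) * v" by (simp add: algebra_simps)
        then have "u x t - e / 4 \<le> U y + e / 4" using v(2) by simp
        then show ?thesis using Uy e by linarith
      qed
      show ?thesis using lower upper by (simp add: abs_le_iff)
    qed
  qed
qed

lemma esssup_tendsto: "((\<lambda>t. esssup lborel (\<lambda>x. ereal \<bar>u x t - U x\<bar>)) \<longlongrightarrow> 0) at_top"
proof -
  define N where "N = (\<lambda>t. esssup lborel (\<lambda>x. ereal \<bar>u x t - U x\<bar>))"
  have N0: "0 \<le> N t" for t
  proof -
    have "esssup lborel (\<lambda>x::'a. 0::ereal) = 0" by (rule esssup_const) simp
    moreover have "esssup lborel (\<lambda>x::'a. 0::ereal) \<le> N t" unfolding N_def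
      by (rule esssup_mono) auto
    ultimately show ?thesis by simp
  qed
  have "(N \<longlongrightarrow> 0) at_top"
  proof (rule order_tendstoI)
    fix a :: ereal assume "a < 0"
    then have "a < N t" for t using N0[of t] by (rule less_le_trans)
    then show "\<forall>\<^sub>F t in at_top. a < N t" by simp
  next
    fix a :: ereal assume "0 < a"
    then obtain e where e: "0 < ereal e" "ereal e < a" using ereal_dense2 by metis
    have "0 < e" using e(1) by simp
    obtain T where T: "\<forall>t\<ge>T. \<forall>x. \<bar>u x t - U x\<bar> \<le> e"
      using uniform_convergence[OF \<open>0 < e\<close>] by blast
    have "\<forall>\<^sub>F t in at_top. T \<le> t \<and> 0 < t"
      by (intro eventually_conj eventually_ge_at_top eventually_gt_at_top)
    then show "\<forall>\<^sub>F t in at_top. N t < a"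
    proof eventually_elim
      case (elim t)
      have "(\<lambda>x. ereal \<bar>u x t - U x\<bar>) \<in> borel_measurable lborel"
        using measurable_slice[of t] measurable_U elim by simp
      moreover have "AE x in lborel. ereal \<bar>u x t - U x\<bar> \<le> ereal e"
        using T elim by simp
      ultimately have "N t \<le> ereal e" unfolding N_def by (rule esssup_I)
      then show ?case using e(2) by (rule le_less_trans)
    qed
  qed
  then show ?thesis unfolding N_def .
qed

end

lemma classical_solution_fbp:
  assumes "classical_solution \<mu>0 u R" shows "fbp u R"
proof -
  note c1 = assms[unfolded classical_solution_def, THEN conjunct2]
  note c2 = c1[THEN conjunct2] note c3 = c2[THEN conjunct2] note c4 = c3[THEN conjunct2]
  note c5 = c4[THEN conjunct2] note c6 = c5[THEN conjunct2]
  show ?thesis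
  proof
    show "0 \<le> u x t" if "t > 0" for x t using c1[THEN conjunct1] that by simp
    show "continuous_on (UNIV \<times> {0<..}) (\<lambda>(x, t). u x t)" by (rule c2[THEN conjunct1])
    show "C21_on (positive_region R) u" by (rule c3[THEN conjunct1])
    show "deriv (u x) t = laplacian (\<lambda>y. u y t) x + u x t" if "(x, t) \<in> positive_region R" for x t
      using bspec[OF c4[THEN conjunct1] that] unfolding prod.case .
    show "u x t = 0" if "t > 0" "R t \<le> ennreal (norm x)" for x t using c5[THEN conjunct1] that by simp
    show "(\<integral>x. u x t \<partial>lborel) = 1" if "t > 0" for t using c6[THEN conjunct1] that by simp
  qed
qed

theorem theorem1p2:
  fixes \<mu>0 :: "'a::euclidean_space measure"
    and u :: "'a \<Rightarrow> real \<Rightarrow> real" and R :: "real \<Rightarrow> ennreal"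
    and R_inf :: real and U :: "'a \<Rightarrow> real"
  assumes "prob_space \<mu>0" and "sets \<mu>0 = sets borel"
    and "classical_solution \<mu>0 u R"
    and "normalized_ground_state R_inf U"
  shows "(R \<longlongrightarrow> ennreal R_inf) at_top \<and>
         ((\<lambda>t. esssup lborel (\<lambda>x. ereal \<bar>u x t - U x\<bar>)) \<longlongrightarrow> 0) at_top"
proof -
  interpret fbp_ground u R R_inf U
    by (intro fbp_ground.intro classical_solution_fbp[OF assms(3)] ground_state.intro assms(4))
  show ?thesis using radius_tendsto esssup_tendsto by blast
qed

end
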